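(* Let $k,w,s,n\in\mathbb Z_{>0}$ with $n\ge sk$. For an indeterminate $\alpha$, \[ \frac{P_{\delta_{k+1}^{(w,s)}}^{(\alpha)}(\mathbf 1_n)} {P_{\delta_k^{(w,s)}}^{(\alpha)}(\mathbf 1_n)} = \frac{ \widetilde N_k^{(w,s)}\left( n+\frac{\alpha(wk-1)-(sk-1)}{2};\alpha\right)} { \widetilde N_k^{(w,s)}\left( sk+\frac{\alpha(wk-1)-(sk-1)}{2};\alpha\right)}. \]
   Context: Partitions are weakly decreasing sequences of nonnegative integers with finitely many nonzero parts. Exponents on parts denote multiplicities. Generalized staircase partitions: for $w,s\in\mathbb Z_{>0}$, $\delta_1^{(w,s)}=\varnothing$ and, for $k\ge2$, $\delta_k^{(w,s)}=\bigl((w(k-1))^s,(w(k-2))^s,\ldots,w^s\bigr)$. For $m\in\mathbb Z_{>0}$, $I_m=\left\{r-\frac{m-1}{2}:r\in\mathbb Z,\ 0\le r<m\right\}$. The additive centered product is \[ \widetilde N_k^{(w,s)}(x;\alpha)=\prod_{(r,i,j)\in I_k\times I_s\times I_w}\bigl(x+\alpha(j+wr)+i+sr\bigr). \] $P_\lambda^{(\alpha)}$ is the monic Jack polynomial (coefficient of the monomial symmetric function $m_\lambda$ equal to $1$), defined as the limit of the monic Macdonald polynomial $P_\lambda(\cdot;q,t)$ with $q=t^\alpha$ as $t\to1$; its coefficients are rational functions of $\alpha$; $P^{(\alpha)}_\varnothing=1$. $\mathbf 1_n=(1,\ldots,1)$ ($n$ entries). *)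

theory Defs
  imports
    "HOL-Computational_Algebra.Computational_Algebra"
    "HOL-Library.Poly_Mapping"
begin

text \<open>
  A partition is a weakly decreasing sequence of natural numbers with finitely many nonzero
  entries. The index of the first part is 0. The same type serves for exponent vectors of
  monomials in the variables \<open>x\<^sub>0, x\<^sub>1, x\<^sub>2, \<dots>\<close>.
\<close>

definition is_partition :: "(nat \<Rightarrow>\<^sub>0 nat) \<Rightarrow> bool" where
  "is_partition lam \<longleftrightarrow> antimono (Poly_Mapping.lookup lam)"

definition psize :: "(nat \<Rightarrow>\<^sub>0 nat) \<Rightarrow> nat" where
  "psize lam = (\<Sum>i\<in>Poly_Mapping.keys lam. Poly_Mapping.lookup lam i)"

definition dominated :: "(nat \<Rightarrow>\<^sub>0 nat) \<Rightarrow> (nat \<Rightarrow>\<^sub>0 nat) \<Rightarrow> bool" where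
  "dominated mu lam \<longleftrightarrow>
     psize mu = psize lam \<and>
     (\<forall>k. (\<Sum>i<k. Poly_Mapping.lookup mu i) \<le> (\<Sum>i<k. Poly_Mapping.lookup lam i))"

definition staircase :: "nat \<Rightarrow> nat \<Rightarrow> nat \<Rightarrow> (nat \<Rightarrow>\<^sub>0 nat)" where
  "staircase w s k =
     Poly_Mapping.nth (concat (map (\<lambda>j. replicate s (w * j)) (rev [1..<k])))"


text \<open>
  Polynomials in \<open>x\<^sub>0, x\<^sub>1, \<dots>\<close> over \<open>'a\<close> are finitely supported maps from exponent vectors to
  coefficients. A symmetric function \<open>f\<close> is represented as an element of the inverse limit of the
  rings of symmetric polynomials: \<open>f n\<close> is the polynomial \<open>f(x\<^sub>0, \<dots>, x\<^sub>n\<^sub>-\<^sub>1)\<close>.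
\<close>

type_synonym 'a mpol = "(nat \<Rightarrow>\<^sub>0 nat) \<Rightarrow>\<^sub>0 'a"
type_synonym 'a symfun = "nat \<Rightarrow> 'a mpol"

definition mconst :: "'a::zero \<Rightarrow> 'a mpol" where
  "mconst c = Poly_Mapping.single 0 c"

definition mvar :: "nat \<Rightarrow> 'a::{zero,one} mpol" where
  "mvar j = Poly_Mapping.single (Poly_Mapping.single j 1) 1"

definition mpol_value :: "'a::comm_semiring_1 mpol \<Rightarrow> (nat \<Rightarrow> 'a) \<Rightarrow> 'a" where
  "mpol_value f x =
     (\<Sum>e\<in>Poly_Mapping.keys f.
        Poly_Mapping.lookup f e * (\<Prod>i\<in>Poly_Mapping.keys e. x i ^ Poly_Mapping.lookup e i))"

definition monomial_sym :: "(nat \<Rightarrow>\<^sub>0 nat) \<Rightarrow> 'a::comm_semiring_1 symfun" where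
  "monomial_sym lam n =
     (\<Sum>e\<in>{e. Poly_Mapping.keys e \<subseteq> {..<n} \<and>
             (\<exists>\<pi>. bij \<pi> \<and> Poly_Mapping.lookup e = Poly_Mapping.lookup lam \<circ> \<pi>)}.
        Poly_Mapping.single e 1)"

definition power_sym :: "(nat \<Rightarrow>\<^sub>0 nat) \<Rightarrow> 'a::comm_semiring_1 symfun" where
  "power_sym lam n =
     (\<Prod>i\<in>Poly_Mapping.keys lam. \<Sum>j<n. mvar j ^ Poly_Mapping.lookup lam i)"

text \<open>
  The coefficients in the expansion of a symmetric function in the basis of power sum products
  (a basis because the ground field will have characteristic zero).
\<close>

definition power_coeffs :: "'a::field symfun \<Rightarrow> (nat \<Rightarrow>\<^sub>0 nat) \<Rightarrow>\<^sub>0 'a" where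
  "power_coeffs f =
     (THE a. Poly_Mapping.keys a \<subseteq> Collect is_partition \<and>
             (\<forall>n. f n = (\<Sum>lam\<in>Poly_Mapping.keys a.
                           mconst (Poly_Mapping.lookup a lam) * power_sym lam n)))"

text \<open>\<open>z\<^sub>\<lambda> = \<Prod>\<^sub>r r^(m\<^sub>r) m\<^sub>r!\<close>, where \<open>m\<^sub>r\<close> is the number of parts equal to \<open>r \<ge> 1\<close>.\<close>

definition z_part :: "(nat \<Rightarrow>\<^sub>0 nat) \<Rightarrow> nat" where
  "z_part lam =
     (\<Prod>r\<in>Poly_Mapping.lookup lam ` Poly_Mapping.keys lam.
        r ^ card {i. Poly_Mapping.lookup lam i = r} * fact (card {i. Poly_Mapping.lookup lam i = r}))"

definition z_qt :: "'a::field \<Rightarrow> 'a \<Rightarrow> (nat \<Rightarrow>\<^sub>0 nat) \<Rightarrow> 'a" where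
  "z_qt q t lam =
     of_nat (z_part lam) *
     (\<Prod>i\<in>Poly_Mapping.keys lam.
        (1 - q ^ Poly_Mapping.lookup lam i) / (1 - t ^ Poly_Mapping.lookup lam i))"

text \<open>
  The \<open>(q,t)\<close>-scalar product, i.e. the bilinear form in which the power sum products are
  orthogonal with squared norms \<open>z_qt q t\<close>.
\<close>

definition qt_scalar :: "'a::field \<Rightarrow> 'a \<Rightarrow> 'a symfun \<Rightarrow> 'a symfun \<Rightarrow> 'a" where
  "qt_scalar q t f g =
     (\<Sum>lam\<in>Poly_Mapping.keys (power_coeffs f).
        Poly_Mapping.lookup (power_coeffs f) lam * Poly_Mapping.lookup (power_coeffs g) lam *
        z_qt q t lam)"

definition is_macdonald_family ::
  "'a::field \<Rightarrow> 'a \<Rightarrow> ((nat \<Rightarrow>\<^sub>0 nat) \<Rightarrow> 'a symfun) \<Rightarrow> bool" where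
  "is_macdonald_family q t P \<longleftrightarrow>
     (\<forall>lam. is_partition lam \<longrightarrow>
        (\<exists>u. \<forall>n. P lam n =
           monomial_sym lam n +
           (\<Sum>mu\<in>{mu. is_partition mu \<and> dominated mu lam \<and> mu \<noteq> lam}.
              mconst (u mu) * monomial_sym mu n))) \<and>
     (\<forall>lam mu. is_partition lam \<longrightarrow> is_partition mu \<longrightarrow> lam \<noteq> mu \<longrightarrow>
        qt_scalar q t (P lam) (P mu) = 0)"

text \<open>
  The monic Macdonald polynomial of a partition; for \<open>q\<close> and \<open>t\<close> algebraically independent
  over the rationals there is exactly one such family on partitions.
\<close>

definition macdonald :: "'a::field \<Rightarrow> 'a \<Rightarrow> (nat \<Rightarrow>\<^sub>0 nat) \<Rightarrow> 'a symfun" where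
  "macdonald q t lam = (THE f. \<exists>P. is_macdonald_family q t P \<and> f = P lam)"


text \<open>
  The field \<open>\<rat>(\<alpha>)\<close> and its indeterminate. As \<open>\<alpha>\<close> is an indeterminate, the limit \<open>t \<rightarrow> 1\<close> along
  \<open>q = t^\<alpha>\<close> is taken in the Laurent series field \<open>\<rat>(\<alpha>)((z))\<close> with \<open>t = 1 + z\<close>, \<open>z \<rightarrow> 0\<close>, where
  \<open>t^\<alpha>\<close> is the binomial series \<open>(1 + z)^\<alpha>\<close>. There \<open>t\<close> and \<open>t^\<alpha>\<close> are algebraically independent over
  the rationals, so that \<open>\<rat>(q,t)\<close> embeds into \<open>\<rat>(\<alpha>)((z))\<close> by \<open>t \<mapsto> 1 + z\<close>, \<open>q \<mapsto> (1 + z)^\<alpha>\<close>.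
\<close>

type_synonym ratfun = "rat poly fract"

definition alpha :: ratfun where
  "alpha = Fract [:0, 1:] 1"

definition t_param :: "ratfun fls" where
  "t_param = 1 + fls_X"

definition q_param :: "ratfun fls" where
  "q_param = fps_to_fls (fps_binomial alpha)"

definition has_limit_0 :: "'a::zero fls \<Rightarrow> 'a \<Rightarrow> bool" where
  "has_limit_0 f c \<longleftrightarrow> fls_subdegree f \<ge> 0 \<and> fls_nth f 0 = c"

text \<open>The limit of the Macdonald polynomial in \<open>n\<close> variables is taken coefficientwise.\<close>

definition jack :: "(nat \<Rightarrow>\<^sub>0 nat) \<Rightarrow> ratfun symfun" where
  "jack lam n =
     (THE g. \<forall>e. has_limit_0 (Poly_Mapping.lookup (macdonald q_param t_param lam n) e)
                             (Poly_Mapping.lookup g e))"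

definition jack_at_ones :: "(nat \<Rightarrow>\<^sub>0 nat) \<Rightarrow> nat \<Rightarrow> ratfun" where
  "jack_at_ones lam n = mpol_value (jack lam n) (\<lambda>_. 1)"


definition centered :: "nat \<Rightarrow> 'a::field_char_0 set" where
  "centered m = (\<lambda>r. of_nat r - (of_nat m - 1) / 2) ` {..<m}"

definition centered_prod :: "nat \<Rightarrow> nat \<Rightarrow> nat \<Rightarrow> 'a::field_char_0 \<Rightarrow> 'a \<Rightarrow> 'a" where
  "centered_prod w s k x a =
     (\<Prod>(r, i, j)\<in>centered k \<times> centered s \<times> centered w.
        x + a * (j + of_nat w * r) + i + of_nat s * r)"

end

theory Submission
  imports Defs "HOL-Combinatorics.Permutations"
begin

text \<open>
  Two facts about \<open>J_lam(n)\<close>, the Jack polynomial of \<open>lam\<close> at \<open>n\<close> ones, determine the ratio.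
  The first is the evaluation \<open>J_lam(n) = C \<Prod> (n + alpha j - i)\<close> over the cells \<open>(i, j)\<close> of \<open>lam\<close>
  (rows and columns counted from 0), where \<open>C\<close> does not depend on \<open>n\<close> (\<open>jack_evaluation\<close>). The
  second is removal of columns: in \<open>N\<close> variables, adding a column of length \<open>N\<close> to a partition with
  at most \<open>N\<close> parts multiplies its polynomial by \<open>x_0 \<cdots> x_(N-1)\<close>, which is invisible at ones
  (\<open>jack_at_ones_add_column\<close>). The staircase \<open>delta_(k+1)\<close> arises from \<open>delta_k\<close> by adding \<open>w\<close>
  columns of length \<open>s k\<close>. Hence the two staircases have the same value at \<open>n = s k\<close>, while for general
  \<open>n\<close> their ratio is a constant times the product of \<open>n + alpha j - i\<close> over the added cells. The value 1
  at \<open>n = s k\<close> fixes the constant, and the product over the added cells is the centered product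
  (\<open>jack_staircase_ratio\<close>, \<open>strip_prod_eq_centered_prod\<close>). No hook lengths enter.

  Both facts come from Macdonald polynomials before the limit. A symmetric function is handled as a
  polynomial in the power sums, where the scalar product is diagonal; \<open>in_vars n\<close> restricts it to \<open>n\<close>
  variables. Macdonald's operator is written as \<open>\<Sum>\<^sub>m A_m B_m\<close>, where \<open>A_m\<close> multiplies by the coefficient of
  \<open>z^m\<close> in \<open>\<Prod> (1 - z x_i / t) / (1 - z x_i)\<close> and \<open>B_m\<close> takes the coefficient of \<open>y^m\<close> after the substitution
  \<open>p_r \<mapsto> p_r + (q^r - 1) y^r\<close>. Up to the factor \<open>t^(-m)\<close> these are adjoint to each other, so the operator
  is self-adjoint (\<open>macop_selfadjoint\<close>). On \<open>n\<close> variables a partial fraction expansion identifies it with the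
  \<open>q\<close>-difference operator (\<open>vandermonde_macop\<close>), and after multiplication by the Vandermonde product its
  triangularity for dominance can be read off. Its eigenvalues separate partitions, and its
  eigenfunctions are the Macdonald polynomials (\<open>macdonald_eq_mac\<close>).

  Multiplication by \<open>x_0 \<cdots> x_(n-1)\<close> maps eigenfunctions of the operator in \<open>n\<close> variables to eigenfunctions,
  which gives removal of columns (\<open>in_vars_mac_add_column\<close>). For the evaluation, specialize
  \<open>p_r \<mapsto> (1 - u^r) / (1 - t^r)\<close> in the commutator of the operator with the derivative by \<open>p_1\<close>. The result
  expresses the value of \<open>P_lam\<close> through values of \<open>P_mu\<close>, where \<open>mu\<close> is \<open>lam\<close> with one cell removed, and the
  coefficient of the latter is a multiple of \<open>u q^j / t^i - 1\<close> for the removed cell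
  (\<open>pieri_support\<close>, \<open>principal_specialization\<close>).

  For the limit, \<open>\<rat>(alpha)\<close> is an ordered field with \<open>alpha > 0\<close>, in which the limiting scalar product is
  positive definite. This makes the norms nonzero before the limit and excludes poles at \<open>z = 0\<close>
  (\<open>anisotropic_concrete\<close>, \<open>mac_regular\<close>), so that both facts pass to Jack polynomials.
\<close>

section \<open>Polynomials and substitution homomorphisms\<close>

abbreviation lookup :: "('k \<Rightarrow>\<^sub>0 'v::zero) \<Rightarrow> 'k \<Rightarrow> 'v" where
  "lookup \<equiv> Poly_Mapping.lookup"

abbreviation keys :: "('k \<Rightarrow>\<^sub>0 'v::zero) \<Rightarrow> 'k set" where
  "keys \<equiv> Poly_Mapping.keys"

abbreviation single :: "'k \<Rightarrow> 'v::zero \<Rightarrow> ('k \<Rightarrow>\<^sub>0 'v)" where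
  "single \<equiv> Poly_Mapping.single"

definition semiring_hom :: "('a::semiring_1 \<Rightarrow> 'b::semiring_1) \<Rightarrow> bool" where
  "semiring_hom h \<longleftrightarrow> h 0 = 0 \<and> h 1 = 1 \<and> (\<forall>x y. h (x + y) = h x + h y) \<and>
     (\<forall>x y. h (x * y) = h x * h y)"

lemma semiring_hom_0: "semiring_hom h \<Longrightarrow> h 0 = 0"
  and semiring_hom_1: "semiring_hom h \<Longrightarrow> h 1 = 1"
  and semiring_hom_add: "semiring_hom h \<Longrightarrow> h (x + y) = h x + h y"
  and semiring_hom_mult: "semiring_hom h \<Longrightarrow> h (x * y) = h x * h y"
  by (auto simp: semiring_hom_def)

lemma semiring_hom_sum: "semiring_hom h \<Longrightarrow> h (sum f A) = (\<Sum>x\<in>A. h (f x))"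
  by (induction A rule: infinite_finite_induct) (auto simp: semiring_hom_0 semiring_hom_add)

lemma semiring_hom_prod:
  "semiring_hom h \<Longrightarrow> h (prod f A) = (\<Prod>x\<in>A. h (f x))" for h :: "'a::comm_semiring_1 \<Rightarrow> 'b::comm_semiring_1"
  by (induction A rule: infinite_finite_induct) (auto simp: semiring_hom_1 semiring_hom_mult)

lemma semiring_hom_power: "semiring_hom h \<Longrightarrow> h (x ^ n) = h x ^ n"
  by (induction n) (auto simp: semiring_hom_1 semiring_hom_mult)

lemma semiring_hom_uminus:
  "semiring_hom h \<Longrightarrow> h (- x) = - h x" for h :: "'a::ring_1 \<Rightarrow> 'b::ring_1"
  by (metis add.right_inverse add_eq_0_iff semiring_hom_0 semiring_hom_add)

lemma semiring_hom_diff: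
  "semiring_hom h \<Longrightarrow> h (x - y) = h x - h y" for h :: "'a::ring_1 \<Rightarrow> 'b::ring_1"
  by (metis diff_conv_add_uminus semiring_hom_add semiring_hom_uminus)

lemma semiring_hom_comp: "semiring_hom f \<Longrightarrow> semiring_hom g \<Longrightarrow> semiring_hom (\<lambda>x. f (g x))"
  by (auto simp: semiring_hom_def)

lemma semiring_hom_id: "semiring_hom (\<lambda>x. x)"
  by (auto simp: semiring_hom_def)

lemma semiring_hom_mconst: "semiring_hom (mconst :: 'a::comm_semiring_1 \<Rightarrow> _)"
  by (auto simp: semiring_hom_def mconst_def mult_single single_add)

lemma semiring_hom_const_poly: "semiring_hom (\<lambda>c::'a::comm_semiring_1. [:c:])"
  by (auto simp: semiring_hom_def one_pCons mult.commute)

lemmas mconst_0 [simp] = semiring_hom_0[OF semiring_hom_mconst]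
lemmas mconst_1 [simp] = semiring_hom_1[OF semiring_hom_mconst]
lemmas mconst_add = semiring_hom_add[OF semiring_hom_mconst]
lemmas mconst_mult = semiring_hom_mult[OF semiring_hom_mconst]
lemmas mconst_uminus = semiring_hom_uminus[OF semiring_hom_mconst]
lemmas mconst_diff = semiring_hom_diff[OF semiring_hom_mconst]
lemmas mconst_power = semiring_hom_power[OF semiring_hom_mconst]

lemma mconst_of_nat: "mconst (of_nat n) = of_nat n"
  by (simp add: mconst_def)

lemma lookup_mconst_mult: "lookup (mconst c * f) e = c * lookup f e"
  for f :: "'a::comm_semiring_1 mpol"
  unfolding mconst_def mult_map_scale_conv_mult [symmetric] by (auto simp: Poly_Mapping.map.rep_eq when_def)

lemma mpol_eq_sum_single:
  fixes f :: "'k \<Rightarrow>\<^sub>0 'a::comm_monoid_add"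
  assumes "finite S" "keys f \<subseteq> S"
  shows "f = (\<Sum>e\<in>S. single e (lookup f e))"
proof (rule poly_mapping_eqI)
  fix k
  have "lookup (\<Sum>e\<in>S. single e (lookup f e)) k = (\<Sum>e\<in>S. if e = k then lookup f k else 0)"
    unfolding lookup_sum by (rule sum.cong) (auto simp: lookup_single)
  also have "\<dots> = lookup f k"
    using assms by (auto simp: in_keys_iff)
  finally show "lookup f k = lookup (\<Sum>e\<in>S. single e (lookup f e)) k" ..
qed

definition monomial_value :: "(nat \<Rightarrow> 'b::comm_semiring_1) \<Rightarrow> (nat \<Rightarrow>\<^sub>0 nat) \<Rightarrow> 'b" where
  "monomial_value g e = (\<Prod>i\<in>keys e. g i ^ lookup e i)"

lemma monomial_value_superset:
  "finite S \<Longrightarrow> keys e \<subseteq> S \<Longrightarrow> monomial_value g e = (\<Prod>i\<in>S. g i ^ lookup e i)"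
  unfolding monomial_value_def by (rule prod.mono_neutral_left) (auto simp: in_keys_iff)

lemma monomial_value_add: "monomial_value g (d + e) = monomial_value g d * monomial_value g e"
proof -
  let ?S = "keys d \<union> keys e"
  have "keys (d + e) \<subseteq> ?S" by (rule keys_add)
  then show ?thesis
    by (simp add: monomial_value_superset[of ?S] lookup_add power_add prod.distrib)
qed

lemma monomial_value_0 [simp]: "monomial_value g 0 = 1"
  by (simp add: monomial_value_def)

lemma monomial_value_single: "monomial_value g (single i n) = g i ^ n"
  by (simp add: monomial_value_def)

lemma monomial_value_mvar: "monomial_value mvar e = (single e 1 :: 'a::comm_semiring_1 mpol)"
proof -
  have pow: "mvar i ^ n = (single (single i n) 1 :: 'a mpol)" for i n
    by (induction n) (auto simp: mvar_def mult_single single_add [symmetric])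
  have "finite S \<Longrightarrow> (\<Prod>i\<in>S. mvar i ^ lookup e i :: 'a mpol) = single (\<Sum>i\<in>S. single i (lookup e i)) 1" for S
    by (induction S rule: finite_induct) (auto simp: pow mult_single)
  then show ?thesis
    using mpol_eq_sum_single[of "keys e" e] by (simp add: monomial_value_def)
qed

lemma single_eq_monomial: "single e c = mconst c * monomial_value mvar e"
  by (simp add: monomial_value_mvar mconst_def mult_single)

lemma mpol_induct [case_names const var add mult]:
  fixes f :: "'a::comm_semiring_1 mpol"
  assumes c: "\<And>c. P (mconst c)" and v: "\<And>i. P (mvar i)"
    and a: "\<And>f g. P f \<Longrightarrow> P g \<Longrightarrow> P (f + g)" and m: "\<And>f g. P f \<Longrightarrow> P g \<Longrightarrow> P (f * g)"
  shows "P f"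
proof -
  have 1: "P 1" and 0: "P 0" using c[of 1] c[of 0] by auto
  have pow: "P g \<Longrightarrow> P (g ^ n)" for g n by (induction n) (auto intro: m 1)
  have pr: "finite S \<Longrightarrow> (\<And>i. i \<in> S \<Longrightarrow> P (h i)) \<Longrightarrow> P (prod h S)" for S and h :: "nat \<Rightarrow> 'a mpol"
    by (induction S rule: finite_induct) (auto intro: m 1)
  have sm: "finite S \<Longrightarrow> (\<And>i. i \<in> S \<Longrightarrow> P (h i)) \<Longrightarrow> P (sum h S)"
    for S and h :: "(nat \<Rightarrow>\<^sub>0 nat) \<Rightarrow> 'a mpol"
    by (induction S rule: finite_induct) (auto intro: a 0)
  have "P (\<Sum>e\<in>keys f. single e (lookup f e))"
    by (rule sm) (auto simp: single_eq_monomial monomial_value_def intro!: m c pr pow v)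
  then show ?thesis using mpol_eq_sum_single[of "keys f" f] by simp
qed

lemma mpol_hom_eqI:
  fixes F G :: "'a::comm_semiring_1 mpol \<Rightarrow> 'b::comm_semiring_1"
  assumes "semiring_hom F" "semiring_hom G"
    and "\<And>c. F (mconst c) = G (mconst c)" "\<And>i. F (mvar i) = G (mvar i)"
  shows "F f = G f"
  by (induction f rule: mpol_induct) (simp_all add: assms semiring_hom_add semiring_hom_mult)

definition msub :: "('a::comm_semiring_1 \<Rightarrow> 'b::comm_semiring_1) \<Rightarrow> (nat \<Rightarrow> 'b) \<Rightarrow> 'a mpol \<Rightarrow> 'b" where
  "msub h g f = (\<Sum>e\<in>keys f. h (lookup f e) * monomial_value g e)"

lemma msub_single: "semiring_hom h \<Longrightarrow> msub h g (single e c) = h c * monomial_value g e"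
  by (simp add: msub_def semiring_hom_0)

lemma msub_add: "semiring_hom h \<Longrightarrow> msub h g (f1 + f2) = msub h g f1 + msub h g f2"
  unfolding msub_def
  by (rule setsum_keys_plus_distrib) (auto simp: semiring_hom_0 semiring_hom_add algebra_simps)

lemma msub_0: "msub h g 0 = 0"
  by (simp add: msub_def)

lemma msub_sum: "semiring_hom h \<Longrightarrow> msub h g (sum f S) = (\<Sum>x\<in>S. msub h g (f x))"
  by (induction S rule: infinite_finite_induct) (auto simp: msub_0 msub_add)

lemma msub_mult:
  assumes h: "semiring_hom h"
  shows "msub h g (f1 * f2) = msub h g f1 * msub h g f2"
proof -
  have "f1 * f2 = (\<Sum>e\<in>keys f1. single e (lookup f1 e)) * (\<Sum>e\<in>keys f2. single e (lookup f2 e))"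
    using mpol_eq_sum_single[of "keys f1" f1] mpol_eq_sum_single[of "keys f2" f2] by simp
  also have "\<dots> = (\<Sum>d\<in>keys f1. \<Sum>e\<in>keys f2. single (d + e) (lookup f1 d * lookup f2 e))"
    by (simp add: sum_product mult_single)
  also have "msub h g \<dots> = (\<Sum>d\<in>keys f1. \<Sum>e\<in>keys f2. h (lookup f1 d * lookup f2 e) * monomial_value g (d + e))"
    by (simp add: msub_sum[OF h] msub_single[OF h])
  also have "\<dots> = msub h g f1 * msub h g f2"
    by (simp add: msub_def sum_product monomial_value_add semiring_hom_mult[OF h] algebra_simps)
  finally show ?thesis .
qed

lemma msub_mconst: "semiring_hom h \<Longrightarrow> msub h g (mconst c) = h c"
  by (simp add: mconst_def msub_single)

lemma msub_mvar: "semiring_hom h \<Longrightarrow> msub h g (mvar i) = g i"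
  by (simp add: mvar_def msub_single monomial_value_single semiring_hom_1)

lemma semiring_hom_msub: "semiring_hom h \<Longrightarrow> semiring_hom (msub h g)"
  unfolding semiring_hom_def[of "msub h g"]
  using msub_mconst[of h g 1] by (auto simp: msub_0 msub_add msub_mult semiring_hom_1)

lemma mpol_value_eq_msub: "mpol_value f x = msub (\<lambda>c. c) x f"
  by (simp add: mpol_value_def msub_def monomial_value_def)

lemma lookup_single_mult_add:
  fixes f :: "'a::comm_semiring_1 mpol"
  shows "lookup (single d c * f) (d + e) = c * lookup f e"
proof -
  have "single d c * f = (\<Sum>e\<in>keys f. single (d + e) (c * lookup f e))"
    using mpol_eq_sum_single[of "keys f" f]
    by (metis (no_types, lifting) finite_keys mult_single order_refl sum.cong sum_distrib_left)
  then have "lookup (single d c * f) (d + e) = (\<Sum>e'\<in>keys f. if e' = e then c * lookup f e else 0)"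
    by (auto simp: lookup_sum lookup_single when_def intro!: sum.cong)
  also have "\<dots> = c * lookup f e"
    by (auto simp: in_keys_iff)
  finally show ?thesis .
qed

lemma keys_single_mult: "keys (single d c * f) \<subseteq> (+) d ` keys f"
  for f :: "'a::comm_semiring_1 mpol"
  using keys_mult[of "single d c" f] by (auto split: if_splits)

lemma lookup_single_mult:
  fixes f :: "'a::comm_semiring_1 mpol"
  shows "lookup (single d c * f) e =
    (if \<forall>i. lookup d i \<le> lookup e i then c * lookup f (e - d) else 0)"
proof (cases "\<forall>i. lookup d i \<le> lookup e i")
  case True
  then have "e = d + (e - d)"
    by (intro poly_mapping_eqI) (simp add: lookup_add lookup_minus)
  then show ?thesis using True lookup_single_mult_add[of d c f "e - d"] by simp
next
  case False
  then have "e \<notin> keys (single d c * f)"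
    using keys_single_mult[of d c f] by (auto simp: lookup_add)
  then show ?thesis using False by (auto simp: in_keys_iff)
qed

section \<open>Exponents, dominance and rearrangements\<close>

definition part_sum :: "nat \<Rightarrow> (nat \<Rightarrow>\<^sub>0 nat) \<Rightarrow> nat" where
  "part_sum k e = (\<Sum>i<k. lookup e i)"

lemma part_sum_add: "part_sum k (d + e) = part_sum k d + part_sum k e"
  by (simp add: part_sum_def lookup_add sum.distrib)

lemma psize_superset: "finite S \<Longrightarrow> keys e \<subseteq> S \<Longrightarrow> psize e = (\<Sum>i\<in>S. lookup e i)"
  unfolding psize_def by (rule sum.mono_neutral_left) (auto simp: in_keys_iff)

lemma psize_eq_part_sum: "keys e \<subseteq> {..<k} \<Longrightarrow> psize e = part_sum k e"
  by (simp add: part_sum_def psize_superset)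

lemma psize_add: "psize (d + e) = psize d + psize e"
  using keys_add[of d e]
  by (simp add: psize_superset[of "keys d \<union> keys e"] lookup_add sum.distrib)

lemma psize_single [simp]: "psize (single i n) = n"
  by (simp add: psize_def)

lemma psize_0 [simp]: "psize 0 = 0"
  by (simp add: psize_def)

lemma lookup_le_psize: "lookup e i \<le> psize e"
proof (cases "i \<in> keys e")
  case True
  then show ?thesis unfolding psize_def by (intro member_le_sum) auto
qed (auto simp: in_keys_iff)

lemma dominated_iff: "dominated d e \<longleftrightarrow> psize d = psize e \<and> (\<forall>k. part_sum k d \<le> part_sum k e)"
  by (simp add: dominated_def part_sum_def)

lemma dominated_refl [simp]: "dominated e e"
  by (simp add: dominated_iff)

lemma dominated_trans: "dominated c d \<Longrightarrow> dominated d e \<Longrightarrow> dominated c e"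
  unfolding dominated_iff by (auto intro: le_trans)

lemma part_sum_Suc: "part_sum (Suc k) e = part_sum k e + lookup e k"
  by (simp add: part_sum_def)

lemma exponent_eq_if_part_sum_eq: "(\<And>k. part_sum k d = part_sum k e) \<Longrightarrow> d = e"
  by (rule poly_mapping_eqI) (metis add_left_cancel part_sum_Suc)

lemma dominated_add:
  "dominated d d' \<Longrightarrow> dominated e e' \<Longrightarrow> dominated (d + e) (d' + e')"
  by (auto simp: dominated_iff part_sum_add psize_add intro: add_mono)

lemma dominated_add_left_iff: "dominated (c + d) (c + e) \<longleftrightarrow> dominated d e"
  by (auto simp: dominated_iff part_sum_add psize_add)

lemma dominated_antisym: "dominated d e \<Longrightarrow> dominated e d \<Longrightarrow> d = e"
  by (rule exponent_eq_if_part_sum_eq) (auto simp: dominated_iff intro: antisym)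

text \<open>At the first position where two exponents differ, the next partial sum decides both orders. So
  the lexicographic order, which is linear, refines dominance, and \<open>Max\<close> finds exponents that are
  maximal for dominance.\<close>

lemma dominated_imp_le:
  assumes "dominated d e"
  shows "d \<le> e"
proof (cases "d = e")
  case False
  then have ex: "\<exists>k. lookup d k \<noteq> lookup e k" by (metis poly_mapping_eqI)
  define k where "k = (LEAST k. lookup d k \<noteq> lookup e k)"
  have k: "lookup d k \<noteq> lookup e k" "\<And>i. i < k \<Longrightarrow> lookup d i = lookup e i"
    using LeastI_ex[OF ex] not_less_Least unfolding k_def by blast+
  have "part_sum k d = part_sum k e" using k(2) by (simp add: part_sum_def)
  with assms have "lookup d k \<le> lookup e k"
    unfolding dominated_iff by (metis part_sum_Suc nat_add_left_cancel_le)
  with k have "less_fun (lookup d) (lookup e)"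
    unfolding less_fun_def by (intro exI[of _ k]) auto
  then show ?thesis by (simp add: less_eq_poly_mapping.rep_eq)
qed simp

lemma is_partition_le: "is_partition lam \<Longrightarrow> i \<le> j \<Longrightarrow> lookup lam j \<le> lookup lam i"
  by (simp add: is_partition_def antimono_def)

lemma partition_keys_subset:
  assumes "is_partition lam" "psize lam \<le> m"
  shows "keys lam \<subseteq> {..<m}"
proof
  fix i assume i: "i \<in> keys lam"
  have "lookup lam j \<ge> 1" if "j \<le> i" for j
    using is_partition_le[OF assms(1) that] i by (simp add: in_keys_iff)
  then have sub: "{..i} \<subseteq> keys lam" by (force simp: in_keys_iff)
  have "card {..i} \<le> card (keys lam)" by (rule card_mono) (use sub in auto)
  also have "\<dots> = (\<Sum>j\<in>keys lam. 1)" by simp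
  also have "\<dots> \<le> psize lam" unfolding psize_def by (rule sum_mono) (simp add: in_keys_iff)
  finally show "i \<in> {..<m}" using assms(2) by simp
qed

lemma finite_exponents:
  assumes "finite A" "finite B"
  shows "finite {e :: nat \<Rightarrow>\<^sub>0 nat. keys e \<subseteq> A \<and> lookup e ` A \<subseteq> B}"
proof (rule finite_imageD)
  show "finite (lookup ` {e :: nat \<Rightarrow>\<^sub>0 nat. keys e \<subseteq> A \<and> lookup e ` A \<subseteq> B})"
    by (rule finite_subset[OF _ finite_set_of_finite_funs[OF assms, of 0]]) (auto simp: in_keys_iff)
  show "inj_on lookup {e :: nat \<Rightarrow>\<^sub>0 nat. keys e \<subseteq> A \<and> lookup e ` A \<subseteq> B}"
    by (auto simp: inj_on_def)
qed

lemma finite_partitions: "finite {lam. is_partition lam \<and> psize lam \<le> m}"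
  by (rule finite_subset[OF _ finite_exponents[of "{..<m}" "{..m}"]])
    (use partition_keys_subset lookup_le_psize le_trans in \<open>fastforce+\<close>)

lemma finite_dominated: "finite {mu. is_partition mu \<and> dominated mu lam \<and> Q mu}"
  by (rule finite_subset[OF _ finite_partitions[of "psize lam"]]) (auto simp: dominated_iff)

definition rearranges :: "(nat \<Rightarrow>\<^sub>0 nat) \<Rightarrow> (nat \<Rightarrow>\<^sub>0 nat) \<Rightarrow> bool" where
  "rearranges e lam \<longleftrightarrow> (\<exists>\<pi>. bij \<pi> \<and> lookup e = lookup lam \<circ> \<pi>)"

lemma rearranges_refl [simp]: "rearranges e e"
  unfolding rearranges_def by (rule exI[of _ id]) auto

lemma rearranges_sym: "rearranges d e \<Longrightarrow> rearranges e d"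
  unfolding rearranges_def
proof (elim exE conjE)
  fix \<pi> assume p: "bij \<pi>" "lookup d = lookup e \<circ> \<pi>"
  then have "lookup e = lookup d \<circ> inv \<pi>" by (auto simp: fun_eq_iff bij_is_surj surj_f_inv_f)
  with p(1) show "\<exists>\<pi>. bij \<pi> \<and> lookup e = lookup d \<circ> \<pi>" using bij_imp_bij_inv by blast
qed

lemma rearranges_trans: "rearranges c d \<Longrightarrow> rearranges d e \<Longrightarrow> rearranges c e"
  unfolding rearranges_def using bij_comp by (metis comp_assoc)

lemma rearranges_psize:
  assumes "rearranges d e" shows "psize d = psize e"
proof -
  obtain \<pi> where p: "bij \<pi>" "lookup d = lookup e \<circ> \<pi>" using assms by (auto simp: rearranges_def)
  have k: "keys d = \<pi> -` keys e" by (auto simp: in_keys_iff p(2))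
  have "bij_betw \<pi> (keys d) (keys e)"
    unfolding bij_betw_def k using p(1)
    by (metis bij_is_inj bij_is_surj inj_on_subset subset_UNIV surj_image_vimage_eq)
  then have "(\<Sum>i\<in>keys d. lookup e (\<pi> i)) = (\<Sum>i\<in>keys e. lookup e i)"
    by (rule sum.reindex_bij_betw)
  then show ?thesis by (simp add: psize_def p(2))
qed

lemma sum_antimono_le:
  fixes f :: "nat \<Rightarrow> nat"
  assumes "antimono f" "finite S"
  shows "sum f S \<le> sum f {..<card S}"
  using assms(2)
proof (induction "card S" arbitrary: S)
  case (Suc n)
  then have "S \<noteq> {}" by auto
  define m where "m = Max S"
  have m: "m \<in> S" using Suc \<open>S \<noteq> {}\<close> by (simp add: m_def)
  have "S \<subseteq> {..m}" using Suc by (auto simp: m_def)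
  then have "Suc n \<le> card {..m}" using Suc by (metis card_mono finite_atMost)
  then have "f m \<le> f n" using assms(1) by (simp add: antimono_def)
  moreover have "sum f (S - {m}) \<le> sum f {..<card (S - {m})}"
    by (rule Suc.hyps(1)) (use Suc m in auto)
  moreover have "sum f S = f m + sum f (S - {m})" using Suc m by (intro sum.remove) auto
  ultimately show ?case using Suc m by (metis add.commute add_mono card_Diff_singleton diff_Suc_1 sum.lessThan_Suc)
qed simp

text \<open>The first \<open>k\<close> entries of a rearrangement are some \<open>k\<close> parts, and the first \<open>k\<close> parts have the
  largest sum.\<close>

lemma rearranges_dominated:
  assumes "rearranges e lam" "is_partition lam"
  shows "dominated e lam"
proof -
  obtain \<pi> where p: "bij \<pi>" "lookup e = lookup lam \<circ> \<pi>" using assms by (auto simp: rearranges_def)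
  have "part_sum k e \<le> part_sum k lam" for k
  proof -
    have inj: "inj_on \<pi> {..<k}" using p(1) by (meson bij_is_inj inj_on_subset subset_UNIV)
    have "part_sum k e = sum (lookup lam) (\<pi> ` {..<k})"
      using inj by (simp add: part_sum_def p(2) sum.reindex)
    also have "\<dots> \<le> sum (lookup lam) {..<card (\<pi> ` {..<k})}"
      using assms(2) by (intro sum_antimono_le) (auto simp: is_partition_def)
    finally show ?thesis using inj by (simp add: part_sum_def card_image)
  qed
  then show ?thesis using rearranges_psize[OF assms(1)] by (simp add: dominated_iff)
qed

lemma rearranges_partition_unique:
  "rearranges lam mu \<Longrightarrow> is_partition lam \<Longrightarrow> is_partition mu \<Longrightarrow> lam = mu"
  by (meson dominated_antisym rearranges_dominated rearranges_sym)

lemma ex_sorted_rearrangement: "\<exists>lam. is_partition lam \<and> rearranges e lam"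
proof -
  obtain n where n: "keys e \<subseteq> {..<n}"
    by (meson finite_keys finite_nat_iff_bounded)
  define xs where "xs = map (lookup e) [0..<n]"
  define ys where "ys = rev (sort xs)"
  have "mset xs = mset ys" by (simp add: ys_def)
  then obtain p where p: "p permutes {..<length ys}" "permute_list p ys = xs"
    by (rule mset_eq_permutation)
  have len: "length ys = n" by (simp add: ys_def xs_def)
  have anti: "antimono (lookup (Poly_Mapping.nth ys))"
  proof (rule antimonoI)
    fix i j :: nat assume "i \<le> j"
    then show "lookup (Poly_Mapping.nth ys) j \<le> lookup (Poly_Mapping.nth ys) i"
      using sorted_rev_nth_mono[of ys i j] by (auto simp: ys_def nth_default_def)
  qed
  moreover have "lookup e i = lookup (Poly_Mapping.nth ys) (p i)" for i
  proof (cases "i < n")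
    case True
    then have "p i < n" using p(1) len by (metis lessThan_iff permutes_in_image)
    moreover have "xs ! i = ys ! (p i)" using permute_list_nth[OF p(1)] True p(2) len by metis
    ultimately show ?thesis using True len by (simp add: xs_def nth_default_def)
  next
    case False
    then have "p i = i" using p(1) len by (simp add: permutes_def)
    moreover have "lookup e i = 0" using n False by (auto simp: in_keys_iff)
    ultimately show ?thesis using False len by (simp add: nth_default_def)
  qed
  ultimately show ?thesis
    using p(1) permutes_bij unfolding is_partition_def rearranges_def
    by (intro exI[of _ "Poly_Mapping.nth ys"]) (auto simp: fun_eq_iff)
qed

section \<open>Partial derivatives and shifts of polynomials in the power sums\<close>

definition pd :: "nat \<Rightarrow> 'a::comm_semiring_1 mpol \<Rightarrow> 'a mpol" where
  "pd r f = (\<Sum>e\<in>keys f. single (e - single r 1) (of_nat (lookup e r) * lookup f e))"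

lemma pd_add: "pd r (f + g) = pd r f + pd r g"
  unfolding pd_def by (rule setsum_keys_plus_distrib) (auto simp: algebra_simps single_add)

lemma pd_0 [simp]: "pd r 0 = 0"
  by (simp add: pd_def)

lemma pd_sum: "pd r (sum f S) = (\<Sum>x\<in>S. pd r (f x))"
  by (induction S rule: infinite_finite_induct) (auto simp: pd_add)

lemma pd_single: "pd r (single e c) = single (e - single r 1) (of_nat (lookup e r) * c)"
  by (simp add: pd_def)

lemma pd_mconst [simp]: "pd r (mconst c) = 0"
  by (simp add: mconst_def pd_single)

lemma pd_mvar: "pd r (mvar i) = (if r = i then 1 else 0)"
  by (simp add: mvar_def pd_single lookup_single)

lemma lookup_pd: "lookup (pd r f) e = of_nat (Suc (lookup e r)) * lookup f (e + single r 1)"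
proof -
  have "lookup (pd r f) e = (\<Sum>d\<in>keys f. lookup (single (d - single r 1) (of_nat (lookup d r) * lookup f d)) e)"
    by (simp add: pd_def lookup_sum)
  also have "\<dots> = (\<Sum>d\<in>keys f. if d = e + single r 1 then of_nat (Suc (lookup e r)) * lookup f (e + single r 1) else 0)"
  proof (rule sum.cong[OF refl])
    fix d assume "d \<in> keys f"
    show "lookup (single (d - single r 1) (of_nat (lookup d r) * lookup f d)) e =
       (if d = e + single r 1 then of_nat (Suc (lookup e r)) * lookup f (e + single r 1) else 0)"
    proof (cases "lookup d r = 0")
      case True
      then have "d \<noteq> e + single r 1" by (auto simp: lookup_add)
      then show ?thesis using True by simp
    next
      case False
      then have "d - single r 1 + single r 1 = d"
        by (intro poly_mapping_eqI) (auto simp: lookup_add lookup_minus lookup_single when_def)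
      then have "d - single r 1 = e \<longleftrightarrow> d = e + single r 1" by auto
      then show ?thesis by (auto simp: lookup_single lookup_add when_def)
    qed
  qed
  also have "\<dots> = of_nat (Suc (lookup e r)) * lookup f (e + single r 1)"
    by (auto simp: in_keys_iff)
  finally show ?thesis .
qed

lemma pd_mult: "pd r (f * g) = pd r f * g + f * pd r g"
proof -
  have s: "pd r (single d a * single e b) = pd r (single d a) * single e b + single d a * pd r (single e b)"
    for d e and a b :: 'a
  proof -
    have "lookup d r = 0 \<or> d + e - single r 1 = (d - single r 1) + e"
      by (cases "lookup d r = 0") (auto intro!: poly_mapping_eqI simp: lookup_add lookup_minus lookup_single when_def)
    moreover have "lookup e r = 0 \<or> d + e - single r 1 = d + (e - single r 1)"
      by (cases "lookup e r = 0") (auto intro!: poly_mapping_eqI simp: lookup_add lookup_minus lookup_single when_def)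
    ultimately show ?thesis
      by (auto simp: mult_single pd_single lookup_add algebra_simps single_add)
  qed
  define F where "F = (\<lambda>e. single e (lookup f e))"
  define G where "G = (\<lambda>e. single e (lookup g e))"
  have f: "f = sum F (keys f)" and g: "g = sum G (keys g)"
    by (simp_all add: F_def G_def mpol_eq_sum_single[symmetric])
  have FG: "pd r (F d * G e) = pd r (F d) * G e + F d * pd r (G e)" for d e
    unfolding F_def G_def by (rule s)
  have "pd r (sum F S * sum G T) = pd r (sum F S) * sum G T + sum F S * pd r (sum G T)" for S T
    by (simp only: pd_sum sum_product FG sum.distrib)
  from this[of "keys f" "keys g"] show ?thesis by (simp flip: f g)
qed

lemma pd_mconst_mult: "pd r (mconst c * f) = mconst c * pd r f"
  by (simp add: pd_mult)

lemma pd_eq_0_imp_const: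
  fixes f :: "'a::{comm_semiring_1, semiring_char_0, semiring_no_zero_divisors} mpol"
  assumes "\<And>r. pd r f = 0"
  shows "f = mconst (lookup f 0)"
proof (rule poly_mapping_eqI)
  fix e
  show "lookup f e = lookup (mconst (lookup f 0)) e"
  proof (cases "e = 0")
    case False
    then obtain r where r: "lookup e r \<noteq> 0" by (metis lookup_zero poly_mapping_eqI)
    then have e: "e - single r 1 + single r 1 = e"
      by (intro poly_mapping_eqI) (auto simp: lookup_add lookup_minus lookup_single when_def)
    have "of_nat (Suc (lookup (e - single r 1) r)) * lookup f e = 0"
      using lookup_pd[of r f "e - single r 1"] assms[of r] e by simp
    then show ?thesis using False by (auto simp: mconst_def lookup_single simp del: of_nat_Suc)
  qed (simp add: mconst_def)
qed

definition eval_hom :: "('a::comm_semiring_1 \<Rightarrow> 'b::comm_semiring_1) \<Rightarrow> 'b \<Rightarrow> 'a poly \<Rightarrow> 'b" where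
  "eval_hom h x F = poly (map_poly h F) x"

lemma eval_hom_pCons: "semiring_hom h \<Longrightarrow> eval_hom h x (pCons a F) = h a + x * eval_hom h x F"
  by (simp add: eval_hom_def map_poly_pCons semiring_hom_0)

lemma eval_hom_0 [simp]: "eval_hom h x 0 = 0"
  by (simp add: eval_hom_def)

lemma eval_hom_add: "semiring_hom h \<Longrightarrow> eval_hom h x (F + G) = eval_hom h x F + eval_hom h x G"
  by (induction F G rule: poly_induct2) (simp_all add: eval_hom_pCons semiring_hom_add algebra_simps)

lemma eval_hom_smult: "semiring_hom h \<Longrightarrow> eval_hom h x (smult a F) = h a * eval_hom h x F"
  by (induction F) (simp_all add: eval_hom_pCons semiring_hom_mult algebra_simps)

lemma eval_hom_mult: "semiring_hom h \<Longrightarrow> eval_hom h x (F * G) = eval_hom h x F * eval_hom h x G"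
  by (induction F) (simp_all add: eval_hom_pCons eval_hom_add eval_hom_smult semiring_hom_0 algebra_simps)

lemma semiring_hom_eval_hom: "semiring_hom h \<Longrightarrow> semiring_hom (eval_hom h x)"
  unfolding semiring_hom_def[of "eval_hom h x"]
  by (simp add: eval_hom_add eval_hom_mult one_pCons eval_hom_pCons semiring_hom_1)

lemma eval_hom_altdef:
  assumes "semiring_hom h" "degree F \<le> n"
  shows "eval_hom h x F = (\<Sum>m\<le>n. h (coeff F m) * x ^ m)"
proof -
  have "degree (map_poly h F) \<le> n" using assms
    by (intro degree_le) (auto simp: coeff_map_poly semiring_hom_0 coeff_eq_0)
  then have "eval_hom h x F = (\<Sum>m\<le>n. coeff (map_poly h F) m * x ^ m)"
    unfolding eval_hom_def poly_altdef
    by (intro sum.mono_neutral_left) (auto simp: coeff_eq_0)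
  then show ?thesis by (simp add: coeff_map_poly semiring_hom_0[OF assms(1)])
qed

text \<open>The homomorphism \<open>p_r \<mapsto> p_r + c_r y^r\<close> on polynomials in the power sums, where the variable with
  index \<open>r\<close> stands for \<open>p_(r+1)\<close>. For \<open>c_r = 1\<close> it adjoins a variable \<open>y\<close>; for \<open>c_r = q^r - 1\<close> and
  \<open>y = x_i\<close> it replaces \<open>x_i\<close> by \<open>q x_i\<close>.\<close>

definition shift :: "(nat \<Rightarrow> 'a::comm_semiring_1) \<Rightarrow> 'a mpol \<Rightarrow> 'a mpol poly" where
  "shift c = msub (\<lambda>a. [:mconst a:]) (\<lambda>r. [:mvar r:] + monom (mconst (c (Suc r))) (Suc r))"

lemma semiring_hom_mconst_poly: "semiring_hom (\<lambda>a::'a::comm_semiring_1. [:mconst a:])"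
  using semiring_hom_comp[OF semiring_hom_const_poly semiring_hom_mconst] .

lemma semiring_hom_shift: "semiring_hom (shift c)"
  unfolding shift_def by (rule semiring_hom_msub[OF semiring_hom_mconst_poly])

lemma shift_mconst: "shift c (mconst a) = [:mconst a:]"
  unfolding shift_def by (rule msub_mconst[OF semiring_hom_mconst_poly])

lemma shift_mvar: "shift c (mvar r) = [:mvar r:] + monom (mconst (c (Suc r))) (Suc r)"
  unfolding shift_def by (rule msub_mvar[OF semiring_hom_mconst_poly])

lemmas shift_add = semiring_hom_add[OF semiring_hom_shift]
lemmas shift_mult = semiring_hom_mult[OF semiring_hom_shift]
lemmas shift_0 = semiring_hom_0[OF semiring_hom_shift]

lemma coeff_shift_0: "coeff (shift c f) 0 = f"
proof -
  have "semiring_hom (\<lambda>f. coeff (shift c f) 0)"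
    unfolding semiring_hom_def
    using shift_mconst[of c 1] by (simp add: shift_0 shift_add shift_mult coeff_mult_0)
  then show ?thesis
    by (rule mpol_hom_eqI[OF _ semiring_hom_id]) (auto simp: shift_mconst shift_mvar)
qed

text \<open>Since \<open>shift c\<close> is \<open>exp (\<Sum>\<^sub>r c_r y^r d/dp_r)\<close>, the Euler derivative in \<open>y\<close> pulls out
  \<open>\<Sum>\<^sub>r r c_r y^r d/dp_r\<close>. This sum is infinite; only the derivatives by the variables of \<open>f\<close>
  contribute, and \<open>n0\<close> bounds these.\<close>

lemma shift_deriv:
  fixes f :: "'a::idom mpol"
  shows "\<exists>n0. \<forall>n\<ge>n0. pCons 0 (pderiv (shift c f)) =
    (\<Sum>r<n. monom (of_nat (Suc r) * mconst (c (Suc r))) (Suc r) * shift c (pd r f))"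
    (is "\<exists>n0. \<forall>n\<ge>n0. ?d f = ?G n f")
proof (induction f rule: mpol_induct)
  case (const a)
  show ?case by (simp add: shift_mconst shift_0 pderiv_pCons)
next
  case (var i)
  have *: "?G n (mvar i) = ?d (mvar i)" if "n \<ge> Suc i" for n
  proof -
    have "?G n (mvar i) = (\<Sum>r<n. if r = i then monom (of_nat (Suc r) * mconst (c (Suc r))) (Suc r) else 0)"
      using semiring_hom_1[OF semiring_hom_shift, of c]
      by (intro sum.cong) (auto simp: pd_mvar shift_0)
    also have "\<dots> = monom (of_nat (Suc i) * mconst (c (Suc i))) (Suc i)"
      using that by simp
    also have "\<dots> = ?d (mvar i)"
      by (simp add: shift_mvar pderiv_add pderiv_pCons pderiv_monom del: of_nat_Suc flip: monom_Suc)
    finally show ?thesis .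
  qed
  show ?case by (intro exI[of _ "Suc i"] allI impI) (rule *[symmetric])
next
  case (add f g)
  then obtain m n where mn: "\<forall>k\<ge>m. ?d f = ?G k f" "\<forall>k\<ge>n. ?d g = ?G k g" by blast
  have "?d (f + g) = ?G k (f + g)" if "k \<ge> max m n" for k
  proof -
    have "?d (f + g) = ?d f + ?d g" by (simp add: shift_add pderiv_add)
    also have "?d f = ?G k f" using mn that by auto
    also have "?d g = ?G k g" using mn that by auto
    also have "?G k f + ?G k g = ?G k (f + g)"
      unfolding sum.distrib[symmetric]
      by (rule sum.cong) (simp_all only: pd_add shift_add distrib_left)
    finally show ?thesis .
  qed
  then show ?case by blast
next
  case (mult f g)
  then obtain m n where mn: "\<forall>k\<ge>m. ?d f = ?G k f" "\<forall>k\<ge>n. ?d g = ?G k g" by blast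
  have "?d (f * g) = ?G k (f * g)" if "k \<ge> max m n" for k
  proof -
    have "?d (f * g) = ?d f * shift c g + shift c f * ?d g"
      by (simp add: shift_mult pderiv_mult algebra_simps)
    also have "?d f = ?G k f" using mn that by auto
    also have "?d g = ?G k g" using mn that by auto
    also have "?G k f * shift c g + shift c f * ?G k g = ?G k (f * g)"
      unfolding sum_distrib_left sum_distrib_right sum.distrib[symmetric]
      by (rule sum.cong) (simp_all add: pd_mult shift_add shift_mult algebra_simps)
    finally show ?thesis .
  qed
  then show ?case by blast
qed

lemma coeff_shift_rec:
  fixes f :: "'a::idom mpol"
  shows "of_nat m * coeff (shift c f) m =
    (\<Sum>r<m. of_nat (Suc r) * mconst (c (Suc r)) * coeff (shift c (pd r f)) (m - Suc r))"
proof -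
  obtain n0 where n0: "\<forall>n\<ge>n0. pCons 0 (pderiv (shift c f)) =
    (\<Sum>r<n. monom (of_nat (Suc r) * mconst (c (Suc r))) (Suc r) * shift c (pd r f))"
    using shift_deriv by blast
  let ?n = "max n0 m"
  let ?t = "\<lambda>r. of_nat (Suc r) * mconst (c (Suc r)) * coeff (shift c (pd r f)) (m - Suc r)"
  have "of_nat m * coeff (shift c f) m = coeff (pCons 0 (pderiv (shift c f))) m"
    by (cases m) (auto simp: coeff_pderiv)
  also have "\<dots> = (\<Sum>r<?n. coeff (monom (of_nat (Suc r) * mconst (c (Suc r))) (Suc r) * shift c (pd r f)) m)"
    by (subst n0[rule_format, OF max.cobounded1]) (rule coeff_sum)
  also have "\<dots> = (\<Sum>r<?n. if r < m then ?t r else 0)"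
    by (rule sum.cong) (auto simp: coeff_monom_mult)
  also have "\<dots> = (\<Sum>r<m. ?t r)"
    by (rule sum.mono_neutral_cong_right) auto
  finally show ?thesis .
qed

lemma coeff_shift_1: "coeff (shift c f) 1 = mconst (c 1) * pd 0 f" for f :: "'a::idom mpol"
  using coeff_shift_rec[of 1 c f] by (simp add: coeff_shift_0)

lemma pd_coeff_shift: "pd r (coeff (shift c f) m) = coeff (shift c (pd r f)) m"
proof (induction f arbitrary: m rule: mpol_induct)
  case (const a)
  then show ?case by (cases m) (auto simp: shift_mconst shift_0)
next
  case (var i)
  have "shift c 1 = 1" by (rule semiring_hom_1[OF semiring_hom_shift])
  then show ?case
    by (cases m) (auto simp: shift_mvar shift_0 pd_mvar pd_add)
next
  case (add f g)
  then show ?case by (simp add: shift_add pd_add)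
next
  case (mult f g)
  then show ?case
    by (simp add: shift_add shift_mult coeff_mult pd_sum pd_mult sum.distrib)
qed

section \<open>Symmetric functions as polynomials in the power sums\<close>

definition powsum :: "nat \<Rightarrow> nat \<Rightarrow> 'a::comm_semiring_1 mpol" where
  "powsum n r = (\<Sum>j<n. mvar j ^ r)"

text \<open>The variable with index \<open>r\<close> stands for the power sum \<open>p_(r+1)\<close>.\<close>

definition in_vars :: "nat \<Rightarrow> 'a::comm_semiring_1 mpol \<Rightarrow> 'a mpol" where
  "in_vars n = msub mconst (\<lambda>r. powsum n (Suc r))"

lemma semiring_hom_in_vars: "semiring_hom (in_vars n)"
  unfolding in_vars_def by (rule semiring_hom_msub[OF semiring_hom_mconst])

lemmas in_vars_0 = semiring_hom_0[OF semiring_hom_in_vars]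
lemmas in_vars_1 = semiring_hom_1[OF semiring_hom_in_vars]
lemmas in_vars_add = semiring_hom_add[OF semiring_hom_in_vars]
lemmas in_vars_mult = semiring_hom_mult[OF semiring_hom_in_vars]
lemmas in_vars_sum = semiring_hom_sum[OF semiring_hom_in_vars]
lemmas in_vars_diff = semiring_hom_diff[OF semiring_hom_in_vars]

lemma in_vars_mconst: "in_vars n (mconst c) = mconst c"
  unfolding in_vars_def by (rule msub_mconst[OF semiring_hom_mconst])

lemma in_vars_mvar: "in_vars n (mvar r) = powsum n (Suc r)"
  unfolding in_vars_def by (rule msub_mvar[OF semiring_hom_mconst])

lemma eval_shift:
  "eval_hom (in_vars n) x (shift c f) =
    msub mconst (\<lambda>r. powsum n (Suc r) + mconst (c (Suc r)) * x ^ Suc r) f"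
proof (rule mpol_hom_eqI[where F = "\<lambda>f. eval_hom (in_vars n) x (shift c f)"])
  show "semiring_hom (\<lambda>f. eval_hom (in_vars n) x (shift c f))"
    by (rule semiring_hom_comp[OF semiring_hom_eval_hom[OF semiring_hom_in_vars] semiring_hom_shift])
  have m: "eval_hom (in_vars n) x (monom a k) = in_vars n a * x ^ k" for a k
    by (induction k) (auto simp: monom_0 monom_Suc eval_hom_pCons semiring_hom_in_vars in_vars_0 mult_ac)
  show "eval_hom (in_vars n) x (shift c (mvar i)) =
      msub mconst (\<lambda>r. powsum n (Suc r) + mconst (c (Suc r)) * x ^ Suc r) (mvar i)" for i
    unfolding shift_mvar eval_hom_add[OF semiring_hom_in_vars] m
      msub_mvar[OF semiring_hom_mconst] in_vars_mconst eval_hom_pCons[OF semiring_hom_in_vars]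
    by (simp add: in_vars_mvar)
  show "eval_hom (in_vars n) x (shift c (mconst a)) =
      msub mconst (\<lambda>r. powsum n (Suc r) + mconst (c (Suc r)) * x ^ Suc r) (mconst a)" for a
    unfolding shift_mconst msub_mconst[OF semiring_hom_mconst] eval_hom_pCons[OF semiring_hom_in_vars]
    by (simp add: in_vars_mconst)
qed (rule semiring_hom_msub[OF semiring_hom_mconst])

lemma in_vars_Suc:
  assumes "degree (shift (\<lambda>_. 1) f) \<le> k"
  shows "in_vars (Suc n) f = (\<Sum>m\<le>k. in_vars n (coeff (shift (\<lambda>_. 1) f) m) * mvar n ^ m)"
proof -
  have "in_vars (Suc n) f = msub mconst (\<lambda>r. powsum n (Suc r) + mconst 1 * mvar n ^ Suc r) f"
    by (simp add: in_vars_def powsum_def del: power_Suc)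
  also have "\<dots> = eval_hom (in_vars n) (mvar n) (shift (\<lambda>_. 1) f)"
    unfolding eval_shift by simp
  finally show ?thesis using eval_hom_altdef[OF semiring_hom_in_vars assms] by simp
qed

lemma keys_in_vars: "e \<in> keys (in_vars n f) \<Longrightarrow> keys e \<subseteq> {..<n}"
proof (induction f arbitrary: e rule: mpol_induct)
  case (const c)
  then show ?case unfolding in_vars_mconst by (auto simp: mconst_def split: if_splits)
next
  case (var i)
  have p: "mvar j ^ r = (single (single j r) 1 :: 'a mpol)" for j r
    using monomial_value_mvar[of "single j r"] by (simp add: monomial_value_single)
  have "(\<Sum>j<n. lookup (single (single j (Suc i)) 1 :: 'a mpol) e) \<noteq> 0"
    using var by (simp add: in_vars_mvar powsum_def p in_keys_iff lookup_sum del: power_Suc)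
  then obtain j where "j < n" "lookup (single (single j (Suc i)) 1 :: 'a mpol) e \<noteq> 0"
    by (metis (no_types, lifting) lessThan_iff sum.not_neutral_contains_not_neutral)
  then show ?case by (auto simp: lookup_single when_def split: if_splits)
next
  case (add f g)
  then show ?case using keys_add[of "in_vars n f" "in_vars n g"] by (auto simp: in_vars_add)
next
  case (mult f g)
  then obtain a b where "e = a + b" "a \<in> keys (in_vars n f)" "b \<in> keys (in_vars n g)"
    using keys_mult[of "in_vars n f" "in_vars n g"] by (auto simp: in_vars_mult)
  then show ?case using mult keys_add[of a b] by blast
qed

lemma lookup_mult_mvar_power:
  fixes f :: "'a::comm_semiring_1 mpol"
  assumes "\<And>d. d \<in> keys f \<Longrightarrow> n \<notin> keys d" "n \<notin> keys e"
  shows "lookup (f * mvar n ^ m) (e + single n k) = (if m = k then lookup f e else 0)"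
proof -
  have "mvar n ^ m = (single (single n m) 1 :: 'a mpol)"
    using monomial_value_mvar[of "single n m"] by (simp add: monomial_value_single)
  then have *: "f * mvar n ^ m = single (single n m) 1 * f" by (simp add: mult.commute)
  show ?thesis
  proof (cases "m = k")
    case True
    then show ?thesis unfolding * using lookup_single_mult_add[of "single n m" 1 f e] by (simp add: add.commute)
  next
    case False
    have "e + single n k \<notin> keys (single (single n m) 1 * f)"
    proof
      assume "e + single n k \<in> keys (single (single n m) 1 * f)"
      then obtain d where "e + single n k = single n m + d" "d \<in> keys f"
        using keys_single_mult by blast
      then have "lookup (e + single n k) n = lookup (single n m + d) n" "n \<notin> keys d" using assms(1) by auto
      then show False using False assms(2) by (simp add: lookup_add in_keys_iff)
    qed
    then show ?thesis using False by (simp add: * in_keys_iff)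
  qed
qed

lemma lookup_in_vars_Suc:
  assumes "n \<notin> keys e"
  shows "lookup (in_vars (Suc n) f) (e + single n m) = lookup (in_vars n (coeff (shift (\<lambda>_. 1) f) m)) e"
proof -
  let ?k = "max m (degree (shift (\<lambda>_. 1) f))"
  have "lookup (in_vars (Suc n) f) (e + single n m) =
     (\<Sum>l\<le>?k. if l = m then lookup (in_vars n (coeff (shift (\<lambda>_. 1) f) l)) e else 0)"
    unfolding in_vars_Suc[OF max.cobounded2[of _ m]] lookup_sum
    by (intro sum.cong lookup_mult_mvar_power assms refl) (use keys_in_vars in blast)
  then show ?thesis by simp
qed

text \<open>The coefficients of the shift restricted to \<open>n\<close> variables are the coefficients of \<open>f\<close> in the
  last of \<open>n + 1\<close> variables.\<close>

lemma coeff_shift_in_kernel: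
  assumes "\<And>n. in_vars n f = 0"
  shows "in_vars n (coeff (shift (\<lambda>_. 1) f) m) = 0"
proof (rule poly_mapping_eqI)
  fix e
  show "lookup (in_vars n (coeff (shift (\<lambda>_. 1) f) m)) e = lookup 0 e"
  proof (cases "n \<in> keys e")
    case True
    then have "e \<notin> keys (in_vars n (coeff (shift (\<lambda>_. 1) f) m))" using keys_in_vars by blast
    then show ?thesis by (simp add: in_keys_iff)
  next
    case False
    then show ?thesis using lookup_in_vars_Suc[OF False, of f m] assms[of "Suc n"] by simp
  qed
qed

text \<open>The coefficient of \<open>y^(r+1)\<close> in the shift is \<open>d/dp_(r+1)\<close> plus products involving derivatives of
  lower index, so it can be solved for this derivative.\<close>

lemma pd_in_kernel:
  fixes f :: "'a::{idom, ring_char_0} mpol"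
  assumes "\<And>n. in_vars n f = 0"
  shows "in_vars n (pd r f) = 0"
  using assms
proof (induction r arbitrary: f n rule: less_induct)
  case (less r)
  have "of_nat (Suc r) * in_vars n (coeff (shift (\<lambda>_. 1) f) (Suc r)) = in_vars n (of_nat (Suc r) * coeff (shift (\<lambda>_. 1) f) (Suc r))"
    by (simp add: in_vars_mult in_vars_mconst flip: mconst_of_nat del: of_nat_Suc)
  also have "\<dots> = (\<Sum>l<Suc r. of_nat (Suc l) * in_vars n (coeff (shift (\<lambda>_. 1) (pd l f)) (Suc r - Suc l)))"
    unfolding coeff_shift_rec by (simp add: in_vars_sum in_vars_mult in_vars_mconst flip: mconst_of_nat del: of_nat_Suc sum.lessThan_Suc)
  also have "\<dots> = of_nat (Suc r) * in_vars n (pd r f) +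
      (\<Sum>l<r. of_nat (Suc l) * in_vars n (coeff (shift (\<lambda>_. 1) (pd l f)) (Suc r - Suc l)))"
    by (simp add: coeff_shift_0)
  also have "(\<Sum>l<r. of_nat (Suc l) * in_vars n (coeff (shift (\<lambda>_. 1) (pd l f)) (Suc r - Suc l))) = 0"
  proof (rule sum.neutral, rule ballI)
    fix l assume "l \<in> {..<r}"
    then have "in_vars n (coeff (shift (\<lambda>_. 1) (pd l f)) (Suc r - Suc l)) = 0"
      by (intro coeff_shift_in_kernel less.IH less.prems) simp
    then show "of_nat (Suc l) * in_vars n (coeff (shift (\<lambda>_. 1) (pd l f)) (Suc r - Suc l)) = 0"
      by simp
  qed
  finally show ?case using coeff_shift_in_kernel[OF less.prems, of n "Suc r"] by (simp del: of_nat_Suc)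
qed

text \<open>Algebraic independence of the power sums: the kernel of all restrictions is stable under the
  partial derivatives, so an element of least degree in it has vanishing derivatives and is constant.\<close>

lemma in_vars_injective:
  fixes f :: "'a::{idom, ring_char_0} mpol"
  assumes "\<And>n. in_vars n f = 0"
  shows "f = 0"
proof -
  have "f = 0" if "\<And>e. e \<in> keys f \<Longrightarrow> psize e \<le> d" "\<And>n. in_vars n f = 0" for d
    using that
  proof (induction d arbitrary: f)
    case 0
    have "e = 0" if "e \<in> keys f" for e
      using 0(1)[OF that] lookup_le_psize[of e] by (intro poly_mapping_eqI) simp
    then have "keys f \<subseteq> {0}" by blast
    then have "f = mconst (lookup f 0)"
      using mpol_eq_sum_single[of "{0}" f] by (simp add: mconst_def)
    then show ?case using 0(2)[of 0] in_vars_mconst[of 0 "lookup f 0"] by simp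
  next
    case (Suc d)
    have "pd r f = 0" for r
    proof (rule Suc.IH)
      fix e assume "e \<in> keys (pd r f)"
      then have "e + single r 1 \<in> keys f" by (auto simp: in_keys_iff lookup_pd simp del: of_nat_Suc)
      then have "psize (e + single r 1) \<le> Suc d" by (rule Suc.prems)
      then show "psize e \<le> d" by (simp add: psize_add)
    qed (rule pd_in_kernel, rule Suc.prems)
    then have "f = mconst (lookup f 0)" by (rule pd_eq_0_imp_const)
    then show ?case using Suc(3)[of 0] in_vars_mconst[of 0 "lookup f 0"] by simp
  qed
  moreover have "psize e \<le> Max (psize ` keys f)" if "e \<in> keys f" for e using that by simp
  ultimately show ?thesis using assms by blast
qed

section \<open>Monomial symmetric functions\<close>

lemma partition_keys_eq:
  assumes "is_partition lam"
  shows "keys lam = {..<card (keys lam)}"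
proof -
  have "i \<in> keys lam \<Longrightarrow> j \<le> i \<Longrightarrow> j \<in> keys lam" for i j
    using is_partition_le[OF assms, of j i] by (auto simp: in_keys_iff)
  then have dc: "{..i} \<subseteq> keys lam" if "i \<in> keys lam" for i using that by auto
  have "keys lam \<subseteq> {..<card (keys lam)}"
  proof
    fix i assume "i \<in> keys lam"
    then have "card {..i} \<le> card (keys lam)" by (intro card_mono dc) auto
    then show "i \<in> {..<card (keys lam)}" by simp
  qed
  then show ?thesis by (metis card_lessThan card_subset_eq finite_lessThan)
qed

lemma rearranges_card_keys:
  assumes "rearranges d e" shows "card (keys d) = card (keys e)"
proof -
  obtain \<pi> where p: "bij \<pi>" "lookup d = lookup e \<circ> \<pi>" using assms by (auto simp: rearranges_def)
  have "keys d = \<pi> -` keys e" by (auto simp: in_keys_iff p(2))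
  then show ?thesis using p(1) by (simp add: card_vimage_inj bij_is_inj bij_is_surj)
qed

lemma rearranges_partition_keys:
  assumes "rearranges e lam" "is_partition lam" "keys e \<subseteq> {..<n}"
  shows "keys lam \<subseteq> {..<n}"
proof -
  have "card (keys lam) \<le> n"
    using rearranges_card_keys[OF assms(1)] card_mono[OF _ assms(3)] by simp
  then show ?thesis using partition_keys_eq[OF assms(2)] by (metis lessThan_subset_iff)
qed

lemma finite_rearrangements: "finite {e. keys e \<subseteq> {..<n} \<and> rearranges e lam}"
proof (rule finite_subset[OF _ finite_exponents[of "{..<n}" "{..psize lam}"]])
  show "{e. keys e \<subseteq> {..<n} \<and> rearranges e lam} \<subseteq> {e. keys e \<subseteq> {..<n} \<and> lookup e ` {..<n} \<subseteq> {..psize lam}}"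
    using lookup_le_psize by (auto simp flip: rearranges_psize)
qed auto

lemma lookup_monomial_sym:
  "lookup (monomial_sym lam n) e = (if keys e \<subseteq> {..<n} \<and> rearranges e lam then 1 else 0)"
proof -
  have "lookup (monomial_sym lam n) e =
    (\<Sum>d\<in>{e. keys e \<subseteq> {..<n} \<and> rearranges e lam}. if d = e then 1 else 0)"
    unfolding monomial_sym_def rearranges_def[symmetric] lookup_sum
    by (rule sum.cong) (auto simp: lookup_single when_def)
  then show ?thesis using finite_rearrangements[of n lam] by simp
qed

lemma is_partition_0: "is_partition 0"
  by (simp add: is_partition_def antimono_def)

lemma monomial_sym_0: "monomial_sym 0 n = 1"
proof -
  have "rearranges e 0 \<longleftrightarrow> e = 0" for e
    by (auto simp: rearranges_def fun_eq_iff intro!: poly_mapping_eqI exI[of _ id])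
  then show ?thesis by (intro poly_mapping_eqI) (auto simp: lookup_monomial_sym lookup_one when_def)
qed

lemma lookup_monomial_sym_partition:
  "is_partition lam \<Longrightarrow> is_partition mu \<Longrightarrow> keys mu \<subseteq> {..<n} \<Longrightarrow>
    lookup (monomial_sym lam n) mu = (if mu = lam then 1 else 0)"
  using rearranges_partition_unique by (auto simp: lookup_monomial_sym)

lemma mvar_power: "mvar j ^ r = (single (single j r) 1 :: 'a::comm_semiring_1 mpol)"
  using monomial_value_mvar[of "single j r"] by (simp add: monomial_value_single)

text \<open>The coefficient of \<open>m_e\<close> in \<open>p_r m_lam\<close>, see \<open>powsum_mult_monomial_sym\<close>.\<close>

definition removal_count :: "nat \<Rightarrow> (nat \<Rightarrow>\<^sub>0 nat) \<Rightarrow> (nat \<Rightarrow>\<^sub>0 nat) \<Rightarrow> nat" where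
  "removal_count r lam e = card {j. r \<le> lookup e j \<and> rearranges (e - single j r) lam}"

lemma removal_count_rearranges:
  assumes "rearranges e mu"
  shows "removal_count r lam e = removal_count r lam mu"
proof -
  obtain \<pi> where p: "bij \<pi>" "lookup e = lookup mu \<circ> \<pi>" using assms by (auto simp: rearranges_def)
  have "lookup (e - single j r) = lookup (mu - single (\<pi> j) r) \<circ> \<pi>" for j
    using p by (auto simp: fun_eq_iff lookup_minus lookup_single when_def bij_def inj_eq)
  then have re: "rearranges (e - single j r) (mu - single (\<pi> j) r)" for j
    using p(1) by (auto simp: rearranges_def)
  have eq: "{j. r \<le> lookup e j \<and> rearranges (e - single j r) lam} =
    \<pi> -` {j. r \<le> lookup mu j \<and> rearranges (mu - single j r) lam}"
    using re by (auto simp: p(2)) (meson rearranges_sym rearranges_trans)+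
  show ?thesis unfolding removal_count_def eq
    by (rule card_vimage_inj) (use p(1) in \<open>auto simp: bij_def\<close>)
qed

lemma finite_removals: "r > 0 \<Longrightarrow> finite {j. r \<le> lookup e j \<and> Q j}" for e :: "nat \<Rightarrow>\<^sub>0 nat"
  by (rule finite_subset[of _ "keys e"]) (auto simp: in_keys_iff)

lemma minus_single_add: "r \<le> lookup e j \<Longrightarrow> e - single j r + single j r = e" for e :: "nat \<Rightarrow>\<^sub>0 nat"
  by (intro poly_mapping_eqI) (auto simp: lookup_add lookup_minus lookup_single when_def)

lemma psize_minus_single: "r \<le> lookup e j \<Longrightarrow> psize (e - single j r) + r = psize e"
  using psize_add[of "e - single j r" "single j r"] by (simp add: minus_single_add)

lemma removal_count_psize:
  assumes "removal_count r lam e \<noteq> 0" shows "psize e = psize lam + r"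
proof -
  have "{j. r \<le> lookup e j \<and> rearranges (e - single j r) lam} \<noteq> {}"
    using assms unfolding removal_count_def by (metis card.empty)
  then obtain j where "r \<le> lookup e j" "rearranges (e - single j r) lam" by blast
  then show ?thesis using psize_minus_single rearranges_psize by metis
qed

lemma powsum_mult_monomial_sym:
  assumes "r > 0"
  shows "powsum n r * monomial_sym lam n =
    (\<Sum>mu | is_partition mu \<and> psize mu \<le> psize lam + r.
       mconst (of_nat (removal_count r lam mu)) * monomial_sym mu n)" (is "_ = ?R")
proof (rule poly_mapping_eqI)
  fix e
  let ?P = "\<lambda>j. r \<le> lookup e j \<and> rearranges (e - single j r) lam"
  have "lookup (powsum n r * monomial_sym lam n) e =
    (\<Sum>j<n. if ?P j \<and> keys (e - single j r) \<subseteq> {..<n} then 1 else 0)"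
    unfolding powsum_def sum_distrib_right lookup_sum mvar_power
    by (intro sum.cong) (auto simp: lookup_single_mult lookup_monomial_sym lookup_single when_def)
  also have "\<dots> = (if keys e \<subseteq> {..<n} then of_nat (removal_count r lam e) else 0)"
  proof (cases "keys e \<subseteq> {..<n}")
    case True
    have "keys (e - single j r) \<subseteq> keys e" for j
      by (auto simp: in_keys_iff lookup_minus)
    then have "keys (e - single j r) \<subseteq> {..<n}" for j
      using True by blast
    moreover have "j < n" if "r \<le> lookup e j" for j
    proof -
      have "j \<in> keys e" using that assms by (auto simp: in_keys_iff)
      then show ?thesis using True by auto
    qed
    then have "{..<n} \<inter> {j. ?P j} = {j. ?P j}" by auto
    ultimately show ?thesis using True by (simp add: sum.If_cases removal_count_def)
  next
    case False
    then obtain i where i: "i \<in> keys e" "\<not> i < n" by auto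
    then have "i \<in> keys (e - single j r)" if "j < n" for j
      using that by (auto simp: in_keys_iff lookup_minus lookup_single when_def)
    then have "\<not> keys (e - single j r) \<subseteq> {..<n}" if "j < n" for j
      using that i(2) by auto
    then show ?thesis using False by (auto intro!: sum.neutral)
  qed
  also have "\<dots> = lookup ?R e"
  proof -
    obtain nu where nu: "is_partition nu" "rearranges e nu" using ex_sorted_rearrangement by blast
    have re: "rearranges e mu \<longleftrightarrow> mu = nu" if "is_partition mu" for mu
      using nu that by (meson rearranges_partition_unique rearranges_sym rearranges_trans)
    have "lookup ?R e =
      (\<Sum>mu | is_partition mu \<and> psize mu \<le> psize lam + r.
        if mu = nu then (if keys e \<subseteq> {..<n} then of_nat (removal_count r lam nu) else 0) else 0)"
      unfolding lookup_sum by (intro sum.cong) (auto simp: lookup_mconst_mult lookup_monomial_sym re)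
    also have "\<dots> = (if keys e \<subseteq> {..<n} then of_nat (removal_count r lam nu) else 0)"
      using removal_count_psize[of r lam nu] nu(1) finite_partitions[of "psize lam + r"]
      by (cases "removal_count r lam nu = 0") auto
    finally show ?thesis using removal_count_rearranges[OF nu(2)] by simp
  qed
  finally show "lookup (powsum n r * monomial_sym lam n) e =
    lookup ?R e" .
qed

definition coeffs_in :: "'a::zero set \<Rightarrow> 'a mpol \<Rightarrow> bool" where
  "coeffs_in R f \<longleftrightarrow> (\<forall>e. lookup f e \<in> R)"

definition subsemiring :: "'a::semiring_1 set \<Rightarrow> bool" where
  "subsemiring R \<longleftrightarrow> 0 \<in> R \<and> 1 \<in> R \<and> (\<forall>x\<in>R. \<forall>y\<in>R. x + y \<in> R \<and> x * y \<in> R)"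

lemma subsemiring_sum: "subsemiring R \<Longrightarrow> (\<And>x. x \<in> A \<Longrightarrow> f x \<in> R) \<Longrightarrow> sum f A \<in> R"
  by (induction A rule: infinite_finite_induct) (auto simp: subsemiring_def)

lemma coeffs_in_add: "subsemiring R \<Longrightarrow> coeffs_in R f \<Longrightarrow> coeffs_in R g \<Longrightarrow> coeffs_in R (f + g)"
  by (auto simp: coeffs_in_def lookup_add subsemiring_def)

lemma coeffs_in_mult:
  assumes R: "subsemiring R" and "coeffs_in R f" "coeffs_in R g"
  shows "coeffs_in R (f * g)"
proof -
  have "f * g = (\<Sum>d\<in>keys f. single d (lookup f d)) * (\<Sum>e\<in>keys g. single e (lookup g e))"
    using mpol_eq_sum_single[of "keys f" f] mpol_eq_sum_single[of "keys g" g] by simp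
  then have "f * g = (\<Sum>d\<in>keys f. \<Sum>e\<in>keys g. single (d + e) (lookup f d * lookup g e))"
    by (simp add: sum_product mult_single)
  then show ?thesis
    using assms by (auto simp: coeffs_in_def lookup_sum lookup_single when_def subsemiring_def
      intro!: subsemiring_sum)
qed

lemma coeffs_in_mconst: "subsemiring R \<Longrightarrow> c \<in> R \<Longrightarrow> coeffs_in R (mconst c)"
  by (auto simp: coeffs_in_def mconst_def lookup_single when_def subsemiring_def)

lemma coeffs_in_mvar: "subsemiring R \<Longrightarrow> coeffs_in R (mvar i)"
  by (auto simp: coeffs_in_def mvar_def lookup_single when_def subsemiring_def)

lemma coeffs_in_sum: "subsemiring R \<Longrightarrow> (\<And>x. x \<in> A \<Longrightarrow> coeffs_in R (f x)) \<Longrightarrow> coeffs_in R (sum f A)"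
  by (auto simp: coeffs_in_def lookup_sum intro!: subsemiring_sum)

lemma coeffs_in_1: "subsemiring R \<Longrightarrow> coeffs_in R 1" for R :: "'a::comm_semiring_1 set"
  using coeffs_in_mconst[of R 1] by (simp add: subsemiring_def)

lemma coeffs_in_prod: "subsemiring R \<Longrightarrow> (\<And>x. x \<in> A \<Longrightarrow> coeffs_in R (f x)) \<Longrightarrow> coeffs_in R (prod f A)"
  for R :: "'a::comm_semiring_1 set"
  by (induction A rule: infinite_finite_induct) (simp_all add: coeffs_in_1 coeffs_in_mult)

lemma coeffs_in_power: "subsemiring R \<Longrightarrow> coeffs_in R f \<Longrightarrow> coeffs_in R (f ^ n)"
  for R :: "'a::comm_semiring_1 set"
  by (induction n) (simp_all add: coeffs_in_1 coeffs_in_mult)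

lemma coeffs_in_in_vars:
  assumes R: "subsemiring R" and f: "coeffs_in R f"
  shows "coeffs_in R (in_vars n f)"
proof -
  have "coeffs_in R (powsum n r)" for r
    unfolding powsum_def by (intro coeffs_in_sum coeffs_in_power coeffs_in_mvar R)
  then have "coeffs_in R (monomial_value (\<lambda>r. powsum n (Suc r)) e)" for e
    unfolding monomial_value_def by (intro coeffs_in_prod coeffs_in_power R)
  moreover have "coeffs_in R (mconst (lookup f e))" for e
    using f by (intro coeffs_in_mconst R) (simp add: coeffs_in_def)
  ultimately show ?thesis unfolding in_vars_def msub_def
    by (intro coeffs_in_sum coeffs_in_mult R)
qed

lemma subsemiring_Rats: "subsemiring (\<rat> :: 'a::field_char_0 set)"
  by (auto simp: subsemiring_def)

lemma partition_remove_last_part: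
  assumes lam: "is_partition lam" and card: "card (keys lam) = Suc m"
  shows "is_partition (lam - single m (lookup lam m))" "m \<notin> keys (lam - single m (lookup lam m))"
    "card (keys (lam - single m (lookup lam m))) = m" "lookup lam m > 0"
proof -
  have k: "keys lam = {..<Suc m}" using partition_keys_eq[OF lam] card by simp
  then have z: "lookup lam i = 0 \<longleftrightarrow> \<not> i < Suc m" for i
    by (metis in_keys_iff lessThan_iff)
  then show "lookup lam m > 0" by (metis lessI neq0_conv)
  have l: "lookup (lam - single m (lookup lam m)) i = (if i < m then lookup lam i else 0)" for i
    using z[of i] by (auto simp: lookup_minus lookup_single when_def)
  have "keys (lam - single m (lookup lam m)) = {..<m}"
    by (auto simp: in_keys_iff l z split: if_splits)
  then show "m \<notin> keys (lam - single m (lookup lam m))" "card (keys (lam - single m (lookup lam m))) = m"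
    by simp_all
  show "is_partition (lam - single m (lookup lam m))"
    using is_partition_le[OF lam] by (auto simp: is_partition_def antimono_def l)
qed

lemma rearranges_add_single:
  assumes "rearranges d e" "i \<notin> keys d" "j \<notin> keys e"
  shows "rearranges (d + single i r) (e + single j r)"
proof -
  obtain \<pi> where p: "bij \<pi>" "lookup d = lookup e \<circ> \<pi>" using assms by (auto simp: rearranges_def)
  let ?\<tau> = "transpose (\<pi> i) j"
  have 0: "lookup e (\<pi> i) = 0" "lookup e j = 0" using assms p by (auto simp: in_keys_iff)
  have "lookup (d + single i r) = lookup (e + single j r) \<circ> (?\<tau> \<circ> \<pi>)"
  proof
    fix k
    have "\<pi> k = \<pi> i \<longleftrightarrow> k = i" using p(1) by (auto simp: bij_def inj_eq)
    then show "lookup (d + single i r) k = (lookup (e + single j r) \<circ> (?\<tau> \<circ> \<pi>)) k"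
      using 0 by (auto simp: lookup_add lookup_single when_def p(2) transpose_def)
  qed
  moreover have "bij (?\<tau> \<circ> \<pi>)" using p(1) by (intro bij_comp) auto
  ultimately show ?thesis unfolding rearranges_def by blast
qed

text \<open>Induction on the number of parts: multiplying by the power sum of the smallest part of \<open>lam\<close> the
  monomial function of the other parts gives a nonzero multiple of \<open>m_lam\<close> and monomial functions with
  fewer parts. The coefficients stay rational, which later shows that \<open>m_lam\<close> has no pole at \<open>z = 0\<close>.\<close>

lemma ex_Msym:
  assumes "is_partition lam"
  shows "\<exists>f. (\<forall>n. in_vars n f = (monomial_sym lam n :: 'a::field_char_0 mpol)) \<and> coeffs_in \<rat> f"
  using assms
proof (induction "card (keys lam)" arbitrary: lam rule: less_induct)
  case less
  show ?case
  proof (cases "card (keys lam)")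
    case 0
    then have [simp]: "lam = 0" by simp
    show ?thesis using coeffs_in_mconst[OF subsemiring_Rats, of 1]
      by (intro exI[of _ 1]) (auto simp: in_vars_1 monomial_sym_0)
  next
    case (Suc m)
    define r where "r = lookup lam m"
    define lam' where "lam' = lam - single m r"
    note rm = partition_remove_last_part[OF less.prems Suc, folded r_def, folded lam'_def]
    have lam_eq: "lam = lam' + single m r"
      unfolding lam'_def r_def by (simp add: minus_single_add)
    let ?T = "{mu. is_partition mu \<and> psize mu \<le> psize lam' + r}"
    let ?c = "removal_count r lam'"
    have lamT: "lam \<in> ?T" using less.prems by (simp add: lam_eq psize_add)
    have clam: "?c lam \<noteq> 0"
    proof -
      have "m \<in> {j. r \<le> lookup lam j \<and> rearranges (lam - single j r) lam'}"
        by (auto simp: r_def lam'_def)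
      then show ?thesis using finite_removals[OF rm(4), of lam "\<lambda>j. rearranges (lam - single j r) lam'"]
        unfolding removal_count_def by (metis card_0_eq empty_iff)
    qed
    \<comment> \<open>If the part \<open>r\<close> is not new, it was added to an existing part.\<close>
    have smaller: "card (keys mu) < card (keys lam)" if mu: "mu \<in> ?T" "mu \<noteq> lam" "?c mu \<noteq> 0" for mu
    proof -
      have "{j. r \<le> lookup mu j \<and> rearranges (mu - single j r) lam'} \<noteq> {}"
        using mu(3) unfolding removal_count_def by (metis card.empty)
      then obtain j where j: "r \<le> lookup mu j" "rearranges (mu - single j r) lam'" by blast
      have "lookup mu j \<noteq> r"
      proof
        assume e: "lookup mu j = r"
        then have "j \<notin> keys (mu - single j r)" by (simp add: in_keys_iff lookup_minus)
        then have "rearranges (mu - single j r + single j r) (lam' + single m r)"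
          by (rule rearranges_add_single[OF j(2) _ rm(2)])
        then have "rearranges mu lam" using j(1) by (simp add: minus_single_add lam_eq)
        then show False using mu(1,2) less.prems rearranges_partition_unique by blast
      qed
      then have "keys (mu - single j r) = keys mu"
        using j(1) by (auto simp: in_keys_iff lookup_minus lookup_single when_def split: if_splits)
      then show ?thesis using rearranges_card_keys[OF j(2)] rm(3) Suc by simp
    qed
    have "\<exists>f. (\<forall>n. in_vars n f = (monomial_sym lam' n :: 'a mpol)) \<and> coeffs_in \<rat> f"
      by (rule less.hyps) (use rm Suc in auto)
    then obtain f' where f': "\<And>n. in_vars n f' = (monomial_sym lam' n :: 'a mpol)" "coeffs_in \<rat> f'" by blast
    have "\<forall>mu. \<exists>f. mu \<in> ?T \<longrightarrow> mu \<noteq> lam \<longrightarrow> ?c mu \<noteq> 0 \<longrightarrow>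
      (\<forall>n. in_vars n f = (monomial_sym mu n :: 'a mpol)) \<and> coeffs_in \<rat> f"
      using less.hyps smaller by blast
    then obtain F where F: "\<And>mu. mu \<in> ?T \<Longrightarrow> mu \<noteq> lam \<Longrightarrow> ?c mu \<noteq> 0 \<Longrightarrow>
      (\<forall>n. in_vars n (F mu) = (monomial_sym mu n :: 'a mpol)) \<and> coeffs_in \<rat> (F mu)" by metis
    let ?S = "{mu \<in> ?T. mu \<noteq> lam \<and> ?c mu \<noteq> 0}"
    define f where "f = mconst (1 / of_nat (?c lam)) *
      (mvar (r - 1) * f' + (\<Sum>mu\<in>?S. mconst (- of_nat (?c mu)) * F mu))"
    have fin: "finite ?T" by (rule finite_partitions)
    have finS: "finite ?S" by (rule finite_subset[OF _ fin]) auto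
    have "in_vars n f = monomial_sym lam n" for n
    proof -
      have "powsum n r * monomial_sym lam' n =
        (\<Sum>mu\<in>insert lam ?S. mconst (of_nat (?c mu)) * (monomial_sym mu n :: 'a mpol))"
        unfolding powsum_mult_monomial_sym[OF rm(4)]
        by (rule sum.mono_neutral_right) (use fin lamT in \<open>auto intro!: gr0I\<close>)
      also have "\<dots> = mconst (of_nat (?c lam)) * monomial_sym lam n +
          (\<Sum>mu\<in>?S. mconst (of_nat (?c mu)) * monomial_sym mu n)"
        by (subst sum.insert[OF finS]) auto
      also have "(\<Sum>mu\<in>?S. mconst (of_nat (?c mu)) * monomial_sym mu n) =
          - in_vars n (\<Sum>mu\<in>?S. mconst (- of_nat (?c mu)) * F mu)"
        unfolding in_vars_sum sum_negf[symmetric]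
        by (rule sum.cong) (use F in \<open>auto simp: in_vars_mult in_vars_mconst mconst_uminus semiring_hom_uminus[OF semiring_hom_in_vars]\<close>)
      finally have "mconst (of_nat (?c lam)) * monomial_sym lam n =
        in_vars n (mvar (r - 1) * f' + (\<Sum>mu\<in>?S. mconst (- of_nat (?c mu)) * F mu))"
        using rm(4) by (simp add: in_vars_add in_vars_mult in_vars_mvar f')
      then have "in_vars n f = mconst (1 / of_nat (?c lam)) * (mconst (of_nat (?c lam)) * monomial_sym lam n)"
        unfolding f_def by (simp add: in_vars_mult in_vars_mconst)
      also have "\<dots> = mconst (1 / of_nat (?c lam) * of_nat (?c lam)) * monomial_sym lam n"
        by (simp only: mconst_mult mult.assoc)
      finally show ?thesis using clam by simp
    qed
    moreover have "coeffs_in \<rat> f" unfolding f_def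
      using F by (intro coeffs_in_mult coeffs_in_add coeffs_in_mconst coeffs_in_mvar coeffs_in_sum
        subsemiring_Rats f'(2)) auto
    ultimately show ?thesis by blast
  qed
qed

definition Msym :: "(nat \<Rightarrow>\<^sub>0 nat) \<Rightarrow> 'a::field_char_0 mpol" where
  "Msym lam = (SOME f. (\<forall>n. in_vars n f = monomial_sym lam n) \<and> coeffs_in \<rat> f)"

lemma in_vars_Msym: "is_partition lam \<Longrightarrow> in_vars n (Msym lam) = monomial_sym lam n"
  and coeffs_in_Msym: "is_partition lam \<Longrightarrow> coeffs_in \<rat> (Msym lam)"
  using someI_ex[OF ex_Msym, of lam] unfolding Msym_def by blast+

section \<open>Linear spans\<close>

definition lspan :: "('i \<Rightarrow> 'a::comm_ring_1 mpol) \<Rightarrow> 'i set \<Rightarrow> 'a mpol set" where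
  "lspan b S = {f. \<exists>T u. finite T \<and> T \<subseteq> S \<and> f = (\<Sum>i\<in>T. mconst (u i) * b i)}"

lemma lspanI: "finite T \<Longrightarrow> T \<subseteq> S \<Longrightarrow> (\<Sum>i\<in>T. mconst (u i) * b i) \<in> lspan b S"
  unfolding lspan_def by blast

lemma lspan_0: "0 \<in> lspan b S"
  using lspanI[of "{}" S _ b] by simp

lemma lspan_base: "i \<in> S \<Longrightarrow> b i \<in> lspan b S"
  using lspanI[of "{i}" S "\<lambda>_. 1" b] by simp

lemma lspan_scale: "f \<in> lspan b S \<Longrightarrow> mconst c * f \<in> lspan b S"
  unfolding lspan_def
proof (elim CollectE exE conjE)
  fix T u assume T: "finite T" "T \<subseteq> S" "f = (\<Sum>i\<in>T. mconst (u i) * b i)"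
  then have "mconst c * f = (\<Sum>i\<in>T. mconst (c * u i) * b i)"
    by (simp add: sum_distrib_left mconst_mult mult.assoc)
  with T(1,2) show "mconst c * f \<in> {f. \<exists>T u. finite T \<and> T \<subseteq> S \<and> f = (\<Sum>i\<in>T. mconst (u i) * b i)}"
    by (intro CollectI exI[of _ T] exI[of _ "\<lambda>i. c * u i"]) simp
qed

lemma lspan_add: "f \<in> lspan b S \<Longrightarrow> g \<in> lspan b S \<Longrightarrow> f + g \<in> lspan b S"
  unfolding lspan_def
proof (elim CollectE exE conjE)
  fix T u T' u'
  assume T: "finite T" "T \<subseteq> S" "f = (\<Sum>i\<in>T. mconst (u i) * b i)"
    and T': "finite T'" "T' \<subseteq> S" "g = (\<Sum>i\<in>T'. mconst (u' i) * b i)"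
  have ext: "(\<Sum>i\<in>A. mconst (v i) * b i) = (\<Sum>i\<in>T \<union> T'. mconst (if i \<in> A then v i else 0) * b i)"
    if "A \<subseteq> T \<union> T'" for A and v
    by (rule sum.mono_neutral_cong_left) (use that T T' in auto)
  have "f + g = (\<Sum>i\<in>T \<union> T'. mconst ((if i \<in> T then u i else 0) + (if i \<in> T' then u' i else 0)) * b i)"
    unfolding T(3) T'(3) ext[OF Un_upper1] ext[OF Un_upper2] mconst_add
    by (simp only: sum.distrib[symmetric] distrib_right)
  with T T' show "f + g \<in> {f. \<exists>T u. finite T \<and> T \<subseteq> S \<and> f = (\<Sum>i\<in>T. mconst (u i) * b i)}"
    by (intro CollectI exI[of _ "T \<union> T'"] exI) auto
qed

lemma lspan_sum: "(\<And>x. x \<in> A \<Longrightarrow> f x \<in> lspan b S) \<Longrightarrow> sum f A \<in> lspan b S"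
  by (induction A rule: infinite_finite_induct) (auto intro: lspan_0 lspan_add)

lemma lspan_uminus: "f \<in> lspan b S \<Longrightarrow> - f \<in> lspan b S"
  using lspan_scale[of f b S "-1"] by (simp add: mconst_uminus)

lemma lspan_diff: "f \<in> lspan b S \<Longrightarrow> g \<in> lspan b S \<Longrightarrow> f - g \<in> lspan b S"
  using lspan_add[of f b S "- g"] lspan_uminus by fastforce

lemma lspan_mono: "S \<subseteq> S' \<Longrightarrow> lspan b S \<subseteq> lspan b S'"
  unfolding lspan_def by blast

lemma lspan_subset: "(\<And>i. i \<in> S \<Longrightarrow> b i \<in> lspan b' S') \<Longrightarrow> lspan b S \<subseteq> lspan b' S'"
  unfolding lspan_def[of b S] by (auto intro!: lspan_sum lspan_scale)

lemma Msym_0: "Msym 0 = (1 :: 'a::field_char_0 mpol)"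
proof -
  have "Msym 0 - 1 = (0 :: 'a mpol)"
    by (rule in_vars_injective) (simp add: in_vars_diff in_vars_Msym is_partition_0 in_vars_1 monomial_sym_0)
  then show ?thesis by simp
qed

text \<open>The span contains 1, and by \<open>powsum_mult_monomial_sym\<close> it is closed under multiplication by
  every power sum.\<close>

lemma lspan_Msym_UNIV: "f \<in> lspan Msym (Collect is_partition)"
proof -
  let ?V = "lspan (Msym :: _ \<Rightarrow> 'a mpol) (Collect is_partition)"
  have v: "mvar r * Msym lam \<in> ?V" if "is_partition lam" for r lam
  proof -
    let ?g = "\<Sum>mu | is_partition mu \<and> psize mu \<le> psize lam + Suc r.
       mconst (of_nat (removal_count (Suc r) lam mu)) * Msym mu :: 'a mpol"
    have "mvar r * Msym lam - ?g = 0"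
      by (rule in_vars_injective)
        (simp add: in_vars_diff in_vars_mult in_vars_mvar in_vars_Msym that
          powsum_mult_monomial_sym in_vars_sum in_vars_mconst)
    then have "mvar r * Msym lam = ?g" by simp
    also have "?g \<in> ?V" by (intro lspanI finite_partitions) auto
    finally show ?thesis .
  qed
  have "f * g \<in> ?V" if "g \<in> ?V" for g
    using that
  proof (induction f arbitrary: g rule: mpol_induct)
    case (const c)
    then show ?case by (rule lspan_scale)
  next
    case (var r)
    then obtain T u where "finite T" "T \<subseteq> Collect is_partition" "g = (\<Sum>i\<in>T. mconst (u i) * Msym i)"
      unfolding lspan_def by blast
    then have "mvar r * g = (\<Sum>i\<in>T. mconst (u i) * (mvar r * Msym i))"
      by (simp add: sum_distrib_left mult_ac)
    also have "\<dots> \<in> ?V" using \<open>T \<subseteq> _\<close> by (intro lspan_sum lspan_scale v) auto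
    finally show ?case .
  next
    case (add f1 f2)
    then show ?case by (simp add: distrib_right lspan_add)
  next
    case (mult f1 f2)
    then show ?case by (simp add: mult.assoc)
  qed
  moreover have "1 \<in> ?V"
    using lspan_base[of 0 "Collect is_partition" "Msym :: _ \<Rightarrow> 'a mpol"] by (simp add: is_partition_0 Msym_0)
  ultimately have "f * 1 \<in> ?V" by blast
  then show ?thesis by simp
qed

lemma lookup_in_vars_expansion:
  assumes "finite T" "T \<subseteq> Collect is_partition"
  shows "lookup (in_vars n (\<Sum>mu\<in>T. mconst (u mu) * Msym mu)) e =
    (\<Sum>mu\<in>T. u mu * lookup (monomial_sym mu n) e)"
  unfolding in_vars_sum lookup_sum
  by (rule sum.cong) (use assms in \<open>auto simp: in_vars_mult in_vars_mconst in_vars_Msym lookup_mconst_mult\<close>)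

lemma lookup_in_vars_expansion_partition:
  assumes "finite T" "T \<subseteq> Collect is_partition" "is_partition lam" "keys lam \<subseteq> {..<n}"
  shows "lookup (in_vars n (\<Sum>mu\<in>T. mconst (u mu) * Msym mu)) lam = (if lam \<in> T then u lam else 0)"
proof -
  have "lookup (in_vars n (\<Sum>mu\<in>T. mconst (u mu) * Msym mu)) lam = (\<Sum>mu\<in>T. if mu = lam then u lam else 0)"
    unfolding lookup_in_vars_expansion[OF assms(1,2)]
    by (rule sum.cong) (use assms in \<open>auto simp: lookup_monomial_sym_partition\<close>)
  then show ?thesis using assms(1) by simp
qed

lemma obtain_Msym_expansion:
  obtains T u where "finite T" "T \<subseteq> Collect is_partition" "f = (\<Sum>mu\<in>T. mconst (u mu) * Msym mu)"
    "\<forall>mu\<in>T. u mu \<noteq> 0"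
proof -
  obtain T u where T: "finite T" "T \<subseteq> Collect is_partition" "f = (\<Sum>mu\<in>T. mconst (u mu) * Msym mu)"
    using lspan_Msym_UNIV[of f] unfolding lspan_def by blast
  have f: "f = (\<Sum>mu\<in>{mu\<in>T. u mu \<noteq> 0}. mconst (u mu) * Msym mu)"
    unfolding T(3) by (rule sum.mono_neutral_right) (use T in auto)
  show ?thesis by (rule that[OF _ _ f]) (use T(1,2) in auto)
qed

lemma keys_in_vars_sorted:
  fixes f :: "'a::field_char_0 mpol"
  assumes "e \<in> keys (in_vars n f)"
  obtains lam where "is_partition lam" "rearranges e lam" "lam \<in> keys (in_vars n f)" "keys lam \<subseteq> {..<n}"
proof -
  obtain T u where T: "finite T" "T \<subseteq> Collect is_partition" "f = (\<Sum>mu\<in>T. mconst (u mu) * Msym mu)"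
    "\<forall>mu\<in>T. u mu \<noteq> 0" by (rule obtain_Msym_expansion[of f])
  have "(\<Sum>mu\<in>T. u mu * lookup (monomial_sym mu n) e) \<noteq> 0"
    using assms T lookup_in_vars_expansion[OF T(1,2), of n u e] by (simp add: in_keys_iff)
  then obtain lam where lam: "lam \<in> T" "u lam * lookup (monomial_sym lam n) e \<noteq> 0"
    by (meson sum.neutral)
  then have r: "rearranges e lam" by (auto simp: lookup_monomial_sym split: if_splits)
  have p: "is_partition lam" using T lam by auto
  have k: "keys lam \<subseteq> {..<n}"
    using rearranges_partition_keys[OF r p] keys_in_vars[OF assms] by simp
  have "lookup (in_vars n f) lam = u lam"
    using lookup_in_vars_expansion_partition[OF T(1,2) p k, of u] T(3) lam by simp
  then show ?thesis using that[OF p r _ k] T(4) lam by (simp add: in_keys_iff)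
qed

text \<open>Sorting an exponent of a symmetric polynomial yields another one, which is lexicographically
  at least as large.\<close>

lemma Max_keys_in_vars:
  fixes f :: "'a::field_char_0 mpol"
  assumes "in_vars n f \<noteq> 0"
  shows "is_partition (Max (keys (in_vars n f)))" "keys (Max (keys (in_vars n f))) \<subseteq> {..<n}"
proof -
  let ?M = "Max (keys (in_vars n f))"
  have M: "?M \<in> keys (in_vars n f)" using assms by (intro Max_in) auto
  then obtain lam where lam: "is_partition lam" "rearranges ?M lam" "lam \<in> keys (in_vars n f)"
    by (rule keys_in_vars_sorted)
  then have "?M \<le> lam" by (intro dominated_imp_le rearranges_dominated)
  moreover have "lam \<le> ?M" using lam(3) by (intro Max_ge) auto
  ultimately have "?M = lam" by simp
  then show "is_partition ?M" "keys ?M \<subseteq> {..<n}" using lam keys_in_vars[OF M] by auto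
qed

lemma in_lspan_Msym:
  fixes f :: "'a::field_char_0 mpol"
  assumes "\<And>n e. is_partition e \<Longrightarrow> e \<in> keys (in_vars n f) \<Longrightarrow> e \<in> S"
  shows "f \<in> lspan Msym {mu. is_partition mu \<and> mu \<in> S}"
proof -
  obtain T u where T: "finite T" "T \<subseteq> Collect is_partition" "f = (\<Sum>mu\<in>T. mconst (u mu) * Msym mu)"
    "\<forall>mu\<in>T. u mu \<noteq> 0" by (rule obtain_Msym_expansion[of f])
  have "mu \<in> S" if mu: "mu \<in> T" for mu
  proof -
    have p: "is_partition mu" using mu T by auto
    have "keys mu \<subseteq> {..<psize mu}" by (rule partition_keys_subset[OF p order_refl])
    then have "lookup (in_vars (psize mu) f) mu = u mu"
      using lookup_in_vars_expansion_partition[OF T(1,2) p, of _ u] T(3) mu by simp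
    then show ?thesis using assms[OF p, of "psize mu"] bspec[OF T(4) mu] by (simp add: in_keys_iff)
  qed
  then show ?thesis unfolding T(3) using T by (intro lspanI) auto
qed

section \<open>The scalar product in power sum coordinates\<close>

text \<open>The exponent vector of the product of power sums belonging to a partition: the entry at \<open>r\<close> counts
  the parts equal to \<open>r + 1\<close>.\<close>

definition part_mults :: "(nat \<Rightarrow>\<^sub>0 nat) \<Rightarrow> (nat \<Rightarrow>\<^sub>0 nat)" where
  "part_mults lam = Abs_poly_mapping (\<lambda>r. card {i. lookup lam i = Suc r})"

lemma lookup_part_mults: "lookup (part_mults lam) r = card {i. lookup lam i = Suc r}"
proof -
  have "{r. card {i. lookup lam i = Suc r} \<noteq> 0} \<subseteq> (\<lambda>i. lookup lam i - 1) ` keys lam"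
  proof
    fix r assume "r \<in> {r. card {i. lookup lam i = Suc r} \<noteq> 0}"
    then obtain i where "lookup lam i = Suc r" by (metis (mono_tags, lifting) card.empty empty_Collect_eq mem_Collect_eq)
    then show "r \<in> (\<lambda>i. lookup lam i - 1) ` keys lam" by (intro image_eqI[of _ _ i]) (auto simp: in_keys_iff)
  qed
  then have fin: "finite {r. card {i. lookup lam i = Suc r} \<noteq> 0}" by (rule finite_subset) auto
  show ?thesis unfolding part_mults_def lookup_Abs_poly_mapping[OF fin] ..
qed

lemma finite_fibre: "finite {i. lookup lam i = Suc r}" for lam :: "nat \<Rightarrow>\<^sub>0 nat"
  by (rule finite_subset[of _ "keys lam"]) (auto simp: in_keys_iff)

lemma lookup_image_keys: "lookup lam ` keys lam = Suc ` keys (part_mults lam)"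
proof (intro equalityI subsetI)
  fix v assume "v \<in> lookup lam ` keys lam"
  then obtain i where i: "v = lookup lam i" "lookup lam i \<noteq> 0" by (auto simp: in_keys_iff)
  then obtain r where r: "lookup lam i = Suc r" by (cases "lookup lam i") auto
  then have "r \<in> keys (part_mults lam)"
    using finite_fibre[of lam r] by (auto simp: in_keys_iff lookup_part_mults)
  then show "v \<in> Suc ` keys (part_mults lam)" using i r by auto
next
  fix v assume "v \<in> Suc ` keys (part_mults lam)"
  then obtain r where r: "v = Suc r" "card {i. lookup lam i = Suc r} \<noteq> 0" by (auto simp: in_keys_iff lookup_part_mults)
  then obtain i where "lookup lam i = Suc r" by (metis (mono_tags, lifting) card.empty empty_Collect_eq mem_Collect_eq)
  then show "v \<in> lookup lam ` keys lam" using r by (intro image_eqI[of _ _ i]) (auto simp: in_keys_iff)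
qed

lemma prod_over_parts:
  fixes g :: "nat \<Rightarrow> 'b::comm_monoid_mult"
  shows "(\<Prod>i\<in>keys lam. g (lookup lam i)) = (\<Prod>r\<in>keys (part_mults lam). g (Suc r) ^ lookup (part_mults lam) r)"
proof -
  have "(\<Prod>i\<in>keys lam. g (lookup lam i)) =
    (\<Prod>v\<in>lookup lam ` keys lam. \<Prod>i\<in>{i\<in>keys lam. lookup lam i = v}. g (lookup lam i))"
    by (rule prod.image_gen) simp
  also have "\<dots> = (\<Prod>r\<in>keys (part_mults lam). \<Prod>i\<in>{i\<in>keys lam. lookup lam i = Suc r}. g (lookup lam i))"
    unfolding lookup_image_keys by (subst prod.reindex) auto
  also have "\<dots> = (\<Prod>r\<in>keys (part_mults lam). g (Suc r) ^ lookup (part_mults lam) r)"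
  proof (rule prod.cong[OF refl])
    fix r
    have "{i\<in>keys lam. lookup lam i = Suc r} = {i. lookup lam i = Suc r}" by (auto simp: in_keys_iff)
    then show "(\<Prod>i\<in>{i\<in>keys lam. lookup lam i = Suc r}. g (lookup lam i)) = g (Suc r) ^ lookup (part_mults lam) r"
      by (simp add: lookup_part_mults)
  qed
  finally show ?thesis .
qed

lemma power_sym_eq: "power_sym lam n = in_vars n (single (part_mults lam) 1)"
proof -
  have "in_vars n (single (part_mults lam) 1) = (monomial_value (\<lambda>r. powsum n (Suc r)) (part_mults lam) :: 'a mpol)"
    unfolding in_vars_def by (simp add: msub_single[OF semiring_hom_mconst])
  then show ?thesis
    using prod_over_parts[of "\<lambda>v. powsum n v" lam]
    by (simp add: power_sym_def powsum_def monomial_value_def)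
qed

lemma part_mults_rearranges:
  assumes "rearranges d e" shows "part_mults d = part_mults e"
proof (rule poly_mapping_eqI)
  fix r
  obtain \<pi> where p: "bij \<pi>" "lookup d = lookup e \<circ> \<pi>" using assms by (auto simp: rearranges_def)
  have "{i. lookup d i = Suc r} = \<pi> -` {i. lookup e i = Suc r}" by (auto simp: p(2))
  moreover have "card (\<pi> -` {i. lookup e i = Suc r}) = card {i. lookup e i = Suc r}"
    by (rule card_vimage_inj) (use p(1) in \<open>auto simp: bij_def\<close>)
  ultimately show "lookup (part_mults d) r = lookup (part_mults e) r" by (simp add: lookup_part_mults)
qed

lemma part_mults_add_part:
  assumes "j \<notin> keys lam"
  shows "part_mults (lam + single j (Suc r)) = part_mults lam + single r 1"
proof (rule poly_mapping_eqI)
  fix k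
  have j: "lookup lam j = 0" using assms by (simp add: in_keys_iff)
  have "{i. lookup (lam + single j (Suc r)) i = Suc k} =
    (if k = r then insert j {i. lookup lam i = Suc k} else {i. lookup lam i = Suc k})"
    using j by (auto simp: lookup_add lookup_single when_def split: if_splits)
  then show "lookup (part_mults (lam + single j (Suc r))) k = lookup (part_mults lam + single r 1) k"
    using j finite_fibre[of lam k] by (simp add: lookup_part_mults lookup_add lookup_single when_def)
qed

lemma part_mults_surj: "\<exists>lam. is_partition lam \<and> part_mults lam = e"
proof (induction "psize e" arbitrary: e)
  case 0
  then have "e = 0"
    using lookup_le_psize[of e] by (intro poly_mapping_eqI) simp
  moreover have "part_mults 0 = 0" by (intro poly_mapping_eqI) (simp add: lookup_part_mults)
  ultimately show ?case by (intro exI[of _ 0]) (simp add: is_partition_def antimono_def)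
next
  case (Suc d)
  then have "e \<noteq> 0" by auto
  then obtain r where "lookup e r \<noteq> 0" by (metis lookup_zero poly_mapping_eqI)
  then have r: "1 \<le> lookup e r" by simp
  then have "d = psize (e - single r 1)" using Suc(2) psize_minus_single[OF r] by simp
  then obtain lam where lam: "part_mults lam = e - single r 1" using Suc(1) by blast
  obtain j where j: "j \<notin> keys lam" using ex_new_if_finite[OF infinite_UNIV_nat, of "keys lam"] by auto
  have "part_mults (lam + single j (Suc r)) = e"
    unfolding part_mults_add_part[OF j] lam by (rule minus_single_add[OF r])
  moreover obtain mu where "is_partition mu" "rearranges (lam + single j (Suc r)) mu"
    using ex_sorted_rearrangement by blast
  ultimately show ?case using part_mults_rearranges by metis
qed

text \<open>The multiplicities give the number of parts larger than \<open>k\<close> for each \<open>k\<close>. In a partition these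
  parts form an initial segment, so their number determines which ones they are.\<close>

lemma part_mults_inj:
  assumes lam: "is_partition lam" and mu: "is_partition mu" and eq: "part_mults lam = part_mults mu"
  shows "lam = mu"
proof (rule poly_mapping_eqI)
  fix i
  have down: "{i. Suc k \<le> lookup nu i} = {..<\<Sum>r\<in>{k..<K}. lookup (part_mults nu) r}"
    if nu: "is_partition nu" "psize nu \<le> K" for nu k K
  proof -
    have fin: "finite {i. Suc k \<le> lookup nu i}"
      by (rule finite_subset[of _ "keys nu"]) (auto simp: in_keys_iff)
    have "{i. Suc k \<le> lookup nu i} = (\<Union>r\<in>{k..<K}. {i. lookup nu i = Suc r})"
    proof (intro equalityI subsetI)
      fix i assume "i \<in> {i. Suc k \<le> lookup nu i}"
      moreover have "lookup nu i \<le> K" using lookup_le_psize[of nu i] nu(2) by simp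
      ultimately show "i \<in> (\<Union>r\<in>{k..<K}. {i. lookup nu i = Suc r})"
        by (intro UN_I[of "lookup nu i - 1"]) auto
    qed auto
    also have "card \<dots> = (\<Sum>r\<in>{k..<K}. lookup (part_mults nu) r)"
      unfolding lookup_part_mults by (rule card_UN_disjoint) (auto simp: finite_fibre)
    finally have card: "card {i. Suc k \<le> lookup nu i} = (\<Sum>r\<in>{k..<K}. lookup (part_mults nu) r)" .
    have dc: "{..i} \<subseteq> {i. Suc k \<le> lookup nu i}" if "i \<in> {i. Suc k \<le> lookup nu i}" for i
    proof
      fix j assume "j \<in> {..i}"
      then have "lookup nu i \<le> lookup nu j" using is_partition_le[OF nu(1)] by simp
      then show "j \<in> {i. Suc k \<le> lookup nu i}" using that by simp
    qed
    have "{i. Suc k \<le> lookup nu i} \<subseteq> {..<card {i. Suc k \<le> lookup nu i}}"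
    proof
      fix i assume i: "i \<in> {i. Suc k \<le> lookup nu i}"
      have "card {..i} \<le> card {i. Suc k \<le> lookup nu i}" by (rule card_mono[OF fin dc[OF i]])
      then show "i \<in> {..<card {i. Suc k \<le> lookup nu i}}" by simp
    qed
    then have "{i. Suc k \<le> lookup nu i} = {..<card {i. Suc k \<le> lookup nu i}}"
      by (intro card_subset_eq) auto
    then show ?thesis unfolding card .
  qed
  let ?K = "max (psize lam) (psize mu)"
  have "{i. Suc k \<le> lookup lam i} = {i. Suc k \<le> lookup mu i}" for k
    using down[OF lam, of ?K k] down[OF mu, of ?K k] eq by simp
  then have "Suc k \<le> lookup lam i \<longleftrightarrow> Suc k \<le> lookup mu i" for k by blast
  then show "lookup lam i = lookup mu i" by (metis Suc_le_eq nat_less_le linorder_neqE_nat not_less_iff_gr_or_eq)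
qed

definition qt_weight :: "'a::field_char_0 \<Rightarrow> 'a \<Rightarrow> nat \<Rightarrow> 'a" where
  "qt_weight q t r = of_nat (Suc r) * ((1 - q ^ Suc r) / (1 - t ^ Suc r))"

definition qt_norm :: "'a::field_char_0 \<Rightarrow> 'a \<Rightarrow> (nat \<Rightarrow>\<^sub>0 nat) \<Rightarrow> 'a" where
  "qt_norm q t e = (\<Prod>r\<in>keys e. qt_weight q t r ^ lookup e r * fact (lookup e r))"

definition qt_form :: "'a::field_char_0 \<Rightarrow> 'a \<Rightarrow> 'a mpol \<Rightarrow> 'a mpol \<Rightarrow> 'a" where
  "qt_form q t f g = (\<Sum>e\<in>keys f. lookup f e * lookup g e * qt_norm q t e)"

lemma qt_norm_superset:
  "finite S \<Longrightarrow> keys e \<subseteq> S \<Longrightarrow> qt_norm q t e = (\<Prod>r\<in>S. qt_weight q t r ^ lookup e r * fact (lookup e r))"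
  unfolding qt_norm_def by (rule prod.mono_neutral_left) (auto simp: in_keys_iff)

lemma z_qt_eq: "z_qt q t lam = qt_norm q t (part_mults lam)"
proof -
  have "of_nat (z_part lam) = (\<Prod>r\<in>keys (part_mults lam). of_nat (Suc r) ^ lookup (part_mults lam) r * (fact (lookup (part_mults lam) r) :: 'a))"
    unfolding z_part_def lookup_image_keys
    by (subst prod.reindex) (auto simp: lookup_part_mults of_nat_fact simp del: of_nat_Suc)
  moreover have "(\<Prod>i\<in>keys lam. (1 - q ^ lookup lam i) / (1 - t ^ lookup lam i)) =
    (\<Prod>r\<in>keys (part_mults lam). ((1 - q ^ Suc r) / (1 - t ^ Suc r)) ^ lookup (part_mults lam) r)"
    by (rule prod_over_parts)
  ultimately show ?thesis
    unfolding z_qt_def qt_norm_def qt_weight_def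
    by (simp only: power_mult_distrib mult_ac prod.distrib)
qed

text \<open>Reindexing by \<open>part_mults\<close> turns the coefficients of \<open>f\<close> into coefficients of power sum products;
  they are the only ones because the power sums are algebraically independent.\<close>

lemma power_coeffs_in_vars:
  fixes f :: "'a::field_char_0 mpol"
  shows "lookup (power_coeffs (\<lambda>n. in_vars n f)) lam = (if is_partition lam then lookup f (part_mults lam) else 0)"
proof -
  define a where "a = Abs_poly_mapping (\<lambda>lam. if is_partition lam then lookup f (part_mults lam) else 0)"
  have inj: "inj_on part_mults (Collect is_partition)" by (auto intro!: inj_onI part_mults_inj)
  let ?S = "{lam. (if is_partition lam then lookup f (part_mults lam) else 0) \<noteq> 0}"
  have img: "part_mults ` ?S \<subseteq> keys f" by (auto simp: in_keys_iff split: if_splits)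
  have injS: "inj_on part_mults ?S" by (rule inj_on_subset[OF inj]) (auto split: if_splits)
  have "finite ?S" by (rule finite_imageD[OF finite_subset[OF img] injS]) simp
  then have la: "lookup a lam = (if is_partition lam then lookup f (part_mults lam) else 0)" for lam
    by (simp add: a_def)
  have ka: "keys a \<subseteq> Collect is_partition" by (auto simp: in_keys_iff la split: if_splits)
  have bij: "bij_betw part_mults (keys a) (keys f)"
  proof (rule bij_betw_imageI)
    show "inj_on part_mults (keys a)" by (rule inj_on_subset[OF inj ka])
    show "part_mults ` keys a = keys f"
    proof (intro equalityI subsetI)
      fix e assume e: "e \<in> keys f"
      obtain lam where "is_partition lam" "part_mults lam = e" using part_mults_surj by blast
      then show "e \<in> part_mults ` keys a" using e by (intro image_eqI[of _ _ lam]) (auto simp: in_keys_iff la)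
    qed (use ka in \<open>auto simp: in_keys_iff la\<close>)
  qed
  have ex: "in_vars n f = (\<Sum>lam\<in>keys a. mconst (lookup a lam) * power_sym lam n)" for n
  proof -
    have "f = (\<Sum>e\<in>keys f. mconst (lookup f e) * single e 1)"
      using mpol_eq_sum_single[of "keys f" f] by (simp add: mconst_def mult_single)
    also have "\<dots> = (\<Sum>lam\<in>keys a. mconst (lookup f (part_mults lam)) * single (part_mults lam) 1)"
      by (rule sum.reindex_bij_betw[OF bij, symmetric])
    finally have "in_vars n f = in_vars n (\<Sum>lam\<in>keys a. mconst (lookup f (part_mults lam)) * single (part_mults lam) 1)"
      by (rule arg_cong)
    also have "\<dots> = (\<Sum>lam\<in>keys a. in_vars n (mconst (lookup f (part_mults lam)) * single (part_mults lam) 1))"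
      by (rule in_vars_sum)
    also have "\<dots> = (\<Sum>lam\<in>keys a. mconst (lookup a lam) * power_sym lam n)"
      by (rule sum.cong) (use ka in \<open>auto simp: in_vars_mult in_vars_mconst power_sym_eq la\<close>)
    finally show ?thesis .
  qed
  have "power_coeffs (\<lambda>n. in_vars n f) = a"
    unfolding power_coeffs_def
  proof (rule the_equality)
    show "keys a \<subseteq> Collect is_partition \<and> (\<forall>n. in_vars n f = (\<Sum>lam\<in>keys a. mconst (lookup a lam) * power_sym lam n))"
      using ka ex by blast
    fix b assume b: "keys b \<subseteq> Collect is_partition \<and> (\<forall>n. in_vars n f = (\<Sum>lam\<in>keys b. mconst (lookup b lam) * power_sym lam n))"
    let ?g = "\<Sum>lam\<in>keys b. mconst (lookup b lam) * single (part_mults lam) 1"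
    have "f - ?g = 0"
    proof (rule in_vars_injective)
      fix n
      have "in_vars n ?g = (\<Sum>lam\<in>keys b. mconst (lookup b lam) * power_sym lam n)"
        by (simp add: in_vars_sum in_vars_mult in_vars_mconst power_sym_eq)
      then show "in_vars n (f - ?g) = 0" using b by (simp add: in_vars_diff)
    qed
    then have fg: "f = ?g" by simp
    show "b = a"
    proof (rule poly_mapping_eqI)
      fix lam
      show "lookup b lam = lookup a lam"
      proof (cases "is_partition lam")
        case True
        have "lookup f (part_mults lam) = (\<Sum>mu\<in>keys b. if mu = lam then lookup b lam else 0)"
          unfolding fg lookup_sum
          by (rule sum.cong) (use b True part_mults_inj in \<open>auto simp: mconst_def mult_single lookup_single when_def\<close>)
        then show ?thesis using True by (auto simp: la in_keys_iff)
      next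
        case False
        then show ?thesis using b by (auto simp: la in_keys_iff)
      qed
    qed
  qed
  then show ?thesis by (simp add: la)
qed

lemma qt_scalar_in_vars:
  fixes q t :: "'a::field_char_0"
  shows "qt_scalar q t (\<lambda>n. in_vars n f) (\<lambda>n. in_vars n g) = qt_form q t f g"
proof -
  let ?a = "power_coeffs (\<lambda>n. in_vars n f)"
  have inj: "inj_on part_mults (keys ?a)"
    by (auto simp: in_keys_iff power_coeffs_in_vars intro!: inj_onI part_mults_inj split: if_splits)
  have img: "part_mults ` keys ?a = keys f"
  proof (intro equalityI subsetI)
    fix e assume e: "e \<in> keys f"
    obtain lam where "is_partition lam" "part_mults lam = e" using part_mults_surj by blast
    then show "e \<in> part_mults ` keys ?a" using e
      by (intro image_eqI[of _ _ lam]) (auto simp: in_keys_iff power_coeffs_in_vars)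
  qed (auto simp: in_keys_iff power_coeffs_in_vars split: if_splits)
  have "qt_scalar q t (\<lambda>n. in_vars n f) (\<lambda>n. in_vars n g) =
    (\<Sum>lam\<in>keys ?a. lookup f (part_mults lam) * lookup g (part_mults lam) * qt_norm q t (part_mults lam))"
    unfolding qt_scalar_def
    by (rule sum.cong) (auto simp: in_keys_iff power_coeffs_in_vars z_qt_eq split: if_splits)
  also have "\<dots> = qt_form q t f g"
    unfolding qt_form_def img[symmetric] by (subst sum.reindex[OF inj]) simp
  finally show ?thesis .
qed

lemma qt_form_superset:
  "finite S \<Longrightarrow> keys f \<subseteq> S \<Longrightarrow> qt_form q t f g = (\<Sum>e\<in>S. lookup f e * lookup g e * qt_norm q t e)"
  unfolding qt_form_def by (rule sum.mono_neutral_left) (auto simp: in_keys_iff)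

lemma qt_form_commute: "qt_form q t f g = qt_form q t g f"
  by (simp add: qt_form_superset[of "keys f \<union> keys g"] mult_ac)

lemma qt_form_add_left: "qt_form q t (f1 + f2) g = qt_form q t f1 g + qt_form q t f2 g"
  unfolding qt_form_def
  by (rule setsum_keys_plus_distrib[of "\<lambda>e c. c * lookup g e * qt_norm q t e"]) (auto simp: algebra_simps)

lemma qt_form_0_left [simp]: "qt_form q t 0 g = 0"
  by (simp add: qt_form_def)

lemma qt_form_scale_left: "qt_form q t (mconst c * f) g = c * qt_form q t f g"
proof -
  have "keys (mconst c * f) \<subseteq> keys f" by (auto simp: in_keys_iff lookup_mconst_mult)
  then show ?thesis
    by (simp add: qt_form_superset[of "keys f"] lookup_mconst_mult sum_distrib_left mult.assoc)
qed

lemma qt_form_sum_left: "qt_form q t (sum f A) g = (\<Sum>x\<in>A. qt_form q t (f x) g)"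
  by (induction A rule: infinite_finite_induct) (auto simp: qt_form_add_left)

lemma qt_form_add_right: "qt_form q t f (g1 + g2) = qt_form q t f g1 + qt_form q t f g2"
  by (metis qt_form_add_left qt_form_commute)

lemma qt_form_scale_right: "qt_form q t f (mconst c * g) = c * qt_form q t f g"
  by (metis qt_form_scale_left qt_form_commute)

lemma qt_form_sum_right: "qt_form q t f (sum g A) = (\<Sum>x\<in>A. qt_form q t f (g x))"
  by (simp add: qt_form_commute[of q t f] qt_form_sum_left)

lemma qt_form_diff_left: "qt_form q t (f1 - f2) g = qt_form q t f1 g - qt_form q t f2 g"
  by (metis add_diff_cancel_right' diff_add_cancel qt_form_add_left)

lemma qt_norm_add_single: "qt_norm q t (e + single r 1) = qt_norm q t e * qt_weight q t r * of_nat (Suc (lookup e r))"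
proof -
  let ?S = "insert r (keys e)"
  let ?h = "\<lambda>e i. qt_weight q t i ^ lookup e i * fact (lookup e i)"
  have s: "keys (e + single r 1) \<subseteq> ?S" using keys_add[of e "single r 1"] by auto
  have "qt_norm q t (e + single r 1) = (\<Prod>i\<in>?S. ?h (e + single r 1) i)"
    using s by (intro qt_norm_superset) auto
  also have "\<dots> = ?h (e + single r 1) r * (\<Prod>i\<in>?S - {r}. ?h (e + single r 1) i)"
    by (rule prod.remove) auto
  also have "(\<Prod>i\<in>?S - {r}. ?h (e + single r 1) i) = (\<Prod>i\<in>?S - {r}. ?h e i)"
    by (rule prod.cong) (auto simp: lookup_add lookup_single when_def)
  also have "?h (e + single r 1) r = ?h e r * qt_weight q t r * of_nat (Suc (lookup e r))"
    by (simp add: lookup_add fact_Suc mult_ac del: of_nat_Suc)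
  finally have "qt_norm q t (e + single r 1) =
     (?h e r * (\<Prod>i\<in>?S - {r}. ?h e i)) * qt_weight q t r * of_nat (Suc (lookup e r))"
    by (simp add: mult_ac)
  also have "?h e r * (\<Prod>i\<in>?S - {r}. ?h e i) = (\<Prod>i\<in>?S. ?h e i)"
    by (rule prod.remove[symmetric]) auto
  also have "\<dots> = qt_norm q t e" by (rule qt_norm_superset[symmetric]) auto
  finally show ?thesis .
qed

lemma qt_form_mvar_adjoint: "qt_form q t (mvar r * f) g = qt_weight q t r * qt_form q t f (pd r g)"
proof -
  have "qt_form q t (mvar r * single e c) g = qt_weight q t r * qt_form q t (single e c) (pd r g)" for e c
  proof -
    have "mvar r * single e c = single (e + single r 1) c"
      by (simp add: mvar_def mult_single add.commute)
    then show ?thesis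
      by (simp add: qt_form_def qt_norm_add_single[unfolded One_nat_def] lookup_pd mult_ac del: of_nat_Suc)
  qed
  then have "qt_form q t (mvar r * (\<Sum>e\<in>keys f. single e (lookup f e))) g =
    qt_weight q t r * qt_form q t (\<Sum>e\<in>keys f. single e (lookup f e)) (pd r g)"
    by (simp add: sum_distrib_left qt_form_sum_left)
  then show ?thesis using mpol_eq_sum_single[of "keys f" f] by simp
qed

section \<open>Partial fractions of products of linear factors\<close>

lemma coeff_prod_reversed:
  fixes c :: "nat \<Rightarrow> 'b::idom"
  assumes "finite S" "\<And>j. j \<in> S \<Longrightarrow> c j \<noteq> 0"
  shows "coeff (\<Prod>j\<in>S. [:1, c j:]) k =
    (if k > card S then 0 else coeff (\<Prod>j\<in>S. [:c j, 1:]) (card S - k))"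
proof -
  have "(\<Prod>j\<in>S. [:1, c j:]) = (\<Prod>j\<in>S. reflect_poly [:c j, 1:])"
    by (rule prod.cong) (use assms in \<open>auto simp: reflect_poly_def\<close>)
  also have "\<dots> = reflect_poly (\<Prod>j\<in>S. [:c j, 1:])"
    by (rule reflect_poly_prod[symmetric])
  finally have r: "(\<Prod>j\<in>S. [:1, c j:]) = reflect_poly (\<Prod>j\<in>S. [:c j, 1:])" .
  have "degree (\<Prod>j\<in>S. [:c j, 1:]) = (\<Sum>j\<in>S. degree [:c j, 1:])"
    by (rule degree_prod_sum_eq) auto
  then show ?thesis unfolding r coeff_reflect_poly by simp
qed

text \<open>Reversing the order of the coefficients turns the claim into an identity of polynomials of degree at
  most \<open>N\<close>. It holds at the nodes \<open>x_k\<close>, by the choice of \<open>w\<close>, and at zero.\<close>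

lemma partial_fractions:
  fixes x w :: "nat \<Rightarrow> 'b::idom"
  assumes inj: "inj_on x {..<N}" and x0: "\<And>j. j < N \<Longrightarrow> x j \<noteq> 0" and s: "s \<noteq> 0"
    and w: "\<And>k. k < N \<Longrightarrow> a * (\<Prod>j<N. x k - s * x j) = x k * w k * (\<Prod>j\<in>{..<N} - {k}. x k - x j)"
  shows "smult a (\<Prod>j<N. [:1, - (s * x j):]) =
    smult (s ^ N * a) (\<Prod>j<N. [:1, - x j:]) + (\<Sum>k<N. smult (w k) (\<Prod>j\<in>{..<N} - {k}. [:1, - x j:]))"
proof -
  define P where "P = (\<Prod>j<N. [:- (s * x j), 1:])"
  define Q where "Q = (\<Prod>j<N. [:- x j, 1:])"
  define R where "R = (\<lambda>k. \<Prod>j\<in>{..<N} - {k}. [:- x j, 1:])"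
  define F where "F = smult a P - smult (s ^ N * a) Q - (\<Sum>k<N. smult (w k) (pCons 0 (R k)))"
  have deg: "degree (\<Prod>j\<in>S. [:c j, 1 :: 'b:]) \<le> card S" if "finite S" for S and c :: "nat \<Rightarrow> 'b"
    using degree_prod_sum_le[OF that, of "\<lambda>j. [:c j, 1:]"] by simp
  have degR: "degree (pCons 0 (R k)) \<le> N" if "k < N" for k
  proof -
    have "degree (R k) \<le> card ({..<N} - {k})" unfolding R_def by (rule deg) simp
    also have "\<dots> = N - 1" using that by simp
    finally show ?thesis using that by (intro degree_pCons_le[THEN le_trans]) simp
  qed
  have "degree F \<le> N"
    unfolding F_def
    by (intro degree_diff_le degree_smult_le[THEN le_trans] degree_sum_le degR)
       (use deg[of "{..<N}"] in \<open>auto simp: P_def Q_def\<close>)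
  moreover have "poly F y = 0" if y: "y \<in> insert 0 (x ` {..<N})" for y
  proof (cases "y = 0")
    case True
    have "poly P 0 = s ^ N * poly Q 0"
      by (simp add: P_def Q_def poly_prod prod.distrib flip: mult_minus_right)
    then show ?thesis using True by (simp add: F_def poly_sum)
  next
    case False
    then obtain k where k: "k < N" "y = x k" using y by auto
    have "poly Q y = 0" using k by (auto simp: Q_def poly_prod)
    moreover have "poly (R i) y = 0" if "i < N" "i \<noteq> k" for i
      using k that by (auto simp: R_def poly_prod)
    then have "(\<Sum>i<N. w i * (y * poly (R i) y)) = (\<Sum>i<N. if i = k then w k * (y * poly (R k) y) else 0)"
      by (intro sum.cong) auto
    moreover have "poly P y = (\<Prod>j<N. x k - s * x j)"
      unfolding P_def poly_prod k(2) by (rule prod.cong) auto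
    moreover have "poly (R k) y = (\<Prod>j\<in>{..<N} - {k}. x k - x j)"
      unfolding R_def poly_prod k(2) by (rule prod.cong) auto
    ultimately show ?thesis using k w[OF k(1)] by (simp add: F_def poly_sum mult_ac)
  qed
  moreover have "card (insert 0 (x ` {..<N})) = Suc N"
    using x0 card_image[OF inj] by (subst card_insert_disjoint) auto
  ultimately have "F = 0"
    using card_poly_roots_bound[of F] card_mono[of "{y. poly F y = 0}" "insert 0 (x ` {..<N})"]
      poly_roots_finite[of F] by fastforce
  then have eq: "coeff F j = 0" for j by simp
  show ?thesis
  proof (rule poly_eqI)
    fix m
    show "coeff (smult a (\<Prod>j<N. [:1, - (s * x j):])) m =
      coeff (smult (s ^ N * a) (\<Prod>j<N. [:1, - x j:]) + (\<Sum>k<N. smult (w k) (\<Prod>j\<in>{..<N} - {k}. [:1, - x j:]))) m"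
    proof (cases "m \<le> N")
      case True
      have 1: "coeff (\<Prod>j<N. [:1, - (s * x j):]) m = coeff P (N - m)"
        unfolding P_def by (subst coeff_prod_reversed) (use True x0 s in auto)
      have 2: "coeff (\<Prod>j<N. [:1, - x j:]) m = coeff Q (N - m)"
        unfolding Q_def by (subst coeff_prod_reversed) (use True x0 in auto)
      have 3: "coeff (\<Prod>j\<in>{..<N} - {k}. [:1, - x j:]) m = coeff (pCons 0 (R k)) (N - m)" if "k < N" for k
      proof (cases "m = N")
        case True
        then show ?thesis using that by (subst coeff_prod_reversed) (use x0 in auto)
      next
        case False
        then have "N - m = Suc (N - 1 - m)" using True by simp
        then show ?thesis unfolding R_def using that False True
          by (subst coeff_prod_reversed) (use x0 in auto)
      qed
      have "a * coeff P (N - m) = s ^ N * a * coeff Q (N - m) + (\<Sum>k<N. w k * coeff (pCons 0 (R k)) (N - m))"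
        using eq[of "N - m"] by (simp add: F_def coeff_sum algebra_simps del: smult_pCons)
      then show ?thesis by (simp add: coeff_sum 1 2 3)
    next
      case False
      have "coeff (\<Prod>j<N. [:1, - (s * x j):]) m = 0" "coeff (\<Prod>j<N. [:1, - x j:]) m = 0"
        using False x0 s by (subst coeff_prod_reversed; auto)+
      moreover have "coeff (\<Prod>j\<in>{..<N} - {k}. [:1, - x j:]) m = 0" if "k < N" for k
        using False x0 s that by (subst coeff_prod_reversed) auto
      ultimately show ?thesis by (simp add: coeff_sum)
    qed
  qed
qed

section \<open>Linear factors as power series\<close>

lemma fps_euler_unique:
  fixes F G R :: "'b::{idom, ring_char_0} fps"
  assumes "fps_X * fps_deriv F = R * F" "fps_X * fps_deriv G = R * G"
    and "fps_nth R 0 = 0" "fps_nth F 0 = fps_nth G 0"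
  shows "F = G"
proof (rule fps_ext)
  have rec: "of_nat m * fps_nth Y m = (\<Sum>i=1..m. fps_nth R i * fps_nth Y (m - i))"
    if "fps_X * fps_deriv Y = R * Y" for Y :: "'b fps" and m
  proof -
    have "of_nat m * fps_nth Y m = fps_nth (fps_X * fps_deriv Y) m"
      by (cases m) auto
    also have "\<dots> = (\<Sum>i=0..m. fps_nth R i * fps_nth Y (m - i))"
      by (simp add: that fps_mult_nth)
    also have "\<dots> = (\<Sum>i=1..m. fps_nth R i * fps_nth Y (m - i))"
      using assms(3) by (simp add: sum.atLeast_Suc_atMost)
    finally show ?thesis .
  qed
  show "fps_nth F m = fps_nth G m" for m
  proof (induction m rule: less_induct)
    case (less m)
    have "of_nat m * fps_nth F m = of_nat m * fps_nth G m"
      unfolding rec[OF assms(1)] rec[OF assms(2)] by (rule sum.cong) (use less in auto)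
    then show ?case using assms(4) by (cases "m = 0") auto
  qed
qed

definition fps_geom :: "'b::comm_ring_1 \<Rightarrow> 'b fps" where
  "fps_geom y = Abs_fps (\<lambda>m. y ^ m)"

lemma fps_geom_mult: "(1 - fps_const y * fps_X) * fps_geom y = 1"
proof (rule fps_ext)
  fix m
  show "fps_nth ((1 - fps_const y * fps_X) * fps_geom y) m = fps_nth 1 m"
    by (cases m) (simp_all add: fps_geom_def left_diff_distrib mult.assoc)
qed

lemma fps_euler_linear_prod:
  fixes y :: "nat \<Rightarrow> 'b::comm_ring_1"
  shows "fps_X * fps_deriv (\<Prod>j<N. 1 - fps_const (y j) * fps_X) =
    - (\<Sum>j<N. fps_geom (y j) - 1) * (\<Prod>j<N. 1 - fps_const (y j) * fps_X)"
proof (induction N)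
  case (Suc N)
  define U where "U = (\<Prod>j<N. 1 - fps_const (y j) * fps_X)"
  define S where "S = (\<Sum>j<N. fps_geom (y j) - 1)"
  define v where "v = 1 - fps_const (y N) * fps_X"
  define g where "g = fps_geom (y N)"
  have vg: "v * g = 1" unfolding v_def g_def by (rule fps_geom_mult)
  have v': "fps_X * fps_deriv v = v - 1" by (simp add: v_def mult.commute)
  have "fps_X * fps_deriv (U * v) = (fps_X * fps_deriv U) * v + U * (fps_X * fps_deriv v)"
    by (simp add: algebra_simps)
  also have "\<dots> = - S * U * v + U * (v - v * g)"
    using Suc by (simp add: U_def S_def v' vg)
  also have "\<dots> = - (S + (g - 1)) * (U * v)" by (simp add: algebra_simps)
  finally show ?case by (simp add: U_def S_def v_def g_def)
qed simp

section \<open>The Macdonald operator on symmetric functions\<close>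

text \<open>The coefficients of \<open>exp (\<Sum>\<^sub>r (1 - t^(-r)) p_r z^r / r)\<close>, which is
  \<open>\<Prod> (1 - z x_i / t) / (1 - z x_i)\<close> in variables \<open>x_i\<close>. The recursion expresses the logarithmic
  derivative.\<close>

fun vertex_coeff :: "'a::field_char_0 \<Rightarrow> nat \<Rightarrow> 'a mpol" where
  "vertex_coeff t 0 = 1"
| "vertex_coeff t (Suc m) = mconst (1 / of_nat (Suc m)) *
     (\<Sum>r<Suc m. mconst (1 - 1 / t ^ Suc r) * mvar r * vertex_coeff t (m - r))"

lemma vertex_coeff_rec:
  "of_nat m * vertex_coeff t m = (\<Sum>r<m. mconst (1 - 1 / t ^ Suc r) * mvar r * vertex_coeff t (m - Suc r))"
proof (cases m)
  case (Suc k)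
  let ?S = "\<Sum>r<Suc k. mconst (1 - 1 / t ^ Suc r) * mvar r * vertex_coeff t (k - r)"
  have "of_nat m * vertex_coeff t m = (mconst (of_nat (Suc k)) * mconst (1 / of_nat (Suc k))) * ?S"
    unfolding Suc vertex_coeff.simps by (simp only: mconst_of_nat mult.assoc)
  also have "mconst (of_nat (Suc k)) * mconst (1 / of_nat (Suc k)) = (1 :: 'a mpol)"
    by (simp flip: mconst_mult del: of_nat_Suc)
  finally show ?thesis by (simp only: Suc mult_1 diff_Suc_Suc)
qed simp

definition q_shift :: "'a::field_char_0 \<Rightarrow> 'a mpol \<Rightarrow> 'a mpol poly" where
  "q_shift q = shift (\<lambda>r. q ^ r - 1)"

definition macop :: "'a::field_char_0 \<Rightarrow> 'a \<Rightarrow> 'a mpol \<Rightarrow> 'a mpol" where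
  "macop q t f = (\<Sum>m\<le>degree (q_shift q f). vertex_coeff t m * coeff (q_shift q f) m)"

lemma macop_altdef:
  "degree (q_shift q f) \<le> n \<Longrightarrow> macop q t f = (\<Sum>m\<le>n. vertex_coeff t m * coeff (q_shift q f) m)"
  unfolding macop_def by (rule sum.mono_neutral_left) (auto simp: coeff_eq_0)

lemma macop_add: "macop q t (f + g) = macop q t f + macop q t g"
proof -
  let ?n = "max (degree (q_shift q f)) (degree (q_shift q g))"
  have a: "q_shift q (f + g) = q_shift q f + q_shift q g" by (simp add: q_shift_def shift_add)
  have "degree (q_shift q (f + g)) \<le> ?n" unfolding a by (rule degree_add_le_max)
  then show ?thesis
    by (simp add: macop_altdef[of q _ ?n] a distrib_left sum.distrib)
qed

lemma macop_scale: "macop q t (mconst c * f) = mconst c * macop q t f"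
proof -
  have a: "q_shift q (mconst c * f) = smult (mconst c) (q_shift q f)"
    by (simp add: q_shift_def shift_mult shift_mconst)
  have "degree (q_shift q (mconst c * f)) \<le> degree (q_shift q f)" unfolding a by (rule degree_smult_le)
  then show ?thesis
    by (simp add: macop_altdef[of q _ "degree (q_shift q f)"] a sum_distrib_left mult.left_commute)
qed

lemma macop_0 [simp]: "macop q t 0 = 0"
  using macop_scale[of q t 0 0] by simp

lemma macop_sum: "macop q t (sum f A) = (\<Sum>x\<in>A. macop q t (f x))"
  by (induction A rule: infinite_finite_induct) (auto simp: macop_add)

locale qt_params =
  fixes q t :: "'a::field_char_0"
  assumes t_nonzero: "t \<noteq> 0"
    and t_power: "\<And>r. t ^ Suc r \<noteq> 1"
begin

text \<open>The recursions of \<open>vertex_coeff\<close> and of the coefficients of \<open>q_shift\<close> correspond to each other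
  when multiplication by \<open>p_r\<close> is exchanged with its adjoint, a multiple of \<open>d/dp_r\<close>.\<close>

lemma vertex_coeff_adjoint:
  "qt_form q t (vertex_coeff t m * f) g = (1 / t ^ m) * qt_form q t f (coeff (q_shift q g) m)"
proof (induction m arbitrary: f g rule: less_induct)
  case (less m)
  show ?case
  proof (cases "m = 0")
    case True
    then show ?thesis by (simp add: q_shift_def coeff_shift_0)
  next
    case False
    have scal: "(1 - 1 / t ^ Suc r) * (qt_weight q t r * (1 / t ^ (m - Suc r))) =
      (1 / t ^ m) * (of_nat (Suc r) * (q ^ Suc r - 1))" if "r < m" for r
    proof -
      define T where "T = t ^ Suc r"
      have T: "T \<noteq> 0" "1 - T \<noteq> 0" using t_nonzero t_power[of r] by (auto simp: T_def)
      define S where "S = t ^ (m - Suc r)"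
      have tm: "t ^ m = T * S"
        using that unfolding T_def S_def power_add[symmetric] by simp
      have "S \<noteq> 0" using t_nonzero by (simp add: S_def)
      then show ?thesis
        unfolding qt_weight_def T_def[symmetric] S_def[symmetric] tm using T
        by (simp add: divide_simps del: of_nat_Suc power_Suc) (simp add: algebra_simps del: of_nat_Suc power_Suc)
    qed
    have "of_nat m * qt_form q t (vertex_coeff t m * f) g = qt_form q t (mconst (of_nat m) * (vertex_coeff t m * f)) g"
      by (simp only: qt_form_scale_left)
    also have "mconst (of_nat m) * (vertex_coeff t m * f) =
      (\<Sum>r<m. mconst (1 - 1 / t ^ Suc r) * (mvar r * (vertex_coeff t (m - Suc r) * f)))"
      unfolding mconst_of_nat mult.assoc[symmetric] vertex_coeff_rec sum_distrib_right by (simp only: mult.assoc)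
    also have "qt_form q t \<dots> g =
      (\<Sum>r<m. (1 - 1 / t ^ Suc r) * (qt_weight q t r * qt_form q t (vertex_coeff t (m - Suc r) * f) (pd r g)))"
      by (simp only: qt_form_sum_left qt_form_scale_left qt_form_mvar_adjoint)
    also have "\<dots> = (\<Sum>r<m. (1 / t ^ m) * (of_nat (Suc r) * (q ^ Suc r - 1)) * qt_form q t f (coeff (q_shift q (pd r g)) (m - Suc r)))"
    proof (rule sum.cong[OF refl])
      fix r assume r: "r \<in> {..<m}"
      then have eq: "qt_form q t (vertex_coeff t (m - Suc r) * f) (pd r g) =
         (1 / t ^ (m - Suc r)) * qt_form q t f (coeff (q_shift q (pd r g)) (m - Suc r))"
        by (intro less.IH) auto
      have "(1 - 1 / t ^ Suc r) * (qt_weight q t r * qt_form q t (vertex_coeff t (m - Suc r) * f) (pd r g)) =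
        ((1 - 1 / t ^ Suc r) * (qt_weight q t r * (1 / t ^ (m - Suc r)))) * qt_form q t f (coeff (q_shift q (pd r g)) (m - Suc r))"
        unfolding eq by (simp only: mult.assoc)
      then show "(1 - 1 / t ^ Suc r) * (qt_weight q t r * qt_form q t (vertex_coeff t (m - Suc r) * f) (pd r g)) =
        (1 / t ^ m) * (of_nat (Suc r) * (q ^ Suc r - 1)) * qt_form q t f (coeff (q_shift q (pd r g)) (m - Suc r))"
        using r by (simp only: scal lessThan_iff)
    qed
    also have "\<dots> = (1 / t ^ m) * qt_form q t f (\<Sum>r<m. mconst (of_nat (Suc r) * (q ^ Suc r - 1)) * coeff (q_shift q (pd r g)) (m - Suc r))"
      by (simp only: qt_form_sum_right qt_form_scale_right sum_distrib_left mult.assoc)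
    also have "(\<Sum>r<m. mconst (of_nat (Suc r) * (q ^ Suc r - 1)) * coeff (q_shift q (pd r g)) (m - Suc r)) =
      mconst (of_nat m) * coeff (q_shift q g) m"
      unfolding q_shift_def mconst_of_nat coeff_shift_rec by (simp only: mconst_mult mconst_of_nat mult.assoc)
    finally have "of_nat m * qt_form q t (vertex_coeff t m * f) g =
      of_nat m * ((1 / t ^ m) * qt_form q t f (coeff (q_shift q g) m))"
      by (simp only: qt_form_scale_right mult_ac)
    moreover have "of_nat m \<noteq> (0 :: 'a)" using False by simp
    ultimately show ?thesis by (rule mult_left_cancel[THEN iffD1, rotated])
  qed
qed

text \<open>The right-hand side is symmetric in \<open>f\<close> and \<open>g\<close>, which makes the operator self-adjoint.\<close>

lemma macop_form: "\<exists>n0. \<forall>n\<ge>n0. qt_form q t (macop q t f) g =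
  (\<Sum>m\<le>n. (1 / t ^ m) * qt_form q t (coeff (q_shift q f) m) (coeff (q_shift q g) m))"
  using macop_altdef[of q f] by (intro exI[of _ "degree (q_shift q f)"])
    (simp add: qt_form_sum_left vertex_coeff_adjoint)

lemma macop_selfadjoint: "qt_form q t (macop q t f) g = qt_form q t f (macop q t g)"
proof -
  obtain m where m: "\<forall>n\<ge>m. qt_form q t (macop q t f) g =
    (\<Sum>m\<le>n. (1 / t ^ m) * qt_form q t (coeff (q_shift q f) m) (coeff (q_shift q g) m))"
    using macop_form by blast
  obtain n where n: "\<forall>k\<ge>n. qt_form q t (macop q t g) f =
    (\<Sum>m\<le>k. (1 / t ^ m) * qt_form q t (coeff (q_shift q g) m) (coeff (q_shift q f) m))"
    using macop_form by blast
  have "qt_form q t (macop q t f) g = qt_form q t (macop q t g) f"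
    using m[rule_format, of "max m n"] n[rule_format, of "max m n"]
    by (simp add: qt_form_commute[of q t "coeff (q_shift q g) _"])
  then show ?thesis by (simp add: qt_form_commute)
qed

end

section \<open>The operator in finitely many variables\<close>

definition scale_var :: "'a::comm_semiring_1 \<Rightarrow> nat \<Rightarrow> 'a mpol \<Rightarrow> 'a mpol" where
  "scale_var c i = msub mconst (\<lambda>j. if j = i then mconst c * mvar j else mvar j)"

lemma semiring_hom_scale_var: "semiring_hom (scale_var c i)"
  unfolding scale_var_def by (rule semiring_hom_msub[OF semiring_hom_mconst])

lemma scale_var_mvar: "scale_var c i (mvar j) = (if j = i then mconst c * mvar j else mvar j)"
  unfolding scale_var_def by (rule msub_mvar[OF semiring_hom_mconst])

lemma scale_var_mconst: "scale_var c i (mconst a) = mconst a"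
  unfolding scale_var_def by (rule msub_mconst[OF semiring_hom_mconst])

lemma lookup_scale_var: "lookup (scale_var c i f) e = c ^ lookup e i * lookup f e"
proof -
  have mv: "monomial_value (\<lambda>j. if j = i then mconst c * mvar j else mvar j) d =
    single d (c ^ lookup d i)" for d
  proof -
    have "monomial_value (\<lambda>j. if j = i then mconst c * mvar j else mvar j) d =
      (\<Prod>j\<in>keys d. (if j = i then mconst (c ^ lookup d i) else 1) * mvar j ^ lookup d j)"
      unfolding monomial_value_def by (rule prod.cong) (auto simp: mconst_power power_mult_distrib)
    also have "\<dots> = (\<Prod>j\<in>keys d. if j = i then mconst (c ^ lookup d i) else 1) * monomial_value mvar d"
      by (simp add: prod.distrib monomial_value_def)
    also have "(\<Prod>j\<in>keys d. if j = i then mconst (c ^ lookup d i) else 1) = (mconst (c ^ lookup d i) :: 'a mpol)"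
      by (auto simp: in_keys_iff)
    finally show ?thesis by (simp add: monomial_value_mvar mconst_def mult_single)
  qed
  have "scale_var c i f = (\<Sum>d\<in>keys f. single d (lookup f d * c ^ lookup d i))"
    unfolding scale_var_def msub_def mv by (simp add: mconst_def mult_single)
  then have "lookup (scale_var c i f) e = (\<Sum>d\<in>keys f. if d = e then lookup f e * c ^ lookup e i else 0)"
    by (auto simp: lookup_sum lookup_single when_def intro!: sum.cong)
  then show ?thesis by (auto simp: in_keys_iff mult.commute)
qed

lemma eval_q_shift:
  assumes "i < n"
  shows "eval_hom (in_vars n) (mvar i) (q_shift q f) = scale_var q i (in_vars n f)"
proof -
  have "msub mconst (\<lambda>r. powsum n (Suc r) + mconst (q ^ Suc r - 1) * mvar i ^ Suc r) f = scale_var q i (in_vars n f)"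
  proof (rule mpol_hom_eqI[where G = "\<lambda>f. scale_var q i (in_vars n f)"])
    show "semiring_hom (\<lambda>f. scale_var q i (in_vars n f))"
      by (rule semiring_hom_comp[OF semiring_hom_scale_var semiring_hom_in_vars])
    fix r
    have "scale_var q i (powsum n (Suc r)) = (\<Sum>j<n. (if j = i then mconst q * mvar j else mvar j) ^ Suc r)"
      unfolding powsum_def by (simp only: semiring_hom_sum[OF semiring_hom_scale_var]
          semiring_hom_power[OF semiring_hom_scale_var] scale_var_mvar)
    also have "\<dots> = (\<Sum>j<n. mvar j ^ Suc r + (if j = i then mconst (q ^ Suc r - 1) * mvar i ^ Suc r else 0))"
      by (rule sum.cong) (auto simp: mconst_diff mconst_power power_mult_distrib algebra_simps mconst_mult)
    also have "\<dots> = powsum n (Suc r) + mconst (q ^ Suc r - 1) * mvar i ^ Suc r"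
      using assms by (simp add: sum.distrib powsum_def del: power_Suc)
    finally show "msub mconst (\<lambda>r. powsum n (Suc r) + mconst (q ^ Suc r - 1) * mvar i ^ Suc r) (mvar r) =
        scale_var q i (in_vars n (mvar r))"
      by (simp only: msub_mvar[OF semiring_hom_mconst] in_vars_mvar)
  qed (simp_all only: semiring_hom_msub semiring_hom_mconst msub_mconst in_vars_mconst scale_var_mconst)
  then show ?thesis unfolding q_shift_def eval_shift .
qed

definition vandermonde :: "nat \<Rightarrow> 'a::comm_ring_1 mpol" where
  "vandermonde n = (\<Prod>(i, j)\<in>{(i, j). i < j \<and> j < n}. mvar i - mvar j)"

lemma finite_pairs: "finite {(i, j). i < j \<and> j < n}" for n :: nat
  by (rule finite_subset[of _ "{..<n} \<times> {..<n}"]) auto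

text \<open>Rescaling \<open>x_k\<close> affects only the factors that contain it. In these the order of the two variables
  contributes the same signs on both sides.\<close>

lemma scale_var_vandermonde:
  fixes c :: "'a::comm_ring_1"
  assumes k: "k < n"
  shows "scale_var c k (vandermonde n) * (\<Prod>j\<in>{..<n} - {k}. mvar k - mvar j) =
    vandermonde n * (\<Prod>j\<in>{..<n} - {k}. mconst c * mvar k - mvar j)"
proof -
  let ?S = "{..<n} - {k}"
  let ?A = "{(i, j). i < j \<and> j < n}"
  let ?m = "\<lambda>j. (min j k, max j k)"
  define h where "h = (\<lambda>(i, j). mvar i - mvar j :: 'a mpol)"
  define sg where "sg = (\<lambda>j. if j < k then - 1 else 1 :: 'a mpol)"
  have inj: "inj_on ?m ?S" by (auto simp: inj_on_def min_def max_def split: if_splits)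
  have sub: "?m ` ?S \<subseteq> ?A" using k by (auto simp: min_def max_def)
  note hom = semiring_hom_scale_var[of c k]
  define R where "R = (\<Prod>p\<in>?A - ?m ` ?S. h p)"
  have split: "vandermonde n = R * (\<Prod>j\<in>?S. h (?m j))"
    unfolding vandermonde_def R_def h_def[symmetric] prod.subset_diff[OF sub finite_pairs]
    by (simp add: prod.reindex[OF inj])
  have h1: "h (?m j) = sg j * (mvar k - mvar j)" if "j \<in> ?S" for j
    using that by (auto simp: h_def sg_def min_def max_def)
  have h2: "scale_var c k (h (?m j)) = sg j * (mconst c * mvar k - mvar j)" if "j \<in> ?S" for j
    using that by (auto simp: h_def sg_def min_def max_def semiring_hom_diff[OF hom] scale_var_mvar)
  have "scale_var c k R = R"
    unfolding R_def semiring_hom_prod[OF hom]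
  proof (rule prod.cong[OF refl])
    fix p assume p: "p \<in> ?A - ?m ` ?S"
    obtain i j where ij: "p = (i, j)" by fastforce
    have "i \<noteq> k"
    proof
      assume "i = k"
      then have "p = ?m j" "j \<in> ?S" using p ij by (auto simp: min_def max_def)
      then show False using p by blast
    qed
    moreover have "j \<noteq> k"
    proof
      assume "j = k"
      then have "p = ?m i" "i \<in> ?S" using p ij by (auto simp: min_def max_def)
      then show False using p by blast
    qed
    ultimately show "scale_var c k (h p) = h p"
      by (simp add: h_def ij semiring_hom_diff[OF hom] scale_var_mvar)
  qed
  then have "scale_var c k (vandermonde n) = R * (\<Prod>j\<in>?S. sg j * (mconst c * mvar k - mvar j))"
    unfolding split semiring_hom_mult[OF hom] semiring_hom_prod[OF hom] using h2
    by (metis (no_types, lifting) prod.cong)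
  moreover have "vandermonde n = R * (\<Prod>j\<in>?S. sg j * (mvar k - mvar j))"
    unfolding split using h1 by (metis (no_types, lifting) prod.cong)
  ultimately show ?thesis by (simp add: prod.distrib mult_ac)
qed

text \<open>Both sides have the same logarithmic derivative. With \<open>\<psi> = in_vars n\<close> this is the product formula
  in \<open>n\<close> variables; with a specialization of the power sums it evaluates the coefficients.\<close>

lemma vertex_coeff_series:
  fixes \<psi> :: "'a::field_char_0 mpol \<Rightarrow> 'b::{idom, ring_char_0}" and x y :: "nat \<Rightarrow> 'b"
  assumes hom: "semiring_hom \<psi>"
    and gen: "\<And>r. \<psi> (mconst (1 - 1 / t ^ Suc r) * mvar r) = (\<Sum>j<n. x j ^ Suc r - y j ^ Suc r)"
  shows "(\<Prod>j<n. 1 - fps_const (x j) * fps_X) * Abs_fps (\<lambda>m. \<psi> (vertex_coeff t m)) =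
    (\<Prod>j<n. 1 - fps_const (y j) * fps_X)"
proof -
  define H where "H = Abs_fps (\<lambda>m. \<psi> (vertex_coeff t m))"
  define G where "G = (\<lambda>z. \<Sum>j<n. fps_geom (z j) - 1 :: 'b fps)"
  define U where "U = (\<lambda>z :: nat \<Rightarrow> 'b. \<Prod>j<n. 1 - fps_const (z j) * fps_X)"
  have U': "fps_X * fps_deriv (U z) = - G z * U z" for z
    unfolding U_def G_def by (rule fps_euler_linear_prod)
  have G0: "fps_nth (G z) 0 = 0" for z
    by (simp add: G_def fps_sum_nth fps_geom_def)
  have Gm: "fps_nth (G x - G y) (Suc m) = (\<Sum>j<n. x j ^ Suc m - y j ^ Suc m)" for m
    by (simp add: G_def fps_sum_nth fps_geom_def sum_subtractf)
  have of_nat: "\<psi> (of_nat m) = of_nat m" for m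
    by (induction m) (simp_all add: semiring_hom_0[OF hom] semiring_hom_1[OF hom] semiring_hom_add[OF hom])
  have H': "fps_X * fps_deriv H = (G x - G y) * H"
  proof (rule fps_ext)
    fix m
    have "fps_nth (fps_X * fps_deriv H) m = of_nat m * \<psi> (vertex_coeff t m)"
      by (cases m) (auto simp: H_def)
    also have "\<dots> = \<psi> (of_nat m * vertex_coeff t m)"
      by (simp only: semiring_hom_mult[OF hom] of_nat)
    also have "\<dots> = (\<Sum>r<m. fps_nth (G x - G y) (Suc r) * fps_nth H (m - Suc r))"
      unfolding vertex_coeff_rec semiring_hom_sum[OF hom] semiring_hom_mult[OF hom, of _ "vertex_coeff t _"]
        gen Gm by (simp add: H_def)
    also have "\<dots> = (\<Sum>i\<in>{1..m}. fps_nth (G x - G y) i * fps_nth H (m - i))"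
      by (rule sum.reindex_bij_witness[of _ "\<lambda>i. i - 1" Suc]) auto
    also have "\<dots> = (\<Sum>i=0..m. fps_nth (G x - G y) i * fps_nth H (m - i))"
      by (simp add: sum.atLeast_Suc_atMost G0)
    finally show "fps_nth (fps_X * fps_deriv H) m = fps_nth ((G x - G y) * H) m"
      by (simp add: fps_mult_nth)
  qed
  have "U x * H = U y"
  proof (rule fps_euler_unique)
    have "fps_X * fps_deriv (U x * H) = (fps_X * fps_deriv (U x)) * H + U x * (fps_X * fps_deriv H)"
      by (simp add: algebra_simps)
    also have "\<dots> = - G y * (U x * H)" unfolding U' H' by (simp add: algebra_simps)
    finally show "fps_X * fps_deriv (U x * H) = - G y * (U x * H)" .
    show "fps_X * fps_deriv (U y) = - G y * U y" by (rule U')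
    have "fps_nth (U z) 0 = 1" for z
      unfolding U_def by (induction n) auto
    then show "fps_nth (U x * H) 0 = fps_nth (U y) 0" by (simp add: H_def semiring_hom_1[OF hom])
  qed (simp add: G0)
  then show ?thesis by (simp add: U_def H_def)
qed

context qt_params
begin

lemma in_vars_vertex_coeff_fps:
  "(\<Prod>j<n. 1 - fps_const (mvar j) * fps_X) * Abs_fps (\<lambda>m. in_vars n (vertex_coeff t m)) =
    (\<Prod>j<n. 1 - fps_const (mconst (1 / t) * mvar j) * fps_X)"
proof (rule vertex_coeff_series[OF semiring_hom_in_vars])
  fix r
  have pow: "(mconst (1 / t) * mvar j) ^ Suc r = mconst (1 / t ^ Suc r) * mvar j ^ Suc r" for j
    unfolding power_mult_distrib mconst_power[symmetric] power_one_over ..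
  show "in_vars n (mconst (1 - 1 / t ^ Suc r) * mvar r) =
      (\<Sum>j<n. mvar j ^ Suc r - (mconst (1 / t) * mvar j) ^ Suc r)"
    unfolding in_vars_mult in_vars_mconst in_vars_mvar powsum_def sum_distrib_left pow
    by (simp add: mconst_diff left_diff_distrib del: power_Suc)
qed

text \<open>The factor common to the residues of \<open>\<Prod> (1 - z x_j / t) / (1 - z x_j)\<close> at all nodes.\<close>

definition node_coeff :: "nat \<Rightarrow> 'a" where
  "node_coeff n = (1 - 1 / t) / t ^ (n - 1)"

text \<open>The partial fraction expansion of \<open>\<Prod> (1 - z x_j / t) / (1 - z x_j)\<close>, multiplied by the
  Vandermonde product to stay within polynomials.\<close>

lemma vandermonde_vertex_coeff:
  "vandermonde n * in_vars n (vertex_coeff t m) =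
    (if m = 0 then mconst (1 / t ^ n) * vandermonde n else 0) +
    (\<Sum>i<n. mconst (node_coeff n) * scale_var t i (vandermonde n) * mvar i ^ m)"
proof -
  define H where "H = Abs_fps (\<lambda>m. in_vars n (vertex_coeff t m))"
  define s where "s = (mconst (1 / t) :: 'a mpol)"
  define w where "w = (\<lambda>i. mconst (node_coeff n) * scale_var t i (vandermonde n))"
  define a where "a = (vandermonde n :: 'a mpol)"
  define U where "U = (\<Prod>j<n. 1 - fps_const (mvar j) * fps_X :: 'a mpol fps)"
  define V where "V = (\<lambda>i. \<Prod>j\<in>{..<n} - {i}. 1 - fps_const (mvar j) * fps_X :: 'a mpol fps)"
  have mvar_inj: "mvar i = (mvar j :: 'a mpol) \<longleftrightarrow> i = j" for i j
  proof
    assume eq: "mvar i = (mvar j :: 'a mpol)"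
    have "lookup (mvar i :: 'a mpol) (single i 1) = lookup (mvar j :: 'a mpol) (single i 1)"
      unfolding eq ..
    then have "single i 1 = single j (1 :: nat)"
      by (auto simp: mvar_def lookup_single when_def split: if_splits)
    then have "lookup (single i 1) i = lookup (single j (1 :: nat)) i" by simp
    then show "i = j" by (auto simp: lookup_single when_def split: if_splits)
  qed simp
  have mvar_nz: "mvar i \<noteq> (0 :: 'a mpol)" for i
    by (simp add: mvar_def flip: keys_eq_empty)
  have s_nz: "s \<noteq> 0" unfolding s_def using t_nonzero by (simp add: mconst_def flip: keys_eq_empty)
  have pf: "smult a (\<Prod>j<n. [:1, - (s * mvar j):]) =
    smult (s ^ n * a) (\<Prod>j<n. [:1, - mvar j:]) + (\<Sum>k<n. smult (w k) (\<Prod>j\<in>{..<n} - {k}. [:1, - mvar j:]))"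
  proof (rule partial_fractions)
    show "inj_on (mvar :: nat \<Rightarrow> 'a mpol) {..<n}" by (auto simp: inj_on_def mvar_inj)
    fix k assume k: "k < n"
    let ?S = "{..<n} - {k}"
    have st: "s * mconst t = 1" using t_nonzero by (simp add: s_def flip: mconst_mult)
    have "(\<Prod>j<n. mvar k - s * mvar j) = (mvar k - s * mvar k) * (\<Prod>j\<in>?S. mvar k - s * mvar j)"
      using k by (intro prod.remove) auto
    also have "(\<Prod>j\<in>?S. mvar k - s * mvar j) = (\<Prod>j\<in>?S. s * (mconst t * mvar k - mvar j))"
      by (rule prod.cong) (auto simp: right_diff_distrib st simp flip: mult.assoc)
    also have "\<dots> = s ^ (n - 1) * (\<Prod>j\<in>?S. mconst t * mvar k - mvar j)"
      using k by (simp add: prod.distrib)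
    finally have eq: "(\<Prod>j<n. mvar k - s * mvar j) =
      (mvar k - s * mvar k) * (s ^ (n - 1) * (\<Prod>j\<in>?S. mconst t * mvar k - mvar j))" .
    have e: "mvar k - s * mvar k = mvar k * (1 - s)" by (simp add: algebra_simps)
    have "a * (\<Prod>j<n. mvar k - s * mvar j) =
      mvar k * ((1 - s) * s ^ (n - 1)) * (vandermonde n * (\<Prod>j\<in>?S. mconst t * mvar k - mvar j))"
      unfolding eq e a_def by (simp only: mult_ac)
    also have "(1 - s) * s ^ (n - 1) = mconst (node_coeff n)"
    proof -
      have "(1 - s) * s ^ (n - 1) = mconst ((1 - 1 / t) * (1 / t) ^ (n - 1))"
        by (simp only: s_def mconst_mult mconst_diff mconst_power mconst_1)
      then show ?thesis by (simp add: node_coeff_def power_one_over)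
    qed
    finally show "a * (\<Prod>j<n. mvar k - s * mvar j) = mvar k * w k * (\<Prod>j\<in>?S. mvar k - mvar j)"
      unfolding scale_var_vandermonde[OF k, symmetric] by (simp add: w_def mult_ac)
  qed (use mvar_nz s_nz in auto)
  have lin: "fps_of_poly [:1, - z:] = 1 - fps_const z * fps_X" for z :: "'a mpol"
    by (simp add: fps_of_poly_pCons fps_of_poly_const mult.commute)
  have pf': "fps_const a * (\<Prod>j<n. 1 - fps_const (s * mvar j) * fps_X) =
    fps_const (s ^ n * a) * U + (\<Sum>k<n. fps_const (w k) * V k)"
    using arg_cong[OF pf, of fps_of_poly]
    by (simp only: fps_of_poly_smult fps_of_poly_add fps_of_poly_sum fps_of_poly_prod lin U_def V_def)
  have VU: "V k = U * fps_geom (mvar k)" if "k < n" for k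
  proof -
    have "U = (1 - fps_const (mvar k) * fps_X) * V k"
      unfolding U_def V_def using that by (intro prod.remove) auto
    then have "U * fps_geom (mvar k) = ((1 - fps_const (mvar k) * fps_X) * fps_geom (mvar k)) * V k"
      by (simp only: mult_ac)
    then show ?thesis by (simp only: fps_geom_mult mult_1)
  qed
  have "fps_nth U 0 = 1" unfolding U_def by (induction n) auto
  then have U0: "U \<noteq> 0" by auto
  have "U * (fps_const a * H) = fps_const a * (\<Prod>j<n. 1 - fps_const (s * mvar j) * fps_X)"
    unfolding s_def in_vars_vertex_coeff_fps[of n, symmetric] U_def H_def by (simp only: mult.left_commute)
  also have "\<dots> = U * (fps_const (s ^ n * a) + (\<Sum>k<n. fps_const (w k) * fps_geom (mvar k)))"
    unfolding pf' distrib_left sum_distrib_left using VU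
    by (intro arg_cong2[of _ _ _ _ "(+)"] sum.cong) (auto simp: mult_ac)
  finally have "fps_const a * H = fps_const (s ^ n * a) + (\<Sum>k<n. fps_const (w k) * fps_geom (mvar k))"
    using U0 by simp
  then have "fps_nth (fps_const a * H) m = fps_nth (fps_const (s ^ n * a) + (\<Sum>k<n. fps_const (w k) * fps_geom (mvar k))) m"
    by simp
  then show ?thesis
    by (simp add: H_def a_def w_def fps_sum_nth fps_geom_def s_def power_one_over flip: mconst_power)
qed

text \<open>Macdonald's \<open>q\<close>-difference operator in \<open>n\<close> variables, multiplied by the Vandermonde product so that no
  division is needed.\<close>

definition macop_vars :: "nat \<Rightarrow> 'a mpol \<Rightarrow> 'a mpol" where
  "macop_vars n h = (\<Sum>i<n. scale_var t i (vandermonde n) * scale_var q i h)"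

text \<open>The residue at the node \<open>x_i\<close> comes with \<open>\<Sum>\<^sub>m x_i^m B_m f\<close>, the shift evaluated at \<open>y = x_i\<close>, and
  this evaluation rescales \<open>x_i\<close> by \<open>q\<close>.\<close>

lemma vandermonde_macop:
  "vandermonde n * in_vars n (macop q t f) =
    mconst (1 / t ^ n) * (vandermonde n * in_vars n f) + mconst (node_coeff n) * macop_vars n (in_vars n f)"
proof -
  let ?a = "vandermonde n :: 'a mpol" and ?d = "degree (q_shift q f)"
  let ?B = "\<lambda>m. in_vars n (coeff (q_shift q f) m)"
  have "?a * in_vars n (macop q t f) = (\<Sum>m\<le>?d. (?a * in_vars n (vertex_coeff t m)) * ?B m)"
    by (simp add: macop_def in_vars_sum in_vars_mult sum_distrib_left mult.assoc)
  also have "\<dots> = (\<Sum>m\<le>?d. (if m = 0 then mconst (1 / t ^ n) * ?a * ?B 0 else 0) +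
     (\<Sum>i<n. mconst (node_coeff n) * scale_var t i ?a * (?B m * mvar i ^ m)))"
    unfolding vandermonde_vertex_coeff distrib_right sum_distrib_right
    by (rule sum.cong) (auto simp: mult_ac)
  also have "\<dots> = mconst (1 / t ^ n) * ?a * ?B 0 +
     (\<Sum>i<n. mconst (node_coeff n) * scale_var t i ?a * (\<Sum>m\<le>?d. ?B m * mvar i ^ m))"
    unfolding sum.distrib sum_distrib_left by (subst sum.swap) simp
  also have "(\<Sum>i<n. mconst (node_coeff n) * scale_var t i ?a * (\<Sum>m\<le>?d. ?B m * mvar i ^ m)) =
    mconst (node_coeff n) * macop_vars n (in_vars n f)"
    unfolding macop_vars_def
    by (subst sum_distrib_left, rule sum.cong)
       (simp_all add: eval_q_shift[symmetric] eval_hom_altdef[OF semiring_hom_in_vars order_refl] mult.assoc)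
  also have "?B 0 = in_vars n f" by (simp add: q_shift_def coeff_shift_0)
  finally show ?thesis by (simp add: mult.assoc)
qed

end

section \<open>Triangularity with respect to dominance\<close>

definition delta :: "nat \<Rightarrow> (nat \<Rightarrow>\<^sub>0 nat)" where
  "delta n = (\<Sum>i<n. single i (n - 1 - i))"

lemma lookup_sum_single: "lookup (\<Sum>i<n. single i (c i)) k = (if k < n then c k else 0)" for c :: "nat \<Rightarrow> nat"
proof -
  have "lookup (\<Sum>i<n. single i (c i)) k = (\<Sum>i<n. if i = k then c k else 0)"
    unfolding lookup_sum by (rule sum.cong) (auto simp: lookup_single)
  then show ?thesis by simp
qed

lemma lookup_delta: "lookup (delta n) i = (if i < n then n - 1 - i else 0)"
  by (simp add: delta_def lookup_sum_single)

lemma dominated_add_cancel: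
  assumes "dominated a d" "a + b = d + k"
  shows "dominated k b"
proof -
  have "part_sum j a + part_sum j b = part_sum j d + part_sum j k" for j
    using assms(2) by (simp flip: part_sum_add)
  moreover have "part_sum j a \<le> part_sum j d" for j using assms(1) by (simp add: dominated_iff)
  ultimately have "part_sum j k \<le> part_sum j b" for j by (metis add_le_cancel_left add_le_mono1 le_trans nat_add_left_cancel_le)
  moreover have "psize a + psize b = psize d + psize k" using assms(2) by (simp flip: psize_add)
  ultimately show ?thesis using assms(1) by (simp add: dominated_iff)
qed

lemma lookup_mult_unique:
  fixes f g :: "'a::comm_semiring_1 mpol"
  assumes "\<And>a b. a \<in> keys f \<Longrightarrow> b \<in> keys g \<Longrightarrow> a + b = d + e \<Longrightarrow> a = d \<and> b = e"
  shows "lookup (f * g) (d + e) = lookup f d * lookup g e"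
proof -
  have "f * g = (\<Sum>a\<in>keys f. single a (lookup f a)) * (\<Sum>b\<in>keys g. single b (lookup g b))"
    using mpol_eq_sum_single[of "keys f" f] mpol_eq_sum_single[of "keys g" g] by simp
  then have "lookup (f * g) (d + e) =
     (\<Sum>a\<in>keys f. \<Sum>b\<in>keys g. lookup (single (a + b) (lookup f a * lookup g b)) (d + e))"
    by (simp add: sum_product mult_single lookup_sum)
  also have "\<dots> = (\<Sum>a\<in>keys f. \<Sum>b\<in>keys g. if a = d then if b = e then lookup f d * lookup g e else 0 else 0)"
    by (intro sum.cong refl) (use assms in \<open>auto simp: lookup_single when_def\<close>)
  also have "\<dots> = (\<Sum>a\<in>keys f. if a = d then (\<Sum>b\<in>keys g. if b = e then lookup f d * lookup g e else 0) else 0)"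
    by (intro sum.cong refl) auto
  also have "\<dots> = lookup f d * lookup g e"
    by (auto simp: in_keys_iff)
  finally show ?thesis .
qed

text \<open>If \<open>a + b = d + e\<close> and \<open>a\<close> is dominated by \<open>d\<close>, then \<open>b\<close> dominates \<open>e\<close> and equals it by maximality; so
  only one pair of exponents contributes.\<close>

lemma lookup_mult_maximal:
  fixes f g :: "'a::comm_semiring_1 mpol"
  assumes "\<And>a. a \<in> keys f \<Longrightarrow> dominated a d" "\<And>b. b \<in> keys g \<Longrightarrow> dominated e b \<Longrightarrow> b = e"
  shows "lookup (f * g) (d + e) = lookup f d * lookup g e"
proof (rule lookup_mult_unique)
  fix a b assume ab: "a \<in> keys f" "b \<in> keys g" "a + b = d + e"
  then have "dominated e b" using dominated_add_cancel assms(1) by blast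
  then have "b = e" using ab assms(2) by blast
  then show "a = d \<and> b = e" using ab(3) by simp
qed

lemma keys_mult_dominated:
  fixes f g :: "'a::comm_semiring_1 mpol"
  assumes "\<And>a. a \<in> keys f \<Longrightarrow> dominated a d" "\<And>b. b \<in> keys g \<Longrightarrow> dominated b e"
    and "c \<in> keys (f * g)"
  shows "dominated c (d + e)"
  using keys_mult[of f g] assms dominated_add by blast

lemma vandermonde_leading:
  "(\<forall>e\<in>keys (vandermonde n :: 'a::comm_ring_1 mpol). dominated e (delta n)) \<and>
    lookup (vandermonde n :: 'a mpol) (delta n) = 1"
proof -
  have fac: "(\<forall>e\<in>keys (mvar i - mvar j :: 'a mpol). dominated e (single i 1)) \<and>
    lookup (mvar i - mvar j :: 'a mpol) (single i 1) = 1" if "i < j" for i j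
  proof -
    have "dominated (single j 1) (single i 1)"
      using that by (auto simp: dominated_iff part_sum_def lookup_single when_def intro!: sum_le_included[where i = "\<lambda>_. i"])
    moreover have "keys (mvar i - mvar j :: 'a mpol) \<subseteq> {single i 1, single j 1}"
      by (auto simp: in_keys_iff lookup_minus mvar_def lookup_single when_def split: if_splits)
    moreover have "single j (1::nat) \<noteq> single i 1"
    proof
      assume "single j (1::nat) = single i 1"
      then have "lookup (single j (1::nat)) j = lookup (single i 1) j" by simp
      then show False using that by (simp add: lookup_single when_def)
    qed
    ultimately show ?thesis by (auto simp: lookup_minus mvar_def lookup_single when_def)
  qed
  have prod: "(\<forall>e\<in>keys (\<Prod>(i, j)\<in>A. mvar i - mvar j :: 'a mpol). dominated e (\<Sum>(i, j)\<in>A. single i 1)) \<and>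
    lookup (\<Prod>(i, j)\<in>A. mvar i - mvar j :: 'a mpol) (\<Sum>(i, j)\<in>A. single i 1) = 1"
    if "finite A" "\<And>i j. (i, j) \<in> A \<Longrightarrow> i < j" for A :: "(nat \<times> nat) set"
    using that
  proof (induction A rule: finite_induct)
    case empty
    then show ?case by simp
  next
    case (insert p A)
    obtain i j where p: "p = (i, j)" by fastforce
    define F where "F = (\<Prod>(i, j)\<in>A. mvar i - mvar j :: 'a mpol)"
    define s where "s = (\<Sum>(i, j)\<in>A. single i (1::nat))"
    have IH: "\<forall>e\<in>keys F. dominated e s" "lookup F s = 1" using insert unfolding F_def s_def by auto
    have f: "\<forall>e\<in>keys (mvar i - mvar j :: 'a mpol). dominated e (single i 1)"
      "lookup (mvar i - mvar j :: 'a mpol) (single i 1) = 1" using fac[of i j] insert.prems[of i j] p by auto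
    have "dominated e (single i 1 + s)" if "e \<in> keys ((mvar i - mvar j) * F)" for e
      by (rule keys_mult_dominated[OF _ _ that]) (use IH f in auto)
    moreover have "lookup ((mvar i - mvar j) * F) (single i 1 + s) =
        lookup (mvar i - mvar j) (single i 1) * lookup F s"
      by (rule lookup_mult_maximal) (use IH f dominated_antisym in auto)
    then have "lookup ((mvar i - mvar j) * F) (single i 1 + s) = 1" using IH f by simp
    ultimately show ?case using insert.hyps by (simp add: p F_def s_def)
  qed
  let ?A = "{(i, j). i < j \<and> j < n}"
  have "(\<Sum>(i, j)\<in>?A. single i (1::nat)) = delta n"
  proof (rule poly_mapping_eqI)
    fix k
    have "lookup (\<Sum>(i, j)\<in>?A. single i (1::nat)) k = (\<Sum>p\<in>?A. if fst p = k then 1 else 0)"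
      unfolding lookup_sum by (rule sum.cong) (auto simp: lookup_single)
    also have "\<dots> = card {p \<in> ?A. fst p = k}"
      using finite_pairs[of n] by (simp add: sum.If_cases Int_def)
    also have "{p \<in> ?A. fst p = k} = Pair k ` {k<..<n}" by auto
    also have "card \<dots> = card {k<..<n}" by (rule card_image) (auto simp: inj_on_def)
    finally show "lookup (\<Sum>(i, j)\<in>?A. single i (1::nat)) k = lookup (delta n) k"
      by (auto simp: lookup_delta)
  qed
  then show ?thesis using prod[OF finite_pairs, of n] unfolding vandermonde_def by auto
qed

lemma keys_vandermonde: "e \<in> keys (vandermonde n :: 'a::comm_ring_1 mpol) \<Longrightarrow> dominated e (delta n)"
  and lookup_vandermonde: "lookup (vandermonde n :: 'a::comm_ring_1 mpol) (delta n) = 1"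
  using vandermonde_leading by blast+

definition eigenvalue :: "'a::field \<Rightarrow> 'a \<Rightarrow> (nat \<Rightarrow>\<^sub>0 nat) \<Rightarrow> 'a" where
  "eigenvalue q t lam = 1 + (1 - 1 / t) * (\<Sum>i\<in>keys lam. (q ^ lookup lam i - 1) / t ^ i)"

definition below :: "(nat \<Rightarrow>\<^sub>0 nat) \<Rightarrow> (nat \<Rightarrow>\<^sub>0 nat) set" where
  "below lam = {mu. is_partition mu \<and> dominated mu lam \<and> mu \<noteq> lam}"

lemma finite_below: "finite (below lam)"
  unfolding below_def using finite_dominated[of lam "\<lambda>mu. mu \<noteq> lam"] by simp

lemma below_trans: "nu \<in> below mu \<Longrightarrow> mu \<in> below lam \<Longrightarrow> nu \<in> below lam"
  unfolding below_def using dominated_trans dominated_antisym by blast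

lemma keys_monomial_sym_dominated:
  "e \<in> keys (monomial_sym lam n :: 'a::comm_semiring_1 mpol) \<Longrightarrow> is_partition lam \<Longrightarrow> dominated e lam"
  by (auto simp: in_keys_iff lookup_monomial_sym rearranges_dominated split: if_splits)

context qt_params
begin

definition eigenvalue_vars :: "nat \<Rightarrow> (nat \<Rightarrow>\<^sub>0 nat) \<Rightarrow> 'a" where
  "eigenvalue_vars n e = (\<Sum>i<n. t ^ (n - 1 - i) * q ^ lookup e i)"

lemma eigenvalue_vars_eq:
  assumes "keys lam \<subseteq> {..<n}"
  shows "1 / t ^ n + node_coeff n * eigenvalue_vars n lam = eigenvalue q t lam"
proof -
  have geo: "(1 - 1 / t) * (\<Sum>i<n. 1 / t ^ i) = 1 - 1 / t ^ n"
    using t_nonzero by (induction n) (auto simp: field_simps)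
  have "node_coeff n * eigenvalue_vars n lam = (\<Sum>i<n. (1 - 1 / t) * (q ^ lookup lam i / t ^ i))"
    unfolding eigenvalue_vars_def sum_distrib_left
  proof (rule sum.cong[OF refl])
    fix i assume "i \<in> {..<n}"
    then have "t ^ (n - 1) = t ^ (n - 1 - i) * t ^ i" by (simp flip: power_add)
    then show "node_coeff n * (t ^ (n - 1 - i) * q ^ lookup lam i) = (1 - 1 / t) * (q ^ lookup lam i / t ^ i)"
      unfolding node_coeff_def using t_nonzero by (simp add: field_simps)
  qed
  also have "\<dots> = (1 - 1 / t) * (\<Sum>i<n. (q ^ lookup lam i - 1) / t ^ i) + (1 - 1 / t) * (\<Sum>i<n. 1 / t ^ i)"
    unfolding sum_distrib_left sum.distrib[symmetric]
    by (rule sum.cong) (auto simp: diff_divide_distrib right_diff_distrib)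
  also have "(\<Sum>i<n. (q ^ lookup lam i - 1) / t ^ i) = (\<Sum>i\<in>keys lam. (q ^ lookup lam i - 1) / t ^ i)"
    by (rule sum.mono_neutral_right) (use assms in \<open>auto simp: in_keys_iff\<close>)
  finally show ?thesis unfolding geo eigenvalue_def by simp
qed

lemma keys_scale_var: "keys (scale_var c i f) \<subseteq> keys f"
  by (auto simp: in_keys_iff lookup_scale_var)

lemma keys_macop_vars_dominated:
  assumes h: "\<And>e. e \<in> keys h \<Longrightarrow> dominated e mu" and "e \<in> keys (macop_vars n h)"
  shows "dominated e (delta n + mu)"
proof -
  have "(\<Sum>i<n. lookup (scale_var t i (vandermonde n) * scale_var q i h) e) \<noteq> 0"
    using assms(2) by (simp add: macop_vars_def in_keys_iff lookup_sum)
  then obtain i where "e \<in> keys (scale_var t i (vandermonde n) * scale_var q i h)"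
    by (meson in_keys_iff sum.neutral)
  then show ?thesis
    by (rule keys_mult_dominated[rotated 2])
      (use h keys_vandermonde keys_scale_var in blast)+
qed

lemma lookup_macop_vars:
  assumes "\<And>b. b \<in> keys h \<Longrightarrow> dominated e b \<Longrightarrow> b = e"
  shows "lookup (macop_vars n h) (delta n + e) = eigenvalue_vars n e * lookup h e"
    and "lookup (vandermonde n * h) (delta n + e) = lookup h e"
proof -
  show "lookup (vandermonde n * h) (delta n + e) = lookup h e"
    by (subst lookup_mult_maximal) (use assms keys_vandermonde in \<open>auto simp: lookup_vandermonde\<close>)
  have *: "lookup (scale_var t i (vandermonde n) * scale_var q i h) (delta n + e) =
      t ^ lookup (delta n) i * (q ^ lookup e i * lookup h e)" for i
    by (subst lookup_mult_maximal)
      (use assms keys_vandermonde keys_scale_var in \<open>blast | simp add: lookup_scale_var lookup_vandermonde\<close>)+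
  show "lookup (macop_vars n h) (delta n + e) = eigenvalue_vars n e * lookup h e"
    unfolding macop_vars_def lookup_sum eigenvalue_vars_def sum_distrib_right *
    by (rule sum.cong) (simp_all add: lookup_delta)
qed

text \<open>Multiplication by the Vandermonde product shifts maximal exponents by \<open>delta n\<close>. A maximal exponent
  violating the claim would therefore show up in the product, all of whose exponents are dominated by
  \<open>delta n + mu\<close> by \<open>vandermonde_macop\<close>.\<close>

lemma keys_macop_Msym:
  assumes mu: "is_partition mu" and e: "e \<in> keys (in_vars n (macop q t (Msym mu)))"
  shows "dominated e mu"
proof (rule ccontr)
  assume nd: "\<not> dominated e mu"
  define g where "g = in_vars n (macop q t (Msym mu))"
  let ?S = "{e \<in> keys g. \<not> dominated e mu}"
  define k where "k = Max ?S"
  have fin: "finite ?S" by simp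
  have "?S \<noteq> {}" using e nd by (auto simp: g_def)
  then have k: "k \<in> ?S" unfolding k_def by (rule Max_in[OF fin])
  have max: "b = k" if "b \<in> keys g" "dominated k b" for b
  proof -
    have "b \<in> ?S" using that k dominated_trans by blast
    then have "b \<le> k" unfolding k_def by (rule Max_ge[OF fin])
    then show ?thesis using dominated_imp_le[OF that(2)] by simp
  qed
  have "lookup (vandermonde n * g) (delta n + k) \<noteq> 0"
    using lookup_macop_vars(2)[OF max] k by (simp add: in_keys_iff)
  then have "lookup (mconst (1 / t ^ n) * (vandermonde n * monomial_sym mu n)) (delta n + k) +
    lookup (mconst (node_coeff n) * macop_vars n (monomial_sym mu n)) (delta n + k) \<noteq> 0"
    unfolding g_def vandermonde_macop lookup_add in_vars_Msym[OF mu] .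
  then have "delta n + k \<in> keys (vandermonde n * monomial_sym mu n :: 'a mpol) \<or>
    delta n + k \<in> keys (macop_vars n (monomial_sym mu n))"
    by (auto simp: lookup_mconst_mult in_keys_iff)
  then have "dominated (delta n + k) (delta n + mu)"
  proof
    assume "delta n + k \<in> keys (vandermonde n * monomial_sym mu n :: 'a mpol)"
    then show ?thesis
      by (rule keys_mult_dominated[rotated 2])
        (use keys_vandermonde keys_monomial_sym_dominated[OF _ mu] in blast)+
  next
    assume "delta n + k \<in> keys (macop_vars n (monomial_sym mu n))"
    then show ?thesis
      by (rule keys_macop_vars_dominated[rotated]) (rule keys_monomial_sym_dominated[OF _ mu])
  qed
  then show False using k by (simp add: dominated_add_left_iff)
qed

lemma lookup_macop_Msym:
  assumes mu: "is_partition mu" and n: "keys mu \<subseteq> {..<n}"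
  shows "lookup (in_vars n (macop q t (Msym mu))) mu = eigenvalue q t mu"
proof -
  let ?g = "in_vars n (macop q t (Msym mu))"
  have "lookup ?g mu = lookup (vandermonde n * ?g) (delta n + mu)"
    by (rule lookup_macop_vars(2)[symmetric]) (use keys_macop_Msym[OF mu] dominated_antisym in blast)
  also have "\<dots> = 1 / t ^ n + node_coeff n * eigenvalue_vars n mu"
  proof -
    have max: "b = mu" if "b \<in> keys (monomial_sym mu n :: 'a mpol)" "dominated mu b" for b
      using keys_monomial_sym_dominated[OF that(1) mu] that(2) dominated_antisym by blast
    have l: "lookup (vandermonde n * monomial_sym mu n) (delta n + mu) = lookup (monomial_sym mu n :: 'a mpol) mu"
      "lookup (macop_vars n (monomial_sym mu n)) (delta n + mu) = eigenvalue_vars n mu * lookup (monomial_sym mu n) mu"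
      by (rule lookup_macop_vars, use max in blast)+
    show ?thesis
      unfolding vandermonde_macop lookup_add lookup_mconst_mult in_vars_Msym[OF mu] l
      by (simp add: lookup_monomial_sym n)
  qed
  finally show ?thesis using eigenvalue_vars_eq[OF n] by simp
qed

lemma macop_Msym_triangular:
  assumes mu: "is_partition mu"
  shows "macop q t (Msym mu) - mconst (eigenvalue q t mu) * Msym mu \<in> lspan Msym (below mu)"
proof -
  let ?f = "macop q t (Msym mu) - mconst (eigenvalue q t mu) * Msym mu"
  have "?f \<in> lspan Msym {nu. is_partition nu \<and> nu \<in> {nu. dominated nu mu \<and> nu \<noteq> mu}}"
  proof (rule in_lspan_Msym)
    fix n e assume e: "is_partition e" "e \<in> keys (in_vars n ?f)"
    have k: "keys e \<subseteq> {..<n}" using keys_in_vars[OF e(2)] .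
    have l: "lookup (in_vars n ?f) e = lookup (in_vars n (macop q t (Msym mu))) e -
      eigenvalue q t mu * lookup (monomial_sym mu n) e"
      by (simp add: in_vars_diff in_vars_mult in_vars_mconst lookup_minus lookup_mconst_mult in_vars_Msym mu)
    have "e \<noteq> mu" using e k l lookup_macop_Msym[OF mu] by (auto simp: in_keys_iff lookup_monomial_sym)
    moreover have "dominated e mu"
    proof (cases "lookup (monomial_sym mu n :: 'a mpol) e = 0")
      case True
      then show ?thesis using e l keys_macop_Msym[OF mu, of e n] by (auto simp: in_keys_iff)
    next
      case False
      then show ?thesis using keys_monomial_sym_dominated[OF _ mu] by (auto simp: in_keys_iff)
    qed
    ultimately show "e \<in> {nu. dominated nu mu \<and> nu \<noteq> mu}" by simp
  qed
  then show ?thesis by (simp add: below_def)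
qed

end

section \<open>Existence and uniqueness of the Macdonald polynomials\<close>

lemma lspan_insert:
  assumes "f \<in> lspan b (insert k S)"
  shows "\<exists>c. f - mconst c * b k \<in> lspan b S"
proof -
  obtain T u where T: "finite T" "T \<subseteq> insert k S" "f = (\<Sum>i\<in>T. mconst (u i) * b i)"
    using assms unfolding lspan_def by blast
  show ?thesis
  proof (cases "k \<in> T")
    case True
    then have "f = mconst (u k) * b k + (\<Sum>i\<in>T - {k}. mconst (u i) * b i)"
      unfolding T(3) by (intro sum.remove T(1))
    then have "f - mconst (u k) * b k = (\<Sum>i\<in>T - {k}. mconst (u i) * b i)" by simp
    also have "\<dots> \<in> lspan b S" using T by (intro lspanI) auto
    finally show ?thesis ..
  next
    case False
    then have "f \<in> lspan b S" unfolding T(3) using T by (intro lspanI) auto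
    then show ?thesis by (intro exI[of _ 0]) simp
  qed
qed

text \<open>The genericity of \<open>q\<close> and \<open>t\<close> that is used: the eigenvalues separate all partitions, of whatever
  size, and no nonzero symmetric function is isotropic.\<close>

locale macdonald_setting = qt_params +
  assumes eigenvalue_inj: "\<And>lam mu. is_partition lam \<Longrightarrow> is_partition mu \<Longrightarrow>
      eigenvalue q t lam = eigenvalue q t mu \<Longrightarrow> lam = mu"
    and anisotropic: "\<And>f. qt_form q t f f = 0 \<Longrightarrow> f = 0"
begin

text \<open>Back substitution: the largest element of \<open>S\<close> for the lexicographic order lies below no other one, so its
  coefficient can be matched first.\<close>

lemma solve_eigenvalue_equation:
  assumes "finite S" "\<And>mu. mu \<in> S \<Longrightarrow> is_partition mu \<and> below mu \<subseteq> S"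
    and "\<And>mu. mu \<in> S \<Longrightarrow> eigenvalue q t mu \<noteq> E" "w \<in> lspan Msym S"
  shows "\<exists>v\<in>lspan Msym S. macop q t v - mconst E * v = w"
  using assms
proof (induction "card S" arbitrary: S w)
  case 0
  then have "w = 0" by (auto simp: lspan_def)
  then show ?case by (intro bexI[of _ 0]) (auto simp: lspan_0)
next
  case (Suc n)
  let ?ev = "eigenvalue q t"
  have ne: "S \<noteq> {}" using Suc.hyps(2) by auto
  define k where "k = Max S"
  have k: "k \<in> S" unfolding k_def using Suc.prems(1) ne by (rule Max_in)
  let ?S = "S - {k}"
  have down: "below mu \<subseteq> ?S" if mu: "mu \<in> S" for mu
  proof -
    have "k \<notin> below mu"
    proof
      assume "k \<in> below mu"
      then have "k \<le> mu" "k \<noteq> mu" by (auto simp: below_def dominated_imp_le)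
      moreover have "mu \<le> k" unfolding k_def using Suc.prems(1) mu by (rule Max_ge)
      ultimately show False by simp
    qed
    then show ?thesis using Suc.prems(2)[OF mu] by blast
  qed
  have nz: "?ev k - E \<noteq> 0" using Suc.prems(3)[OF k] by simp
  obtain c where c: "w - mconst c * Msym k \<in> lspan Msym ?S"
    using lspan_insert[of w Msym k ?S] Suc.prems(4) k by (auto simp: insert_absorb)
  \<comment> \<open>the coefficient of \<open>m_k\<close> in the solution\<close>
  define d where "d = c / (?ev k - E)"
  define r where "r = macop q t (Msym k) - mconst (?ev k) * Msym k"
  have r: "r \<in> lspan Msym ?S"
    using macop_Msym_triangular[of k] Suc.prems(2)[OF k] lspan_mono[OF down[OF k]] unfolding r_def by blast
  have "\<exists>v\<in>lspan Msym ?S. macop q t v - mconst E * v = (w - mconst c * Msym k) - mconst d * r"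
  proof (rule Suc.hyps(1))
    show "n = card ?S" using Suc.hyps(2) k Suc.prems(1) by simp
    show "(w - mconst c * Msym k) - mconst d * r \<in> lspan Msym ?S"
      by (intro lspan_diff c lspan_scale r)
  qed (use Suc.prems down in auto)
  then obtain v where v: "v \<in> lspan Msym ?S"
    "macop q t v - mconst E * v = (w - mconst c * Msym k) - mconst d * r" by blast
  have "macop q t (mconst d * Msym k + v) - mconst E * (mconst d * Msym k + v) =
    mconst d * (r + mconst (?ev k - E) * Msym k) + (macop q t v - mconst E * v)"
    by (simp add: macop_add macop_scale r_def mconst_diff algebra_simps)
  also have "\<dots> = mconst (d * (?ev k - E)) * Msym k + (w - mconst c * Msym k)"
    unfolding v(2) by (simp only: mconst_mult) (simp add: algebra_simps)
  also have "\<dots> = w" using nz by (simp add: d_def)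
  finally have "macop q t (mconst d * Msym k + v) - mconst E * (mconst d * Msym k + v) = w" .
  moreover have "mconst d * Msym k + v \<in> lspan Msym S"
    using k v(1) lspan_mono[of ?S S] by (intro lspan_add lspan_scale lspan_base) auto
  ultimately show ?case by blast
qed

lemma ex_macdonald_eigenfunction:
  assumes lam: "is_partition lam"
  shows "\<exists>P. P - Msym lam \<in> lspan Msym (below lam) \<and> macop q t P = mconst (eigenvalue q t lam) * P"
proof -
  let ?E = "eigenvalue q t lam"
  let ?r = "macop q t (Msym lam) - mconst ?E * Msym lam"
  have "\<exists>v\<in>lspan Msym (below lam). macop q t v - mconst ?E * v = - ?r"
  proof (rule solve_eigenvalue_equation[OF finite_below])
    show "is_partition mu \<and> below mu \<subseteq> below lam" if "mu \<in> below lam" for mu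
      using that below_trans[of _ mu lam] by (auto simp: below_def)
    show "eigenvalue q t mu \<noteq> ?E" if "mu \<in> below lam" for mu
      using that eigenvalue_inj[OF _ lam] by (auto simp: below_def)
    show "- ?r \<in> lspan Msym (below lam)" by (intro lspan_uminus macop_Msym_triangular lam)
  qed
  then obtain v where v: "v \<in> lspan Msym (below lam)" "macop q t v - mconst ?E * v = - ?r" by blast
  then have "macop q t (Msym lam + v) = mconst ?E * (Msym lam + v)"
    by (simp add: macop_add algebra_simps)
  then show ?thesis using v(1) by (intro exI[of _ "Msym lam + v"]) simp
qed

definition mac :: "(nat \<Rightarrow>\<^sub>0 nat) \<Rightarrow> 'a mpol" where
  "mac lam = (SOME P. P - Msym lam \<in> lspan Msym (below lam) \<and> macop q t P = mconst (eigenvalue q t lam) * P)"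

lemma mac_triangular: "is_partition lam \<Longrightarrow> mac lam - Msym lam \<in> lspan Msym (below lam)"
  and macop_mac: "is_partition lam \<Longrightarrow> macop q t (mac lam) = mconst (eigenvalue q t lam) * mac lam"
  using someI_ex[OF ex_macdonald_eigenfunction] unfolding mac_def by blast+

lemma mac_orthogonal:
  assumes "is_partition lam" "is_partition mu" "lam \<noteq> mu"
  shows "qt_form q t (mac lam) (mac mu) = 0"
proof -
  have "eigenvalue q t lam * qt_form q t (mac lam) (mac mu) = eigenvalue q t mu * qt_form q t (mac lam) (mac mu)"
    using macop_selfadjoint[of "mac lam" "mac mu"] assms
    by (simp add: macop_mac qt_form_scale_left qt_form_scale_right)
  then show ?thesis using eigenvalue_inj assms by auto
qed

text \<open>By triangularity each \<open>m_mu\<close> below \<open>lam\<close> is \<open>p mu\<close> up to monomial functions further below.\<close>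

lemma orthogonal_to_below:
  assumes tri: "\<And>lam. is_partition lam \<Longrightarrow> p lam - Msym lam \<in> lspan Msym (below lam)"
    and orth: "\<And>lam mu. is_partition lam \<Longrightarrow> is_partition mu \<Longrightarrow> lam \<noteq> mu \<Longrightarrow> qt_form q t (p lam) (p mu) = 0"
    and lam: "is_partition lam" and f: "f \<in> lspan Msym (below lam)"
  shows "qt_form q t (p lam) f = 0"
proof -
  have base: "qt_form q t (p lam) (Msym mu) = 0" if "mu \<in> below lam" for mu
    using that
  proof (induction "card (below mu)" arbitrary: mu rule: less_induct)
    case less
    have mu: "is_partition mu" "mu \<noteq> lam" using less.prems by (auto simp: below_def)
    obtain T u where T: "finite T" "T \<subseteq> below mu" "p mu - Msym mu = (\<Sum>i\<in>T. mconst (u i) * Msym i)"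
      using tri[OF mu(1)] unfolding lspan_def by blast
    have "qt_form q t (p lam) (Msym nu) = 0" if nu: "nu \<in> T" for nu
    proof (rule less.hyps)
      have nu': "nu \<in> below mu" using nu T by auto
      show "nu \<in> below lam" by (rule below_trans[OF nu' less.prems])
      have "below nu \<subseteq> below mu" using below_trans nu' by blast
      moreover have "nu \<notin> below nu" by (simp add: below_def)
      ultimately show "card (below nu) < card (below mu)"
        using nu' by (intro psubset_card_mono finite_below) auto
    qed
    then have "qt_form q t (p lam) (p mu - Msym mu) = 0"
      unfolding T(3) by (simp add: qt_form_sum_right qt_form_scale_right)
    moreover have "qt_form q t (p lam) (p mu) = qt_form q t (p lam) (p mu - Msym mu) + qt_form q t (p lam) (Msym mu)"
      by (simp flip: qt_form_add_right)
    ultimately show ?case using orth[OF lam mu(1)] mu(2) by simp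
  qed
  obtain T u where T: "finite T" "T \<subseteq> below lam" "f = (\<Sum>i\<in>T. mconst (u i) * Msym i)"
    using f unfolding lspan_def by blast
  show ?thesis unfolding T(3) qt_form_sum_right qt_form_scale_right
    by (rule sum.neutral) (use base T in auto)
qed

text \<open>The difference of two candidates lies in the span below \<open>lam\<close>, to which both are orthogonal. So it is
  isotropic.\<close>

lemma macdonald_family_unique:
  assumes tri: "\<And>lam. is_partition lam \<Longrightarrow> p lam - Msym lam \<in> lspan Msym (below lam)"
    and orth: "\<And>lam mu. is_partition lam \<Longrightarrow> is_partition mu \<Longrightarrow> lam \<noteq> mu \<Longrightarrow> qt_form q t (p lam) (p mu) = 0"
    and lam: "is_partition lam"
  shows "p lam = mac lam"
proof -
  have "(p lam - Msym lam) - (mac lam - Msym lam) \<in> lspan Msym (below lam)"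
    by (intro lspan_diff tri mac_triangular lam)
  then have h: "p lam - mac lam \<in> lspan Msym (below lam)" by simp
  have "qt_form q t (p lam - mac lam) (p lam - mac lam) = 0"
    unfolding qt_form_diff_left
    using orthogonal_to_below[OF tri orth lam h] orthogonal_to_below[OF mac_triangular mac_orthogonal lam h]
    by simp
  then show ?thesis using anisotropic by fastforce
qed

lemma mac_expansion:
  assumes "is_partition lam"
  shows "\<exists>u. mac lam = Msym lam + (\<Sum>mu\<in>below lam. mconst (u mu) * Msym mu)"
proof -
  obtain T u where T: "finite T" "T \<subseteq> below lam" "mac lam - Msym lam = (\<Sum>i\<in>T. mconst (u i) * Msym i)"
    using mac_triangular[OF assms] unfolding lspan_def by blast
  have "(\<Sum>i\<in>T. mconst (u i) * Msym i) = (\<Sum>mu\<in>below lam. mconst (if mu \<in> T then u mu else 0) * Msym mu)"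
    by (rule sum.mono_neutral_cong_left) (use T finite_below in auto)
  then have "mac lam - Msym lam = (\<Sum>mu\<in>below lam. mconst (if mu \<in> T then u mu else 0) * Msym mu)"
    by (rule trans[OF T(3)])
  then have "mac lam = Msym lam + (\<Sum>mu\<in>below lam. mconst (if mu \<in> T then u mu else 0) * Msym mu)"
    by (simp only: diff_eq_eq add.commute)
  then show ?thesis by (rule exI[where x = "\<lambda>mu. if mu \<in> T then u mu else 0"])
qed

lemma in_vars_expansion:
  assumes "is_partition lam"
  shows "in_vars n (Msym lam + (\<Sum>mu\<in>below lam. mconst (u mu) * Msym mu)) =
    monomial_sym lam n + (\<Sum>mu\<in>{mu. is_partition mu \<and> dominated mu lam \<and> mu \<noteq> lam}. mconst (u mu) * monomial_sym mu n)"
  unfolding below_def[symmetric] in_vars_add in_vars_sum in_vars_Msym[OF assms]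
  by (intro arg_cong2[where f = "(+)"] refl sum.cong)
    (simp add: in_vars_Msym in_vars_mult in_vars_mconst below_def)

lemma macdonald_eq_mac:
  assumes lam: "is_partition lam"
  shows "macdonald q t lam = (\<lambda>n. in_vars n (mac lam))"
  unfolding macdonald_def
proof (rule the_equality)
  have "is_macdonald_family q t (\<lambda>lam n. in_vars n (mac lam))"
    unfolding is_macdonald_family_def
  proof (intro conjI allI impI)
    fix lam assume lam: "is_partition lam"
    obtain u where u: "mac lam = Msym lam + (\<Sum>mu\<in>below lam. mconst (u mu) * Msym mu)"
      using mac_expansion[OF lam] by blast
    show "\<exists>u. \<forall>n. in_vars n (mac lam) = monomial_sym lam n +
      (\<Sum>mu | is_partition mu \<and> dominated mu lam \<and> mu \<noteq> lam. mconst (u mu) * monomial_sym mu n)"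
      unfolding u using in_vars_expansion[OF lam] by blast
  qed (simp add: qt_scalar_in_vars mac_orthogonal)
  then show "\<exists>P. is_macdonald_family q t P \<and> (\<lambda>n. in_vars n (mac lam)) = P lam" by blast
next
  fix f assume "\<exists>P. is_macdonald_family q t P \<and> f = P lam"
  then obtain P where P: "is_macdonald_family q t P" "f = P lam" by blast
  have "\<forall>lam. \<exists>u. is_partition lam \<longrightarrow> (\<forall>n. P lam n = monomial_sym lam n +
      (\<Sum>mu | is_partition mu \<and> dominated mu lam \<and> mu \<noteq> lam. mconst (u mu) * monomial_sym mu n))"
    using P(1) unfolding is_macdonald_family_def by blast
  from choice[OF this] obtain u where u: "\<forall>lam. is_partition lam \<longrightarrow> (\<forall>n. P lam n = monomial_sym lam n +
      (\<Sum>mu | is_partition mu \<and> dominated mu lam \<and> mu \<noteq> lam. mconst (u lam mu) * monomial_sym mu n))"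
    by blast
  define p where "p = (\<lambda>lam. Msym lam + (\<Sum>mu\<in>below lam. mconst (u lam mu) * Msym mu))"
  have Pp: "P lam = (\<lambda>n. in_vars n (p lam))" if "is_partition lam" for lam
    by (rule ext) (simp only: p_def in_vars_expansion[OF that] u[rule_format, OF that])
  have "p lam = mac lam"
  proof (rule macdonald_family_unique[OF _ _ lam])
    show "p lam - Msym lam \<in> lspan Msym (below lam)" for lam
      unfolding p_def using lspanI[OF finite_below order_refl] by simp
    fix lam mu assume lm: "is_partition lam" "is_partition mu" "lam \<noteq> mu"
    then have "qt_scalar q t (P lam) (P mu) = 0"
      using P(1) unfolding is_macdonald_family_def by blast
    then show "qt_form q t (p lam) (p mu) = 0"
      by (simp only: Pp[OF lm(1)] Pp[OF lm(2)] qt_scalar_in_vars)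
  qed
  then show "f = (\<lambda>n. in_vars n (mac lam))" using P(2) Pp[OF lam] by simp
qed

end

section \<open>Restriction of Macdonald polynomials and removal of columns\<close>

definition column :: "nat \<Rightarrow> (nat \<Rightarrow>\<^sub>0 nat)" where
  "column n = (\<Sum>i<n. single i 1)"

lemma lookup_column: "lookup (column n) i = (if i < n then 1 else 0)"
  unfolding column_def by (rule lookup_sum_single)

lemma keys_column: "keys (column n) = {..<n}"
  by (auto simp: in_keys_iff lookup_column split: if_splits)

lemma is_partition_column: "is_partition (column n)"
  by (auto simp: is_partition_def antimono_def lookup_column)

lemma is_partition_add: "is_partition d \<Longrightarrow> is_partition e \<Longrightarrow> is_partition (d + e)"
  by (auto simp: is_partition_def antimono_def lookup_add intro: add_mono)

lemma keys_add_column: "keys e \<subseteq> {..<n} \<Longrightarrow> keys (e + column n) = {..<n}"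
  using keys_add[of e "column n"] keys_column[of n] by (auto simp: in_keys_iff lookup_add lookup_column)

lemma psize_column: "psize (column n) = n"
  using psize_eq_part_sum[of "column n" n] by (simp add: keys_column part_sum_def lookup_column)

lemma partition_minus_column:
  assumes "is_partition lam" "keys lam = {..<n}"
  obtains lam' where "is_partition lam'" "keys lam' \<subseteq> {..<n}" "lam = lam' + column n"
proof
  have nz: "lookup lam i \<noteq> 0 \<longleftrightarrow> i < n" for i using assms(2) in_keys_iff[of i lam] by auto
  show "lam = (lam - column n) + column n"
  proof (rule poly_mapping_eqI)
    fix i show "lookup lam i = lookup ((lam - column n) + column n) i"
      using nz[of i] by (simp add: lookup_add lookup_minus lookup_column)
  qed
  show "keys (lam - column n) \<subseteq> {..<n}"
  proof
    fix i assume "i \<in> keys (lam - column n)"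
    then show "i \<in> {..<n}" using nz[of i] by (simp add: in_keys_iff lookup_minus)
  qed
  have "lookup (lam - column n) j \<le> lookup (lam - column n) i" if "i \<le> j" for i j
    using is_partition_le[OF assms(1) that] nz[of i] nz[of j] that
    by (auto simp: lookup_minus lookup_column)
  then show "is_partition (lam - column n)" by (simp add: is_partition_def antimono_def)
qed

lemma dominated_keys:
  assumes "dominated mu lam" "keys mu \<subseteq> {..<n}"
  shows "keys lam \<subseteq> {..<n}"
proof
  fix i assume i: "i \<in> keys lam"
  show "i \<in> {..<n}"
  proof (rule ccontr)
    assume "i \<notin> {..<n}"
    then have "part_sum n lam + lookup lam i \<le> part_sum (Suc i) lam"
      unfolding part_sum_def by (simp add: sum_mono2)
    also have "part_sum (Suc i) lam \<le> psize lam"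
    proof -
      have "part_sum (Suc i) lam = (\<Sum>j\<in>{..<Suc i} \<inter> keys lam. lookup lam j)"
        unfolding part_sum_def by (rule sum.mono_neutral_right) (auto simp: in_keys_iff)
      also have "\<dots> \<le> psize lam" unfolding psize_def by (rule sum_mono2) auto
      finally show ?thesis .
    qed
    also have "psize lam = part_sum n mu" using assms psize_eq_part_sum[OF assms(2)] by (simp add: dominated_iff)
    also have "\<dots> \<le> part_sum n lam" using assms(1) by (simp add: dominated_iff)
    finally show False using i by (simp add: in_keys_iff)
  qed
qed

lemma in_vars_Msym_column: "in_vars n (Msym (column n)) = (single (column n) 1 :: 'a::field_char_0 mpol)"
proof (rule poly_mapping_eqI)
  fix e
  have "keys e \<subseteq> {..<n} \<and> rearranges e (column n) \<longleftrightarrow> e = column n"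
  proof
    assume e: "keys e \<subseteq> {..<n} \<and> rearranges e (column n)"
    then obtain \<pi> where p: "bij \<pi>" "lookup e = lookup (column n) \<circ> \<pi>" by (auto simp: rearranges_def)
    have "card (keys e) = n" using rearranges_card_keys[of e "column n"] e by (simp add: keys_column)
    then have k: "keys e = {..<n}" using e by (intro card_subset_eq) auto
    show "e = column n"
    proof (rule poly_mapping_eqI)
      fix i
      have "lookup e i \<noteq> 0 \<longleftrightarrow> i < n" using k in_keys_iff[of i e] by auto
      then show "lookup e i = lookup (column n) i" by (auto simp: p(2) lookup_column split: if_splits)
    qed
  qed (simp add: keys_column)
  then show "lookup (in_vars n (Msym (column n))) e = lookup (single (column n) 1 :: 'a mpol) e"
    by (auto simp: in_vars_Msym is_partition_column lookup_monomial_sym lookup_single when_def)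
qed

lemma eigenvalue_0 [simp]: "eigenvalue q t 0 = 1"
  by (simp add: eigenvalue_def)

context macdonald_setting
begin

lemma t_ne_1: "t \<noteq> 1"
  using t_power[of 0] by simp

lemma keys_mac_dominated:
  assumes lam: "is_partition lam" and e: "e \<in> keys (in_vars n (mac lam))"
  shows "dominated e lam"
proof -
  obtain u where u: "mac lam = Msym lam + (\<Sum>mu\<in>below lam. mconst (u mu) * Msym mu)"
    using mac_expansion[OF lam] by blast
  have l: "lookup (in_vars n (mac lam)) e = lookup (monomial_sym lam n) e +
    (\<Sum>mu\<in>below lam. u mu * lookup (monomial_sym mu n) e)"
    unfolding u in_vars_expansion[OF lam, folded below_def] lookup_add lookup_sum lookup_mconst_mult ..
  show ?thesis
  proof (cases "lookup (monomial_sym lam n :: 'a mpol) e = 0")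
    case True
    then have "(\<Sum>mu\<in>below lam. u mu * lookup (monomial_sym mu n) e) \<noteq> 0"
      using e l by (simp add: in_keys_iff)
    then obtain mu where mu: "mu \<in> below lam" "e \<in> keys (monomial_sym mu n :: 'a mpol)"
      by (metis (no_types, lifting) in_keys_iff mult_zero_right sum.neutral)
    then show ?thesis
      using keys_monomial_sym_dominated[OF mu(2)] dominated_trans by (auto simp: below_def)
  next
    case False
    then show ?thesis using keys_monomial_sym_dominated[OF _ lam] by (auto simp: in_keys_iff)
  qed
qed

lemma lookup_mac_self:
  assumes lam: "is_partition lam" and k: "keys lam \<subseteq> {..<n}"
  shows "lookup (in_vars n (mac lam)) lam = 1"
proof -
  obtain u where u: "mac lam = Msym lam + (\<Sum>mu\<in>below lam. mconst (u mu) * Msym mu)"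
    using mac_expansion[OF lam] by blast
  have "(\<Sum>mu\<in>below lam. u mu * lookup (monomial_sym mu n) lam) = 0"
    by (rule sum.neutral) (auto simp: lookup_monomial_sym_partition lam k below_def)
  then show ?thesis
    unfolding u in_vars_expansion[OF lam, folded below_def] lookup_add lookup_sum lookup_mconst_mult
    by (simp add: lookup_monomial_sym_partition lam k)
qed

lemma in_vars_mac_eq_0:
  assumes lam: "is_partition lam" and k: "\<not> keys lam \<subseteq> {..<n}"
  shows "in_vars n (mac lam) = 0"
proof (rule ccontr)
  assume "in_vars n (mac lam) \<noteq> 0"
  then obtain e where e: "e \<in> keys (in_vars n (mac lam))" by (metis all_not_in_conv keys_eq_empty)
  show False
    using dominated_keys[OF keys_mac_dominated[OF lam e] keys_in_vars[OF e]] k by simp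
qed

lemma mac_0: "mac 0 = 1"
proof -
  have "mu = 0" if "is_partition mu" "psize mu = 0" for mu
    using lookup_le_psize[of mu] that by (intro poly_mapping_eqI) simp
  then have "below 0 = {}" by (auto simp: below_def dominated_iff)
  then show ?thesis using mac_expansion[OF is_partition_0] by (simp add: Msym_0)
qed

lemma node_coeff_nonzero: "node_coeff n \<noteq> 0"
  using t_ne_1 t_nonzero by (simp add: node_coeff_def)

lemma eigenvalue_vars_inj:
  assumes "is_partition lam" "is_partition mu" "keys lam \<subseteq> {..<n}" "keys mu \<subseteq> {..<n}"
    "eigenvalue_vars n lam = eigenvalue_vars n mu"
  shows "lam = mu"
  using eigenvalue_inj[OF assms(1,2)] eigenvalue_vars_eq[OF assms(3)] eigenvalue_vars_eq[OF assms(4)] assms(5)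
  by simp

lemma macop_vars_mac:
  assumes lam: "is_partition lam" and k: "keys lam \<subseteq> {..<n}"
  shows "macop_vars n (in_vars n (mac lam)) =
    mconst (eigenvalue_vars n lam) * (vandermonde n * in_vars n (mac lam))"
proof -
  let ?h = "in_vars n (mac lam)" and ?a = "vandermonde n :: 'a mpol"
  have "?a * in_vars n (macop q t (mac lam)) = mconst (eigenvalue q t lam) * (?a * ?h)"
    by (simp add: macop_mac lam in_vars_mult in_vars_mconst mult_ac)
  then have "mconst (node_coeff n) * macop_vars n ?h =
      mconst (eigenvalue q t lam) * (?a * ?h) - mconst (1 / t ^ n) * (?a * ?h)"
    unfolding vandermonde_macop by (simp only: eq_diff_eq add.commute)
  also have "\<dots> = mconst (node_coeff n) * (mconst (eigenvalue_vars n lam) * (?a * ?h))"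
    unfolding eigenvalue_vars_eq[OF k, symmetric] by (simp only: mconst_add mconst_mult) (simp add: algebra_simps)
  finally have "mconst (1 / node_coeff n) * (mconst (node_coeff n) * macop_vars n ?h) =
    mconst (1 / node_coeff n) * (mconst (node_coeff n) * (mconst (eigenvalue_vars n lam) * (?a * ?h)))" by simp
  then show ?thesis
    using node_coeff_nonzero unfolding mult.assoc[symmetric] mconst_mult[symmetric] by simp
qed

text \<open>The lexicographically largest exponent of a nonzero eigenfunction is a partition, and its coefficient
  shows that the eigenvalue belongs to this partition.\<close>

lemma macop_vars_eigenfunction_unique:
  assumes lam: "is_partition lam" "keys lam \<subseteq> {..<n}"
    and eig: "macop_vars n (in_vars n f) = mconst (eigenvalue_vars n lam) * (vandermonde n * in_vars n f)"
    and coeff: "lookup (in_vars n f) lam = 0"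
  shows "in_vars n f = 0"
proof (rule ccontr)
  assume nz: "in_vars n f \<noteq> 0"
  define k where "k = Max (keys (in_vars n f))"
  have kp: "is_partition k" "keys k \<subseteq> {..<n}" unfolding k_def by (rule Max_keys_in_vars[OF nz])+
  have kk: "k \<in> keys (in_vars n f)" unfolding k_def using nz by (intro Max_in) auto
  have max: "b = k" if "b \<in> keys (in_vars n f)" "dominated k b" for b
    using Max_ge[OF finite_keys that(1)] dominated_imp_le[OF that(2)] by (simp add: k_def)
  have "eigenvalue_vars n k * lookup (in_vars n f) k = eigenvalue_vars n lam * lookup (in_vars n f) k"
    using arg_cong[OF eig, of "\<lambda>g. lookup g (delta n + k)"]
    by (simp add: lookup_mconst_mult lookup_macop_vars max)
  then have "eigenvalue_vars n k = eigenvalue_vars n lam" using kk by (simp add: in_keys_iff)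
  then have "k = lam" by (rule eigenvalue_vars_inj[OF kp(1) lam(1) kp(2) lam(2)])
  then show False using kk coeff by (simp add: in_keys_iff)
qed

lemma scale_var_column:
  assumes "i < n" shows "scale_var c i (single (column n) 1 * g) = mconst c * (single (column n) 1 * scale_var c i g)"
proof -
  have "scale_var c i (single (column n) 1) = mconst c * single (column n) 1"
    by (rule poly_mapping_eqI)
      (use assms in \<open>auto simp: lookup_scale_var lookup_mconst_mult lookup_single when_def lookup_column\<close>)
  then show ?thesis by (simp add: semiring_hom_mult[OF semiring_hom_scale_var] mult.assoc)
qed

text \<open>Multiplication by \<open>x_0 \<cdots> x_(n-1)\<close> commutes with each rescaling of a variable up to the factor \<open>q\<close>, so both
  sides are eigenfunctions for the same eigenvalue. They agree in the coefficient of the leading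
  exponent.\<close>

lemma in_vars_mac_add_column:
  assumes lam: "is_partition lam" "keys lam \<subseteq> {..<n}"
  shows "in_vars n (mac (lam + column n)) = single (column n) 1 * in_vars n (mac lam)"
proof -
  let ?e = "single (column n) 1 :: 'a mpol" and ?g = "in_vars n (mac lam)" and ?lam = "lam + column n"
  have lc: "is_partition ?lam" "keys ?lam \<subseteq> {..<n}"
    using is_partition_add[OF lam(1) is_partition_column] keys_add_column[OF lam(2)] by auto
  \<comment> \<open>The factor \<open>x_0 \<cdots> x_(n-1)\<close> is itself a restricted symmetric function.\<close>
  define f where "f = mac ?lam - Msym (column n) * mac lam"
  have f: "in_vars n f = in_vars n (mac ?lam) - ?e * ?g"
    by (simp add: f_def in_vars_diff in_vars_mult in_vars_Msym_column)
  have ev: "eigenvalue_vars n ?lam = q * eigenvalue_vars n lam"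
    unfolding eigenvalue_vars_def sum_distrib_left
    by (rule sum.cong) (auto simp: lookup_add lookup_column)
  have "macop_vars n (?e * ?g) = mconst q * (?e * macop_vars n ?g)"
    unfolding macop_vars_def sum_distrib_left
    by (rule sum.cong) (auto simp: scale_var_column mult_ac)
  also have "\<dots> = mconst (eigenvalue_vars n ?lam) * (vandermonde n * (?e * ?g))"
    unfolding macop_vars_mac[OF lam] ev by (simp add: mconst_mult mult_ac)
  finally have eg: "macop_vars n (?e * ?g) = mconst (eigenvalue_vars n ?lam) * (vandermonde n * (?e * ?g))" .
  have "in_vars n f = 0"
  proof (rule macop_vars_eigenfunction_unique[OF lc])
    have "macop_vars n (in_vars n f) = macop_vars n (in_vars n (mac ?lam)) - macop_vars n (?e * ?g)"
      unfolding f macop_vars_def semiring_hom_diff[OF semiring_hom_scale_var] right_diff_distrib sum_subtractf ..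
    then show "macop_vars n (in_vars n f) = mconst (eigenvalue_vars n ?lam) * (vandermonde n * in_vars n f)"
      unfolding macop_vars_mac[OF lc] eg f by (simp add: right_diff_distrib)
    have "lookup (?e * ?g) ?lam = lookup ?g lam"
      using lookup_single_mult_add[of "column n" 1 ?g lam] by (simp add: add.commute)
    then show "lookup (in_vars n f) ?lam = 0"
      unfolding f lookup_minus by (simp add: lookup_mac_self lam lc)
  qed
  then show ?thesis using f by simp
qed

section \<open>Coordinates in the Macdonald basis\<close>

definition mac_coeff :: "(nat \<Rightarrow>\<^sub>0 nat) \<Rightarrow> 'a mpol \<Rightarrow> 'a" where
  "mac_coeff lam f = qt_form q t f (mac lam) / qt_form q t (mac lam) (mac lam)"

lemma mac_nonzero: "is_partition lam \<Longrightarrow> mac lam \<noteq> 0"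
  using lookup_mac_self[of lam "psize lam"] partition_keys_subset[of lam "psize lam"]
  by (auto simp: in_vars_0)

lemma mac_norm_nonzero: "is_partition lam \<Longrightarrow> qt_form q t (mac lam) (mac lam) \<noteq> 0"
  using anisotropic mac_nonzero by blast

lemma mac_coeff_0 [simp]: "mac_coeff lam 0 = 0"
  by (simp add: mac_coeff_def)

lemma mac_coeff_scale: "mac_coeff lam (mconst c * f) = c * mac_coeff lam f"
  by (simp add: mac_coeff_def qt_form_scale_left)

lemma mac_coeff_sum: "mac_coeff lam (sum f A) = (\<Sum>x\<in>A. mac_coeff lam (f x))"
  by (simp add: mac_coeff_def qt_form_sum_left sum_divide_distrib)

lemma mac_coeff_diff: "mac_coeff lam (f - g) = mac_coeff lam f - mac_coeff lam g"
  by (simp add: mac_coeff_def qt_form_diff_left diff_divide_distrib)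

lemma mac_coeff_mac:
  "is_partition lam \<Longrightarrow> is_partition mu \<Longrightarrow> mac_coeff lam (mac mu) = (if lam = mu then 1 else 0)"
  by (auto simp: mac_coeff_def mac_orthogonal mac_norm_nonzero)

lemma Msym_in_lspan_mac: "is_partition mu \<Longrightarrow> Msym mu \<in> lspan mac (Collect is_partition)"
proof (induction "card (below mu)" arbitrary: mu rule: less_induct)
  case less
  obtain u where u: "mac mu = Msym mu + (\<Sum>nu\<in>below mu. mconst (u nu) * Msym nu)"
    using mac_expansion[OF less.prems] by blast
  have "Msym nu \<in> lspan mac (Collect is_partition)" if nu: "nu \<in> below mu" for nu
  proof (rule less.hyps)
    have "below nu \<subseteq> below mu" using below_trans nu by blast
    moreover have "nu \<notin> below nu" by (simp add: below_def)
    ultimately show "card (below nu) < card (below mu)"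
      using nu by (intro psubset_card_mono finite_below) auto
    show "is_partition nu" using nu by (simp add: below_def)
  qed
  then have "mac mu - (\<Sum>nu\<in>below mu. mconst (u nu) * Msym nu) \<in> lspan mac (Collect is_partition)"
    by (intro lspan_diff lspan_base lspan_sum lspan_scale) (use less.prems in auto)
  then show ?case by (simp add: u)
qed

lemma mac_basis:
  obtains T where "finite T" "T \<subseteq> Collect is_partition" "f = (\<Sum>mu\<in>T. mconst (mac_coeff mu f) * mac mu)"
    "\<And>mu. is_partition mu \<Longrightarrow> mac_coeff mu f \<noteq> 0 \<Longrightarrow> mu \<in> T"
proof -
  have "lspan Msym (Collect is_partition) \<subseteq> lspan mac (Collect is_partition)"
    by (rule lspan_subset) (simp add: Msym_in_lspan_mac)
  then have "f \<in> lspan mac (Collect is_partition)" using lspan_Msym_UNIV by blast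
  then obtain T u where T: "finite T" "T \<subseteq> Collect is_partition" "f = (\<Sum>mu\<in>T. mconst (u mu) * mac mu)"
    unfolding lspan_def by blast
  have c: "mac_coeff mu f = (if mu \<in> T then u mu else 0)" if "is_partition mu" for mu
  proof -
    have "mac_coeff mu f = (\<Sum>nu\<in>T. if nu = mu then u mu else 0)"
      unfolding T(3) mac_coeff_sum mac_coeff_scale
      by (rule sum.cong) (use T that in \<open>auto simp: mac_coeff_mac\<close>)
    then show ?thesis using T(1) by simp
  qed
  show ?thesis
  proof (rule that[OF T(1,2)])
    have "(\<Sum>mu\<in>T. mconst (u mu) * mac mu) = (\<Sum>mu\<in>T. mconst (mac_coeff mu f) * mac mu)"
      by (rule sum.cong) (use T(2) c in auto)
    then show "f = (\<Sum>mu\<in>T. mconst (mac_coeff mu f) * mac mu)" using T(3) by simp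
    show "mu \<in> T" if "is_partition mu" "mac_coeff mu f \<noteq> 0" for mu
      using c[OF that(1)] that(2) by (auto split: if_splits)
  qed
qed

text \<open>Restricted to \<open>n\<close> variables, the polynomials of partitions with more than \<open>n\<close> parts vanish, and the others
  remain linearly independent because each contains its own monomial with coefficient 1.\<close>

lemma mac_coeff_eq_0:
  assumes f: "in_vars n f = 0" and lam: "is_partition lam" "keys lam \<subseteq> {..<n}"
  shows "mac_coeff lam f = 0"
proof (rule ccontr)
  assume nz: "mac_coeff lam f \<noteq> 0"
  obtain T where T: "finite T" "T \<subseteq> Collect is_partition" "f = (\<Sum>mu\<in>T. mconst (mac_coeff mu f) * mac mu)"
    "\<And>mu. is_partition mu \<Longrightarrow> mac_coeff mu f \<noteq> 0 \<Longrightarrow> mu \<in> T"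
    by (rule mac_basis[of f]) blast
  let ?S = "{mu \<in> T. mac_coeff mu f \<noteq> 0 \<and> keys mu \<subseteq> {..<n}}"
  define k where "k = Max ?S"
  have fin: "finite ?S" using T(1) by simp
  have "lam \<in> ?S" using T(4) lam nz by simp
  then have k: "k \<in> ?S" unfolding k_def using Max_in[OF fin] by blast
  have "lookup (in_vars n f) k = (\<Sum>mu\<in>T. mac_coeff mu f * lookup (in_vars n (mac mu)) k)"
    by (subst T(3)) (simp add: in_vars_sum in_vars_mult in_vars_mconst lookup_sum lookup_mconst_mult)
  also have "\<dots> = (\<Sum>mu\<in>T. if mu = k then mac_coeff k f else 0)"
  proof (rule sum.cong[OF refl])
    fix mu assume mu: "mu \<in> T"
    then have mp: "is_partition mu" using T by auto
    show "mac_coeff mu f * lookup (in_vars n (mac mu)) k = (if mu = k then mac_coeff k f else 0)"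
    proof (cases "mu = k")
      case True
      then show ?thesis using lookup_mac_self[OF mp, of n] k by simp
    next
      case False
      have "mac_coeff mu f * lookup (in_vars n (mac mu)) k = 0"
      proof (rule ccontr)
        assume ne: "mac_coeff mu f * lookup (in_vars n (mac mu)) k \<noteq> 0"
        then have kk: "k \<in> keys (in_vars n (mac mu))" by (simp add: in_keys_iff)
        have d: "dominated k mu" by (rule keys_mac_dominated[OF mp kk])
        have "keys mu \<subseteq> {..<n}" by (rule dominated_keys[OF d keys_in_vars[OF kk]])
        then have "mu \<le> k" unfolding k_def using mu ne by (intro Max_ge[OF fin]) auto
        then show False using dominated_imp_le[OF d] False by simp
      qed
      then show ?thesis using False by simp
    qed
  qed
  also have "\<dots> = mac_coeff k f" using k T(1) by simp
  finally show False using f k by simp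
qed

lemma mac_coeff_cong:
  assumes "in_vars n f = in_vars n g" "is_partition lam" "keys lam \<subseteq> {..<n}"
  shows "mac_coeff lam f = mac_coeff lam g"
  using mac_coeff_eq_0[of n "f - g" lam] assms by (simp add: in_vars_diff mac_coeff_diff)

section \<open>The Pieri rule for \<open>p_1\<close>\<close>

lemma mac_coeff_adjoint:
  assumes "is_partition lam" "is_partition mu"
  shows "mac_coeff lam (mvar 0 * mac mu) \<noteq> 0 \<longleftrightarrow> mac_coeff mu (pd 0 (mac lam)) \<noteq> 0"
proof -
  have w: "qt_weight q t 0 \<noteq> 0"
  proof
    assume "qt_weight q t 0 = 0"
    then have "qt_form q t (mvar 0 * 1) (mvar 0) = 0" by (simp only: qt_form_mvar_adjoint mult_zero_left)
    then have "mvar 0 = (0 :: 'a mpol)" using anisotropic by simp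
    then have "lookup (mvar 0 :: 'a mpol) (single 0 1) = 0" by simp
    then show False by (simp add: mvar_def)
  qed
  then show ?thesis
    using mac_norm_nonzero assms qt_form_mvar_adjoint[of q t 0 "mac mu" "mac lam"]
    by (auto simp: mac_coeff_def qt_form_commute)
qed

text \<open>The derivative by \<open>p_1\<close> is the coefficient of the first power of an additional variable.\<close>

lemma in_vars_pd_mac_add_column:
  assumes lam: "is_partition lam" "keys lam \<subseteq> {..<Suc m}"
  shows "in_vars m (pd 0 (mac (lam + column (Suc m)))) = single (column m) 1 * in_vars m (mac lam)"
proof (rule poly_mapping_eqI)
  fix e
  show "lookup (in_vars m (pd 0 (mac (lam + column (Suc m))))) e = lookup (single (column m) 1 * in_vars m (mac lam)) e"
  proof (cases "m \<in> keys e")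
    case True
    have "e \<notin> keys (in_vars m (pd 0 (mac (lam + column (Suc m)))))" using True keys_in_vars by blast
    moreover have "e \<notin> keys (single (column m) 1 * in_vars m (mac lam))"
    proof
      assume "e \<in> keys (single (column m) 1 * in_vars m (mac lam))"
      then obtain d where d: "d \<in> keys (in_vars m (mac lam))" "e = column m + d"
        using keys_single_mult by blast
      then have "keys e \<subseteq> {..<m}" using keys_add[of "column m" d] keys_in_vars[OF d(1)] by (auto simp: keys_column)
      then show False using True by auto
    qed
    ultimately show ?thesis by (simp add: in_keys_iff)
  next
    case False
    have c1: "coeff (shift (\<lambda>_. 1) f) 1 = pd 0 f" for f :: "'a mpol" by (simp only: coeff_shift_1 mconst_1 mult_1)
    have colS: "column (Suc m) = column m + single m 1" by (simp add: column_def)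
    have "lookup (in_vars m (pd 0 (mac (lam + column (Suc m))))) e =
      lookup (in_vars (Suc m) (mac (lam + column (Suc m)))) (e + single m 1)"
      unfolding c1[symmetric] by (rule lookup_in_vars_Suc[OF False, symmetric])
    also have "\<dots> = lookup (single (column (Suc m)) 1 * in_vars (Suc m) (mac lam)) (e + single m 1)"
      unfolding in_vars_mac_add_column[OF lam] ..
    also have "\<dots> = lookup (single (column m) 1 * in_vars m (mac lam)) e"
    proof (cases "\<forall>i. lookup (column m) i \<le> lookup e i")
      case True
      then have e: "e = column m + (e - column m)"
        by (intro poly_mapping_eqI) (simp add: lookup_add lookup_minus)
      have "e + single m 1 = column (Suc m) + (e - column m)" by (subst e) (simp add: colS add_ac)
      then have "lookup (single (column (Suc m)) 1 * in_vars (Suc m) (mac lam)) (e + single m 1) =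
        lookup (in_vars (Suc m) (mac lam)) (e - column m)"
        using lookup_single_mult_add[of "column (Suc m)" 1 "in_vars (Suc m) (mac lam)" "e - column m"] by simp
      also have "\<dots> = lookup (in_vars m (mac lam)) (e - column m)"
      proof -
        have "m \<notin> keys (e - column m)" using False by (simp add: in_keys_iff lookup_minus)
        from lookup_in_vars_Suc[OF this, of "mac lam" 0] show ?thesis by (simp add: coeff_shift_0)
      qed
      also have "\<dots> = lookup (single (column m) 1 * in_vars m (mac lam)) e"
        using lookup_single_mult_add[of "column m" 1 "in_vars m (mac lam)" "e - column m"] e by simp
      finally show ?thesis .
    next
      case no: False
      then obtain i where i: "\<not> lookup (column m) i \<le> lookup e i" by blast
      then have "i < m" by (auto simp: lookup_column split: if_splits)
      then have "\<not> lookup (column (Suc m)) i \<le> lookup (e + single m 1) i"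
        using i by (auto simp: lookup_column lookup_add lookup_single when_def)
      then show ?thesis using i by (auto simp: lookup_single_mult)
    qed
    finally show ?thesis .
  qed
qed

text \<open>Let \<open>n\<close> be the number of parts of \<open>lam\<close>. If \<open>mu\<close> has more parts, then \<open>p_1 P_mu\<close> vanishes in \<open>n\<close> variables
  and cannot involve \<open>P_lam\<close>. If \<open>mu\<close> has \<open>n\<close> parts, a column can be removed from both. If \<open>mu\<close> has fewer
  parts, consider instead the adjoint, the coefficient of \<open>P_mu\<close> in the derivative of \<open>P_lam\<close>: restricted to
  \<open>n - 1\<close> variables this derivative is a single Macdonald polynomial, of \<open>lam\<close> without its last cell, or
  zero.\<close>

lemma pieri_support:
  assumes "is_partition lam" "is_partition mu" "mac_coeff lam (mvar 0 * mac mu) \<noteq> 0"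
  shows "\<exists>i. lam = mu + single i 1"
  using assms
proof (induction "psize lam" arbitrary: lam mu rule: less_induct)
  case less
  note lam = less.prems(1) and mu = less.prems(2) and nz = less.prems(3)
  define n where "n = card (keys lam)"
  have kl: "keys lam = {..<n}" unfolding n_def by (rule partition_keys_eq[OF lam])
  have "n \<noteq> 0"
  proof
    assume "n = 0"
    then have "lam = 0" using kl by simp
    then have "pd 0 (mac lam) = 0" using pd_mconst[of 0 "1 :: 'a"] by (simp add: mac_0)
    then show False using nz mac_coeff_adjoint[OF lam mu] by simp
  qed
  then obtain m where m: "n = Suc m" by (cases n) auto
  obtain lam' where lam': "is_partition lam'" "keys lam' \<subseteq> {..<n}" "lam = lam' + column n"
    using partition_minus_column[OF lam kl] by blast
  consider "\<not> keys mu \<subseteq> {..<n}" | "keys mu = {..<n}" | "keys mu \<subseteq> {..<m}"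
  proof -
    have "keys mu = {..<card (keys mu)}" by (rule partition_keys_eq[OF mu])
    then show ?thesis using that m by (metis lessThan_subset_iff less_Suc_eq_le linorder_not_le nle_le not_less_eq_eq)
  qed
  then show ?case
  proof cases
    case 1
    then have "in_vars n (mvar 0 * mac mu) = 0" by (simp add: in_vars_mult in_vars_mac_eq_0 mu)
    then show ?thesis using mac_coeff_eq_0[OF _ lam] kl nz by blast
  next
    case 2
    obtain mu' where mu': "is_partition mu'" "keys mu' \<subseteq> {..<n}" "mu = mu' + column n"
      using partition_minus_column[OF mu 2] by blast
    obtain T where T: "finite T" "T \<subseteq> Collect is_partition"
      "mvar 0 * mac mu' = (\<Sum>nu\<in>T. mconst (mac_coeff nu (mvar 0 * mac mu')) * mac nu)"
      by (rule mac_basis[of "mvar 0 * mac mu'"]) blast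
    let ?c = "\<lambda>nu. mac_coeff nu (mvar 0 * mac mu')"
    define T' where "T' = {nu \<in> T. keys nu \<subseteq> {..<n}}"
    have T': "finite T'" "\<And>nu. nu \<in> T' \<Longrightarrow> is_partition nu \<and> keys nu \<subseteq> {..<n}"
      using T by (auto simp: T'_def)
    define g where "g = (\<Sum>nu\<in>T'. mconst (?c nu) * mac (nu + column n))"
    have "in_vars n (mvar 0 * mac mu) = single (column n) 1 * in_vars n (mvar 0 * mac mu')"
      unfolding mu'(3) in_vars_mult in_vars_mac_add_column[OF mu'(1,2)] by (simp add: mult_ac)
    also have "in_vars n (mvar 0 * mac mu') = (\<Sum>nu\<in>T. mconst (?c nu) * in_vars n (mac nu))"
      by (subst T(3)) (simp add: in_vars_sum in_vars_mult in_vars_mconst)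
    also have "\<dots> = (\<Sum>nu\<in>T'. mconst (?c nu) * in_vars n (mac nu))"
    proof (rule sum.mono_neutral_right[OF T(1)])
      show "\<forall>nu\<in>T - T'. mconst (?c nu) * in_vars n (mac nu) = 0"
        using T(2) in_vars_mac_eq_0[of _ n] unfolding T'_def by fastforce
    qed (simp add: T'_def)
    also have "single (column n) 1 * \<dots> = in_vars n g"
      unfolding g_def in_vars_sum sum_distrib_left in_vars_mult in_vars_mconst
      by (rule sum.cong) (use T' in \<open>auto simp: in_vars_mac_add_column mult_ac\<close>)
    finally have "mac_coeff lam (mvar 0 * mac mu) = mac_coeff lam g"
      by (rule mac_coeff_cong[OF _ lam]) (simp add: kl)
    also have "\<dots> = (\<Sum>nu\<in>T'. if nu = lam' then ?c lam' else 0)"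
      unfolding g_def mac_coeff_sum mac_coeff_scale
      by (rule sum.cong) (use T' lam in \<open>auto simp: mac_coeff_mac is_partition_add is_partition_column lam'(3)\<close>)
    also have "\<dots> = (if lam' \<in> T' then ?c lam' else 0)" using T'(1) by simp
    finally have "?c lam' \<noteq> 0" using nz by (auto split: if_splits)
    moreover have "psize lam' < psize lam" using \<open>n \<noteq> 0\<close> by (simp add: lam'(3) psize_add psize_column)
    ultimately obtain i where "lam' = mu' + single i 1" using less.hyps lam'(1) mu'(1) by blast
    then show ?thesis by (intro exI[of _ i]) (simp add: lam'(3) mu'(3) add_ac)
  next
    case 3
    have r: "in_vars m (pd 0 (mac lam)) = single (column m) 1 * in_vars m (mac lam')"
      using in_vars_pd_mac_add_column[of lam' m] lam' m by simp
    have nz': "mac_coeff mu (pd 0 (mac lam)) \<noteq> 0" using nz mac_coeff_adjoint[OF lam mu] by simp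
    have k': "keys lam' \<subseteq> {..<m}"
    proof (rule ccontr)
      assume "\<not> keys lam' \<subseteq> {..<m}"
      then have "in_vars m (pd 0 (mac lam)) = 0" unfolding r by (simp add: in_vars_mac_eq_0 lam')
      then show False using mac_coeff_eq_0[OF _ mu 3] nz' by blast
    qed
    have "in_vars m (pd 0 (mac lam)) = in_vars m (mac (lam' + column m))"
      unfolding r in_vars_mac_add_column[OF lam'(1) k'] ..
    then have "mac_coeff mu (pd 0 (mac lam)) = mac_coeff mu (mac (lam' + column m))"
      by (rule mac_coeff_cong[OF _ mu 3])
    then have "mu = lam' + column m"
      using nz' mac_coeff_mac[OF mu is_partition_add[OF lam'(1) is_partition_column]] by (auto split: if_splits)
    then show ?thesis by (intro exI[of _ m]) (simp add: lam'(3) m column_def add_ac)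
  qed
qed

section \<open>Principal specialization\<close>

text \<open>For \<open>u = t^n\<close> this is evaluation at \<open>(1, t, \<dots>, t^(n-1))\<close>, see \<open>spec_power_t\<close>. Keeping \<open>u\<close> free shows
  that the constant in \<open>principal_specialization\<close> is the same for all \<open>n\<close>.\<close>

definition spec :: "'a \<Rightarrow> 'a mpol \<Rightarrow> 'a" where
  "spec u = msub (\<lambda>c. c) (\<lambda>r. (1 - u ^ Suc r) / (1 - t ^ Suc r))"

lemma semiring_hom_spec: "semiring_hom (spec u)"
  unfolding spec_def by (rule semiring_hom_msub[OF semiring_hom_id])

lemma spec_mconst: "spec u (mconst c) = c"
  unfolding spec_def by (rule msub_mconst[OF semiring_hom_id])

lemma spec_mvar: "spec u (mvar r) = (1 - u ^ Suc r) / (1 - t ^ Suc r)"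
  unfolding spec_def by (rule msub_mvar[OF semiring_hom_id])

lemmas spec_mult = semiring_hom_mult[OF semiring_hom_spec]
lemmas spec_add = semiring_hom_add[OF semiring_hom_spec]
lemmas spec_diff = semiring_hom_diff[OF semiring_hom_spec]
lemmas spec_sum = semiring_hom_sum[OF semiring_hom_spec]
lemmas spec_1 = semiring_hom_1[OF semiring_hom_spec]

text \<open>The specialized series is \<open>(1 - z / t) / (1 - u z / t)\<close>.\<close>

lemma spec_vertex_coeff:
  assumes u: "u \<noteq> 0"
  shows "spec u (vertex_coeff t m) = (if m = 0 then 1 else (u / t) ^ m * (1 - 1 / u))"
proof -
  define H where "H = Abs_fps (\<lambda>m. spec u (vertex_coeff t m))"
  have "(\<Prod>j<Suc 0. 1 - fps_const (u / t) * fps_X) * H = (\<Prod>j<Suc 0. 1 - fps_const (1 / t) * fps_X)"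
    unfolding H_def
  proof (rule vertex_coeff_series[OF semiring_hom_spec])
    fix r
    define T where "T = t ^ Suc r"
    have T: "T \<noteq> 0" "1 - T \<noteq> 0" using t_nonzero t_power[of r] by (auto simp: T_def)
    have "(1 - 1 / T) * ((1 - u ^ Suc r) / (1 - T)) = u ^ Suc r / T - 1 / T"
      using T by (simp add: divide_simps del: power_Suc) (simp add: algebra_simps del: power_Suc)
    then show "spec u (mconst (1 - 1 / t ^ Suc r) * mvar r) = (\<Sum>j<Suc 0. (u / t) ^ Suc r - (1 / t) ^ Suc r)"
      by (simp add: spec_mult spec_mconst spec_mvar power_divide T_def del: power_Suc)
  qed
  then have eq: "H - fps_const (u / t) * (fps_X * H) = 1 - fps_const (1 / t) * fps_X"
    by (simp add: left_diff_distrib mult.assoc)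
  have rec: "spec u (vertex_coeff t (Suc m)) = (u / t) * spec u (vertex_coeff t m) - (if m = 0 then 1 / t else 0)" for m
    using arg_cong[OF eq, of "\<lambda>F. fps_nth F (Suc m)"]
    by (simp add: H_def diff_eq_eq del: vertex_coeff.simps)
  show ?thesis
  proof (induction m)
    case (Suc m)
    show ?case unfolding rec Suc.IH using u t_nonzero by (cases "m = 0") (simp_all add: field_simps)
  qed (simp add: spec_1)
qed

lemma pd_vertex_coeff: "pd 0 (vertex_coeff t (Suc m)) = mconst (1 - 1 / t) * vertex_coeff t m"
proof (induction m rule: less_induct)
  case (less m)
  let ?c = "\<lambda>r. mconst (1 - 1 / t ^ Suc r) :: 'a mpol"
  have "of_nat (Suc m) * pd 0 (vertex_coeff t (Suc m)) = pd 0 (of_nat (Suc m) * vertex_coeff t (Suc m))"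
    by (simp only: pd_mconst_mult flip: mconst_of_nat)
  also have "\<dots> = (\<Sum>r<Suc m. pd 0 (?c r * mvar r * vertex_coeff t (m - r)))"
    unfolding vertex_coeff_rec by (simp only: pd_sum diff_Suc_Suc)
  also have "\<dots> = (\<Sum>r<Suc m. (if r = 0 then mconst (1 - 1 / t) * vertex_coeff t m else 0) +
      ?c r * mvar r * pd 0 (vertex_coeff t (m - r)))"
    by (rule sum.cong) (auto simp: pd_mult pd_mconst_mult pd_mvar mult.assoc distrib_left)
  also have "\<dots> = mconst (1 - 1 / t) * vertex_coeff t m + (\<Sum>r<Suc m. ?c r * mvar r * pd 0 (vertex_coeff t (m - r)))"
    unfolding sum.distrib by simp
  also have "(\<Sum>r<Suc m. ?c r * mvar r * pd 0 (vertex_coeff t (m - r))) =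
    (\<Sum>r<m. ?c r * mvar r * pd 0 (vertex_coeff t (m - r)))"
    using pd_mconst[of 0 "1 :: 'a"] by simp
  also have "\<dots> = (\<Sum>r<m. mconst (1 - 1 / t) * (?c r * mvar r * vertex_coeff t (m - Suc r)))"
  proof (rule sum.cong[OF refl])
    fix r assume r: "r \<in> {..<m}"
    then have "m - r = Suc (m - Suc r)" by auto
    then show "?c r * mvar r * pd 0 (vertex_coeff t (m - r)) = mconst (1 - 1 / t) * (?c r * mvar r * vertex_coeff t (m - Suc r))"
      using less[of "m - Suc r"] r by (simp only:) (simp add: mult_ac)
  qed
  also have "\<dots> = mconst (1 - 1 / t) * (of_nat m * vertex_coeff t m)"
    by (simp only: vertex_coeff_rec sum_distrib_left)
  finally have "of_nat (Suc m) * pd 0 (vertex_coeff t (Suc m)) = of_nat (Suc m) * (mconst (1 - 1 / t) * vertex_coeff t m)"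
    by (simp add: algebra_simps)
  moreover have "of_nat (Suc m) \<noteq> (0 :: 'a mpol)" by (rule of_nat_neq_0)
  ultimately show ?case by (rule mult_left_cancel[THEN iffD1, rotated])
qed

text \<open>The derivative by \<open>p_1\<close> commutes with the shift and lowers the index of \<open>vertex_coeff\<close> by one. Since the
  specialized coefficients are geometric from index 1 on, lowering the index amounts to the factor
  \<open>t / u\<close>, up to boundary terms.\<close>

lemma spec_commutator:
  assumes u: "u \<noteq> 0"
  shows "spec u (pd 0 (macop q t f)) - spec u (macop q t (pd 0 f)) =
    (1 - 1 / t) * ((t / u) * (spec u (macop q t f) - spec u f) + (q - 1) / u * spec u (pd 0 f))"
proof -
  let ?A = "vertex_coeff t" and ?B = "\<lambda>m. coeff (q_shift q f) m"
  define n where "n = Suc (max (degree (q_shift q f)) (degree (q_shift q (pd 0 f))))"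
  let ?b = "\<lambda>m. spec u (?B m)"
  have D: "macop q t f = (\<Sum>m\<le>n. ?A m * ?B m)" "macop q t (pd 0 f) = (\<Sum>m\<le>n. ?A m * pd 0 (?B m))"
    by (simp_all add: macop_altdef[of _ _ n] n_def q_shift_def pd_coeff_shift)
  have "pd 0 (macop q t f) - macop q t (pd 0 f) = (\<Sum>m\<le>n. pd 0 (?A m) * ?B m)"
    unfolding D by (simp add: pd_sum pd_mult sum.distrib)
  also have "\<dots> = (\<Sum>m<n. pd 0 (?A (Suc m)) * ?B (Suc m))"
    using pd_mconst[of 0 "1 :: 'a"] by (subst sum.atMost_shift) simp
  finally have "spec u (pd 0 (macop q t f)) - spec u (macop q t (pd 0 f)) =
    (1 - 1 / t) * (\<Sum>m<n. spec u (?A m) * ?b (Suc m))"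
    unfolding spec_diff[symmetric]
    by (simp add: pd_vertex_coeff spec_sum spec_mult spec_mconst sum_distrib_left mult.assoc
        del: vertex_coeff.simps)
  also have "(\<Sum>m<n. spec u (?A m) * ?b (Suc m)) =
    (t / u) * (spec u (macop q t f) - spec u f) + 1 / u * ?b 1"
  proof -
    have "spec u (macop q t f) - spec u f = (\<Sum>m<n. spec u (?A (Suc m)) * ?b (Suc m))"
      unfolding D spec_sum spec_mult sum.atMost_shift
      by (simp add: spec_1 spec_add spec_sum spec_mult q_shift_def coeff_shift_0 del: vertex_coeff.simps(2))
    then have "(t / u) * (spec u (macop q t f) - spec u f) =
        (\<Sum>m<n. (t / u) * (spec u (?A (Suc m)) * ?b (Suc m)))"
      by (simp only: sum_distrib_left)
    also have "\<dots> = (\<Sum>m<n. (u / t) ^ m * (1 - 1 / u) * ?b (Suc m))"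
    proof (rule sum.cong[OF refl])
      fix m
      have e: "(t / u) * (u / t) ^ Suc m = (u / t) ^ m" using u t_nonzero by simp
      have s: "spec u (?A (Suc m)) = (u / t) ^ Suc m * (1 - 1 / u)"
        unfolding spec_vertex_coeff[OF u] by (simp del: power_Suc)
      show "(t / u) * (spec u (?A (Suc m)) * ?b (Suc m)) = (u / t) ^ m * (1 - 1 / u) * ?b (Suc m)"
        unfolding s by (simp only: e mult.assoc[symmetric])
    qed
    also have "\<dots> = (\<Sum>m<n. spec u (?A m) * ?b (Suc m) - (if m = 0 then 1 / u * ?b 1 else 0))"
      unfolding spec_vertex_coeff[OF u] by (rule sum.cong) (auto simp: algebra_simps)
    also have "\<dots> = (\<Sum>m<n. spec u (?A m) * ?b (Suc m)) - 1 / u * ?b 1"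
      unfolding sum_subtractf by (simp add: n_def)
    finally show ?thesis by simp
  qed
  also have "?b 1 = (q - 1) * spec u (pd 0 f)"
    unfolding q_shift_def coeff_shift_1 by (simp add: spec_mult spec_mconst)
  finally show ?thesis by (simp only: times_divide_eq_left mult_1)
qed

definition content_prod :: "'a \<Rightarrow> (nat \<Rightarrow>\<^sub>0 nat) \<Rightarrow> 'a" where
  "content_prod u lam = (\<Prod>i\<in>keys lam. \<Prod>j<lookup lam i. u * q ^ j / t ^ i - 1)"

lemma content_prod_superset:
  "finite S \<Longrightarrow> keys lam \<subseteq> S \<Longrightarrow> content_prod u lam = (\<Prod>i\<in>S. \<Prod>j<lookup lam i. u * q ^ j / t ^ i - 1)"
  unfolding content_prod_def by (rule prod.mono_neutral_left) (auto simp: in_keys_iff)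

lemma content_prod_add_box:
  "content_prod u (mu + single i 1) = content_prod u mu * (u * q ^ lookup mu i / t ^ i - 1)"
proof -
  let ?S = "insert i (keys mu)"
  let ?h = "\<lambda>nu k. \<Prod>j<lookup nu k. u * q ^ j / t ^ k - 1"
  have "content_prod u (mu + single i 1) = (\<Prod>k\<in>?S. ?h (mu + single i 1) k)"
    using keys_add[of mu "single i 1"] by (intro content_prod_superset) auto
  also have "\<dots> = ?h (mu + single i 1) i * (\<Prod>k\<in>?S - {i}. ?h (mu + single i 1) k)"
    by (rule prod.remove) auto
  also have "(\<Prod>k\<in>?S - {i}. ?h (mu + single i 1) k) = (\<Prod>k\<in>?S - {i}. ?h mu k)"
    by (rule prod.cong) (auto simp: lookup_add lookup_single when_def)
  also have "?h (mu + single i 1) i = ?h mu i * (u * q ^ lookup mu i / t ^ i - 1)"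
    by (simp add: lookup_add)
  finally have "content_prod u (mu + single i 1) =
    (?h mu i * (\<Prod>k\<in>?S - {i}. ?h mu k)) * (u * q ^ lookup mu i / t ^ i - 1)" by (simp add: mult_ac)
  also have "?h mu i * (\<Prod>k\<in>?S - {i}. ?h mu k) = (\<Prod>k\<in>?S. ?h mu k)"
    by (rule prod.remove[symmetric]) auto
  also have "\<dots> = content_prod u mu" by (rule content_prod_superset[symmetric]) auto
  finally show ?thesis .
qed

lemma eigenvalue_superset:
  "finite S \<Longrightarrow> keys lam \<subseteq> S \<Longrightarrow> eigenvalue q t lam = 1 + (1 - 1 / t) * (\<Sum>i\<in>S. (q ^ lookup lam i - 1) / t ^ i)"
  unfolding eigenvalue_def
  by (intro arg_cong2[where f = "(+)"] arg_cong2[where f = "(*)"] refl sum.mono_neutral_left)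
    (auto simp: in_keys_iff)

lemma eigenvalue_add_box:
  "eigenvalue q t (mu + single i 1) = eigenvalue q t mu + (1 - 1 / t) * ((q - 1) * q ^ lookup mu i / t ^ i)"
proof -
  let ?S = "insert i (keys mu)"
  have "(\<Sum>k\<in>?S. (q ^ lookup (mu + single i 1) k - 1) / t ^ k) =
    (\<Sum>k\<in>?S. (q ^ lookup mu k - 1) / t ^ k + (if k = i then (q - 1) * q ^ lookup mu i / t ^ i else 0))"
    by (rule sum.cong)
      (auto simp: lookup_add lookup_single when_def left_diff_distrib simp flip: add_divide_distrib)
  also have "\<dots> = (\<Sum>k\<in>?S. (q ^ lookup mu k - 1) / t ^ k) + (q - 1) * q ^ lookup mu i / t ^ i"
    by (simp add: sum.distrib)
  finally have sum: "(\<Sum>k\<in>?S. (q ^ lookup (mu + single i 1) k - 1) / t ^ k) =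
    (\<Sum>k\<in>?S. (q ^ lookup mu k - 1) / t ^ k) + (q - 1) * q ^ lookup mu i / t ^ i" .
  have "eigenvalue q t (mu + single i 1) = 1 + (1 - 1 / t) * (\<Sum>k\<in>?S. (q ^ lookup (mu + single i 1) k - 1) / t ^ k)"
    using keys_add[of mu "single i 1"] by (intro eigenvalue_superset) auto
  moreover have "eigenvalue q t mu = 1 + (1 - 1 / t) * (\<Sum>k\<in>?S. (q ^ lookup mu k - 1) / t ^ k)"
    by (intro eigenvalue_superset) auto
  ultimately show ?thesis by (simp only: sum distrib_left add.assoc)
qed

text \<open>Applied to \<open>P_lam\<close>, whose derivative is \<open>\<Sum>\<^sub>mu b_mu P_mu\<close> with \<open>mu\<close> obtained by removing a cell \<open>(i, j)\<close>,
  the commutator formula expresses the value of \<open>P_lam\<close> through those of the \<open>P_mu\<close>. The difference of the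
  eigenvalues of \<open>lam\<close> and \<open>mu\<close> is a multiple of \<open>q^j / t^i\<close>, and together with the last term of the formula it
  gives \<open>P_mu\<close> a multiple of \<open>u q^j / t^i - 1\<close> as coefficient. This is the factor of the removed cell, so the
  products over the cells of the various \<open>mu\<close> all become the product over the cells of \<open>lam\<close>.\<close>

theorem principal_specialization:
  assumes "is_partition lam"
  shows "\<exists>c. \<forall>u. u \<noteq> 0 \<longrightarrow> spec u (mac lam) = c * content_prod u lam"
  using assms
proof (induction "psize lam" arbitrary: lam rule: less_induct)
  case less
  note lam = less.prems
  show ?case
  proof (cases "lam = 0")
    case True
    then show ?thesis by (intro exI[of _ 1]) (simp add: mac_0 spec_1 content_prod_def)
  next
    case False
    let ?E = "eigenvalue q t lam"
    have E: "?E - 1 \<noteq> 0" using eigenvalue_inj[OF lam is_partition_0] False by auto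
    have t1: "1 - 1 / t \<noteq> 0" using t_ne_1 t_nonzero by simp
    define b where "b = (\<lambda>mu. mac_coeff mu (pd 0 (mac lam)))"
    obtain T where T: "finite T" "T \<subseteq> Collect is_partition"
      "pd 0 (mac lam) = (\<Sum>mu\<in>T. mconst (b mu) * mac mu)"
      by (rule mac_basis[of "pd 0 (mac lam)"]) (auto simp: b_def)
    have box: "\<exists>i. lam = mu + single i 1" if "mu \<in> T" "b mu \<noteq> 0" for mu
      using pieri_support[OF lam, of mu] mac_coeff_adjoint[OF lam, of mu] that T(2) by (auto simp: b_def)
    have "\<forall>mu. \<exists>c. mu \<in> T \<longrightarrow> b mu \<noteq> 0 \<longrightarrow> (\<forall>u. u \<noteq> 0 \<longrightarrow> spec u (mac mu) = c * content_prod u mu)"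
    proof (intro allI)
      fix mu
      show "\<exists>c. mu \<in> T \<longrightarrow> b mu \<noteq> 0 \<longrightarrow> (\<forall>u. u \<noteq> 0 \<longrightarrow> spec u (mac mu) = c * content_prod u mu)"
      proof (cases "mu \<in> T \<and> b mu \<noteq> 0")
        case True
        then obtain i where "lam = mu + single i 1" using box by blast
        then have "psize mu < psize lam" by (simp add: psize_add)
        then show ?thesis using less.hyps[of mu] True T(2) by blast
      qed blast
    qed
    from choice[OF this] obtain c where c: "\<forall>mu. mu \<in> T \<longrightarrow> b mu \<noteq> 0 \<longrightarrow>
      (\<forall>u. u \<noteq> 0 \<longrightarrow> spec u (mac mu) = c mu * content_prod u mu)" by blast
    define C where "C = (\<Sum>mu\<in>T. b mu * (q - 1) * c mu) / (t * (?E - 1))"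
    have "spec u (mac lam) = C * content_prod u lam" if u: "u \<noteq> 0" for u
    proof -
      let ?s = "\<lambda>f. spec u f"
      have "?E * ?s (pd 0 (mac lam)) - ?s (macop q t (pd 0 (mac lam))) =
        (1 - 1 / t) * ((t / u) * (?E * ?s (mac lam) - ?s (mac lam)) + (q - 1) / u * ?s (pd 0 (mac lam)))"
        using spec_commutator[OF u, of "mac lam"]
        by (simp add: macop_mac lam pd_mconst_mult spec_mult spec_mconst)
      moreover have pds: "?s (pd 0 (mac lam)) = (\<Sum>mu\<in>T. b mu * ?s (mac mu))"
        unfolding T(3) by (simp add: spec_sum spec_mult spec_mconst)
      moreover have "?s (macop q t (pd 0 (mac lam))) = (\<Sum>mu\<in>T. eigenvalue q t mu * (b mu * ?s (mac mu)))"
        unfolding T(3) macop_sum macop_scale spec_sum spec_mult spec_mconst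
        by (rule sum.cong) (use T(2) in \<open>auto simp: macop_mac spec_mult spec_mconst\<close>)
      ultimately have "(\<Sum>mu\<in>T. (?E - eigenvalue q t mu) * (b mu * ?s (mac mu))) =
        (1 - 1 / t) * ((t / u) * ((?E - 1) * ?s (mac lam)) + (q - 1) / u * (\<Sum>mu\<in>T. b mu * ?s (mac mu)))"
        by (simp add: left_diff_distrib sum_subtractf sum_distrib_left)
      moreover have "(\<Sum>mu\<in>T. (?E - eigenvalue q t mu) * (b mu * ?s (mac mu))) =
        (1 - 1 / t) * ((q - 1) / u * (\<Sum>mu\<in>T. b mu * c mu * content_prod u lam + b mu * ?s (mac mu)))"
        unfolding sum_distrib_left
      proof (rule sum.cong[OF refl])
        fix mu assume mu: "mu \<in> T"
        show "(?E - eigenvalue q t mu) * (b mu * ?s (mac mu)) =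
          (1 - 1 / t) * ((q - 1) / u * (b mu * c mu * content_prod u lam + b mu * ?s (mac mu)))"
        proof (cases "b mu = 0")
          case nz: False
          then obtain i where i: "lam = mu + single i 1" using box mu by blast
          have s: "?s (mac mu) = c mu * content_prod u mu" using c mu nz u by blast
          define x where "x = q ^ lookup mu i / t ^ i"
          have dE: "?E - eigenvalue q t mu = (1 - 1 / t) * ((q - 1) * x)"
            unfolding i eigenvalue_add_box x_def by simp
          have "content_prod u lam = content_prod u mu * (u * x - 1)"
            unfolding i content_prod_add_box x_def by simp
          then have "b mu * c mu * content_prod u lam + b mu * ?s (mac mu) =
              u * (x * (b mu * (c mu * content_prod u mu)))"
            unfolding s by (simp only:) (simp add: algebra_simps)
          then show ?thesis unfolding dE using u by (simp add: s mult.assoc)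
        qed simp
      qed
      ultimately have "(1 - 1 / t) * ((q - 1) / u * (\<Sum>mu\<in>T. b mu * c mu * content_prod u lam + b mu * ?s (mac mu))) =
        (1 - 1 / t) * ((t / u) * ((?E - 1) * ?s (mac lam)) + (q - 1) / u * (\<Sum>mu\<in>T. b mu * ?s (mac mu)))"
        by (simp only:)
      then have "(q - 1) / u * (\<Sum>mu\<in>T. b mu * c mu * content_prod u lam + b mu * ?s (mac mu)) =
        (t / u) * ((?E - 1) * ?s (mac lam)) + (q - 1) / u * (\<Sum>mu\<in>T. b mu * ?s (mac mu))"
        by (rule mult_left_cancel[OF t1, THEN iffD1])
      then have "(q - 1) / u * (\<Sum>mu\<in>T. b mu * c mu * content_prod u lam) = (t / u) * ((?E - 1) * ?s (mac lam))"
        by (simp only: sum.distrib distrib_left add_right_cancel)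
      then have "(t / u) * ((?E - 1) * ?s (mac lam)) = (q - 1) / u * (\<Sum>mu\<in>T. b mu * c mu * content_prod u lam)"
        by (rule sym)
      also have "(\<Sum>mu\<in>T. b mu * c mu * content_prod u lam) = (\<Sum>mu\<in>T. b mu * c mu) * content_prod u lam"
        by (simp add: sum_distrib_right)
      finally have "?s (mac lam) = ((q - 1) * (\<Sum>mu\<in>T. b mu * c mu)) / (t * (?E - 1)) * content_prod u lam"
        using u t_nonzero E by (simp add: field_simps)
      also have "(q - 1) * (\<Sum>mu\<in>T. b mu * c mu) = (\<Sum>mu\<in>T. b mu * (q - 1) * c mu)"
        by (simp add: sum_distrib_left mult_ac)
      finally show ?thesis by (simp add: C_def)
    qed
    then show ?thesis by blast
  qed
qed

lemma spec_power_t: "spec (t ^ n) f = mpol_value (in_vars n f) (\<lambda>i. t ^ i)"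
proof -
  have hom: "semiring_hom (\<lambda>f. msub (\<lambda>c. c) (\<lambda>i. t ^ i) (in_vars n f))"
    by (rule semiring_hom_comp[OF semiring_hom_msub[OF semiring_hom_id] semiring_hom_in_vars])
  have "spec (t ^ n) f = msub (\<lambda>c. c) (\<lambda>i. t ^ i) (in_vars n f)"
  proof (rule mpol_hom_eqI[OF semiring_hom_spec hom])
    fix r
    have "(\<Sum>j<n. (t ^ Suc r) ^ j) = (1 - (t ^ Suc r) ^ n) / (1 - t ^ Suc r)"
      using sum_gp_strict[of "t ^ Suc r" n] t_power[of r] by simp
    moreover have "msub (\<lambda>c. c) (\<lambda>i. t ^ i) (in_vars n (mvar r)) = (\<Sum>j<n. (t ^ j) ^ Suc r)"
      unfolding in_vars_mvar powsum_def semiring_hom_sum[OF semiring_hom_msub[OF semiring_hom_id]]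
        semiring_hom_power[OF semiring_hom_msub[OF semiring_hom_id]] msub_mvar[OF semiring_hom_id] ..
    ultimately show "spec (t ^ n) (mvar r) = msub (\<lambda>c. c) (\<lambda>i. t ^ i) (in_vars n (mvar r))"
      unfolding spec_mvar by (simp only: power_mult[symmetric] mult.commute)
  qed (simp add: spec_mconst in_vars_mconst msub_mconst semiring_hom_id)
  then show ?thesis by (simp add: mpol_value_eq_msub)
qed

end

section \<open>Limits of Laurent series\<close>

lemma has_limit_0_iff: "has_limit_0 f c \<longleftrightarrow> (\<exists>x. f = fps_to_fls x \<and> fps_nth x 0 = c)"
proof
  assume "has_limit_0 f c"
  then show "\<exists>x. f = fps_to_fls x \<and> fps_nth x 0 = c"
    by (intro exI[of _ "fls_regpart f"]) (simp add: has_limit_0_def)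
next
  assume "\<exists>x. f = fps_to_fls x \<and> fps_nth x 0 = c"
  then show "has_limit_0 f c"
    using fls_subdegree_fls_to_fps_gt0 by (auto simp: has_limit_0_def)
qed

lemma has_limit_0_unique: "has_limit_0 f c \<Longrightarrow> has_limit_0 f d \<Longrightarrow> c = d"
  by (simp add: has_limit_0_def)

lemma has_limit_0_const: "has_limit_0 (fls_const c) c"
  unfolding has_limit_0_iff by (intro exI[of _ "fps_const c"]) simp

lemma has_limit_0_0: "has_limit_0 0 0"
  using has_limit_0_const[of 0] by simp

lemma has_limit_0_1: "has_limit_0 (1 :: 'a::field fls) 1"
  unfolding has_limit_0_iff by (intro exI[of _ 1]) simp

lemma has_limit_0_add: "has_limit_0 f c \<Longrightarrow> has_limit_0 g d \<Longrightarrow> has_limit_0 (f + g) (c + d)"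
  for f :: "'a::field fls"
  unfolding has_limit_0_iff by (metis fps_to_fls_plus fps_add_nth)

lemma has_limit_0_uminus: "has_limit_0 f c \<Longrightarrow> has_limit_0 (- f) (- c)"
  for f :: "'a::field fls"
  unfolding has_limit_0_iff by (metis fps_to_fls_uminus fps_neg_nth)

lemma has_limit_0_mult: "has_limit_0 f c \<Longrightarrow> has_limit_0 g d \<Longrightarrow> has_limit_0 (f * g) (c * d)"
  for f :: "'a::field fls"
  unfolding has_limit_0_iff by (metis fls_times_fps_to_fls fps_mult_nth_0)

lemma has_limit_0_sum: "(\<And>x. x \<in> A \<Longrightarrow> has_limit_0 (f x) (c x)) \<Longrightarrow> has_limit_0 (sum f A) (sum c A)"
  for f :: "'b \<Rightarrow> 'a::field fls"
  by (induction A rule: infinite_finite_induct) (auto simp: has_limit_0_0 has_limit_0_add)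

lemma has_limit_0_prod: "(\<And>x. x \<in> A \<Longrightarrow> has_limit_0 (f x) (c x)) \<Longrightarrow> has_limit_0 (prod f A) (prod c A)"
  for f :: "'b \<Rightarrow> 'a::field fls"
  by (induction A rule: infinite_finite_induct) (auto simp: has_limit_0_1 has_limit_0_mult)

lemma has_limit_0_power: "has_limit_0 f c \<Longrightarrow> has_limit_0 (f ^ n) (c ^ n)"
  for f :: "'a::field fls"
  by (induction n) (auto simp: has_limit_0_1 has_limit_0_mult)

lemma has_limit_0_inverse:
  fixes f :: "'a::field fls"
  assumes "has_limit_0 f c" "c \<noteq> 0"
  shows "has_limit_0 (inverse f) (inverse c)"
proof -
  obtain x where x: "f = fps_to_fls x" "fps_nth x 0 = c" using assms(1) by (auto simp: has_limit_0_iff)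
  have "subdegree x = 0" using x(2) assms(2) by simp
  then have "inverse f = fps_to_fls (inverse x)" unfolding x(1) by (simp add: fls_inverse_fps_to_fls)
  moreover have "fps_nth (inverse x) 0 = inverse c" by (simp add: x(2))
  ultimately show ?thesis unfolding has_limit_0_iff by blast
qed

lemma has_limit_0_divide:
  "has_limit_0 f c \<Longrightarrow> has_limit_0 g d \<Longrightarrow> d \<noteq> 0 \<Longrightarrow> has_limit_0 (f / g) (c / d)" for f :: "'a::field fls"
  unfolding divide_inverse by (intro has_limit_0_mult has_limit_0_inverse)

lemma has_limit_0_of_nat: "has_limit_0 (of_nat n :: 'a::field fls) (of_nat n)"
  using has_limit_0_sum[of "{..<n}" "\<lambda>_. 1" "\<lambda>_. 1"] has_limit_0_1 by simp

lemma has_limit_0_of_int: "has_limit_0 (of_int n :: 'a::field fls) (of_int n)"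
proof (cases n rule: int_diff_cases)
  case (diff a b)
  have "has_limit_0 (of_nat a + - of_nat b :: 'a fls) (of_nat a + - of_nat b)"
    by (intro has_limit_0_add has_limit_0_uminus has_limit_0_of_nat)
  then show ?thesis by (simp add: diff)
qed

definition regular :: "'a::field_char_0 fls set" where
  "regular = {f. \<exists>c. has_limit_0 f c}"

lemma regularI: "has_limit_0 f c \<Longrightarrow> f \<in> regular"
  by (auto simp: regular_def)

lemma regular_iff: "f \<in> regular \<longleftrightarrow> fls_subdegree f \<ge> 0"
  by (auto simp: regular_def has_limit_0_def)

lemma regular_limit: "f \<in> regular \<Longrightarrow> has_limit_0 f (fls_nth f 0)"
  by (simp add: regular_iff has_limit_0_def)

lemma subsemiring_regular: "subsemiring regular"
  unfolding subsemiring_def using has_limit_0_0 has_limit_0_1 has_limit_0_add has_limit_0_mult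
  by (auto simp: regular_def) blast+

lemma Rats_regular: "\<rat> \<subseteq> (regular :: 'a::field_char_0 fls set)"
proof
  fix x :: "'a fls" assume "x \<in> \<rat>"
  then obtain a b :: int where ab: "b > 0" "x = of_int a / of_int b" by (rule Rats_cases')
  have "of_int b \<noteq> (0 :: 'a)" using ab(1) by simp
  then have "has_limit_0 x (of_int a / of_int b)"
    unfolding ab(2) by (rule has_limit_0_divide[OF has_limit_0_of_int has_limit_0_of_int])
  then show "x \<in> regular" by (rule regularI)
qed

section \<open>Binomial series\<close>

text \<open>The power \<open>t^c\<close> of \<open>t = 1 + z\<close>, for any exponent \<open>c\<close> in the ground field.\<close>

definition t_pow :: "'a::field_char_0 \<Rightarrow> 'a fls" where
  "t_pow c = fps_to_fls (fps_binomial c)"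

lemma t_pow_add: "t_pow (c + d) = t_pow c * t_pow d"
  by (simp add: t_pow_def fps_binomial_add_mult fls_times_fps_to_fls)

lemma t_pow_0 [simp]: "t_pow 0 = 1"
  by (simp add: t_pow_def)

lemma t_pow_nonzero [simp]: "t_pow c \<noteq> 0"
  using t_pow_add[of c "- c"] by auto

lemma t_pow_diff: "t_pow (c - d) = t_pow c / t_pow d"
  using t_pow_add[of "c - d" d] by (simp add: field_simps)

lemma t_pow_power: "t_pow c ^ n = t_pow (of_nat n * c)"
  by (induction n) (simp_all add: t_pow_add distrib_right)

lemma t_param_eq: "t_param = t_pow 1"
  by (simp add: t_param_def t_pow_def fps_binomial_1)

lemma q_param_eq: "q_param = t_pow alpha"
  by (simp add: q_param_def t_pow_def)

lemma t_pow_limit: "has_limit_0 (t_pow c) 1"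
  unfolding has_limit_0_iff t_pow_def by (intro exI[of _ "fps_binomial c"]) simp

lemma t_pow_derivative: "has_limit_0 ((t_pow c - 1) / fls_X) c"
proof -
  define y where "y = Abs_fps (\<lambda>n. c gchoose Suc n)"
  have "fps_binomial c - 1 = fps_X * y"
    by (rule fps_ext) (auto simp: y_def gr0_conv_Suc)
  then have b: "t_pow c - 1 = fls_X * fps_to_fls y"
    unfolding t_pow_def by (metis fls_times_fps_to_fls fps_X_to_fls fps_one_to_fls fps_to_fls_minus)
  have "fls_X \<noteq> (0 :: 'a fls)" by simp
  then have "(t_pow c - 1) / fls_X = fps_to_fls y" unfolding b by (rule nonzero_mult_div_cancel_left)
  then show ?thesis unfolding has_limit_0_iff by (intro exI[of _ y]) (simp add: y_def)
qed

lemma t_pow_inj: "t_pow c = t_pow d \<Longrightarrow> c = d"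
  using has_limit_0_unique[OF t_pow_derivative, of c d] t_pow_derivative[of d] by simp

text \<open>The series \<open>(1 + z)^c\<close> are eigenvectors of \<open>(1 + z) d/dz\<close> for the distinct eigenvalues \<open>c\<close>.\<close>

lemma t_pow_independent:
  fixes w :: "'a::field_char_0 \<Rightarrow> 'a"
  assumes "finite C" "(\<Sum>c\<in>C. fps_const (w c) * fps_binomial c) = 0" "c \<in> C"
  shows "w c = 0"
  using assms
proof (induction C arbitrary: w c rule: finite_induct)
  case (insert d C)
  define L where "L = (\<lambda>F. (1 + fps_X) * fps_deriv F - fps_const d * F :: 'a fps)"
  have L1: "L (fps_const v * fps_binomial c) = fps_const (v * (c - d)) * fps_binomial c" for v c
  proof -
    have u: "fps_nth (1 + fps_X :: 'a fps) 0 \<noteq> 0" by simp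
    have "(1 + fps_X) * fps_deriv (fps_binomial c) = fps_const c * fps_binomial c"
      unfolding fps_binomial_deriv using u by (metis fps_divide_times_eq mult.commute nonzero_mult_div_cancel_left
          fps_unit_dvd_right dvd_mult_div_cancel unit_dvdE fps_is_unit_iff unit_imp_dvd)
    then have "(1 + fps_X) * fps_deriv (fps_const v * fps_binomial c) = fps_const v * (fps_const c * fps_binomial c)"
      by (simp add: mult.left_commute)
    then show ?thesis unfolding L_def
      by (simp add: right_diff_distrib left_diff_distrib mult_ac flip: fps_const_mult fps_const_sub)
  qed
  have Ls: "L (sum F A) = (\<Sum>x\<in>A. L (F x))" for F and A :: "'a set"
    by (induction A rule: infinite_finite_induct) (auto simp: L_def algebra_simps)
  have "(\<Sum>c\<in>C. fps_const (w c * (c - d)) * fps_binomial c) = L (\<Sum>c\<in>insert d C. fps_const (w c) * fps_binomial c)"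
    unfolding Ls L1 using insert.hyps by simp
  also have "\<dots> = 0" unfolding insert.prems(1) by (simp add: L_def)
  finally have "w c * (c - d) = 0" if "c \<in> C" for c
    using insert.IH[of "\<lambda>c. w c * (c - d)"] that by blast
  then have C: "w c = 0" if "c \<in> C" for c using that insert.hyps(2) by auto
  then have "(\<Sum>c\<in>C. fps_const (w c) * fps_binomial c) = 0" by simp
  then have "fps_const (w d) * fps_binomial d = 0" using insert.prems(1) insert.hyps by simp
  moreover have "fps_nth (fps_const (w d) * fps_binomial d) 0 = w d" by simp
  ultimately have "w d = 0" by (metis fps_zero_nth)
  then show ?case using C insert.prems(2) by auto
qed simp

lemma alpha_pos: "alpha > 0"
proof -
  have "pos_poly [:0, 1 :: rat:]" by (simp add: pos_poly_pCons)
  then have "[:0, 1 :: rat:] > 0" by (simp add: less_poly_def)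
  then show ?thesis by (simp add: alpha_def zero_less_Fract_iff)
qed

lemma alpha_independent:
  assumes "alpha * of_nat a - of_nat i = alpha * of_nat b - of_nat j"
  shows "a = b" "i = j"
proof -
  have "alpha * of_nat a + of_nat j = alpha * of_nat b + (of_nat i :: ratfun)"
    using assms by (simp add: algebra_simps)
  then have "Fract ([:0, 1:] * of_nat a + of_nat j :: rat poly) 1 = Fract ([:0, 1:] * of_nat b + of_nat i) 1"
    by (simp add: alpha_def of_nat_fract)
  then have eq: "[:0, 1:] * of_nat a + of_nat j = ([:0, 1:] * of_nat b + of_nat i :: rat poly)"
    by (simp add: eq_fract)
  have "coeff ([:0, 1:] * of_nat a + of_nat j :: rat poly) 0 = of_nat j" for a j
    by (simp add: of_nat_poly)
  then show "i = j" using arg_cong[OF eq, of "\<lambda>p. coeff p 0"] by simp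
  have "coeff ([:0, 1:] * of_nat a + of_nat j :: rat poly) 1 = of_nat a" for a j
    by (simp add: of_nat_poly)
  then show "a = b" using arg_cong[OF eq, of "\<lambda>p. coeff p 1"] by simp
qed

section \<open>The limiting scalar product is positive definite\<close>

lemma t_param_power: "t_param ^ Suc r \<noteq> 1"
proof
  assume "t_param ^ Suc r = (1 :: ratfun fls)"
  then have "t_pow (of_nat (Suc r)) = (t_pow 0 :: ratfun fls)" by (simp only: t_param_eq t_pow_power mult_1_right t_pow_0)
  then have "of_nat (Suc r) = (0 :: ratfun)" by (rule t_pow_inj)
  then show False by (simp del: of_nat_Suc)
qed

lemma qt_params_concrete: "qt_params t_param"
proof
  show "t_param \<noteq> 0" by (simp add: t_param_eq)
qed (rule t_param_power)

lemma qt_weight_limit: "has_limit_0 (qt_weight q_param t_param r) (of_nat (Suc r) * alpha)"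
proof -
  let ?m = "of_nat (Suc r) :: ratfun"
  have X: "fls_X \<noteq> (0 :: ratfun fls)" by simp
  have "has_limit_0 (((t_pow (?m * alpha) - 1) / fls_X) / ((t_pow ?m - 1) / fls_X)) (?m * alpha / ?m)"
    by (rule has_limit_0_divide[OF t_pow_derivative t_pow_derivative]) (rule of_nat_neq_0)
  also have "((t_pow (?m * alpha) - 1) / fls_X) / ((t_pow ?m - 1) / fls_X) = (t_pow (?m * alpha) - 1) / (t_pow ?m - 1)"
  proof -
    have "(a / z) / (b / z) = a / b" if "z \<noteq> 0" for a b z :: "ratfun fls" using that by simp
    then show ?thesis using X by blast
  qed
  also have "\<dots> = (1 - t_pow (?m * alpha)) / (1 - t_pow ?m)"
    by (metis minus_diff_eq minus_divide_divide)
  also have "\<dots> = (1 - q_param ^ Suc r) / (1 - t_param ^ Suc r)"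
    by (simp only: q_param_eq t_param_eq t_pow_power mult_1_right)
  finally have l: "has_limit_0 ((1 - q_param ^ Suc r) / (1 - t_param ^ Suc r)) (?m * alpha / ?m)" .
  have "?m * alpha / ?m = alpha" by (simp del: of_nat_Suc)
  then show ?thesis unfolding qt_weight_def using has_limit_0_mult[OF has_limit_0_of_nat l, of "Suc r"] by simp
qed

definition jack_norm :: "(nat \<Rightarrow>\<^sub>0 nat) \<Rightarrow> ratfun" where
  "jack_norm e = (\<Prod>r\<in>keys e. (of_nat (Suc r) * alpha) ^ lookup e r * of_nat (fact (lookup e r)))"

lemma qt_norm_limit: "has_limit_0 (qt_norm q_param t_param e) (jack_norm e)"
proof -
  have "has_limit_0 (fact m :: ratfun fls) (of_nat (fact m))" for m
    using has_limit_0_of_nat[of "fact m", where ?'a = ratfun] by (simp only: of_nat_fact)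
  then show ?thesis
    unfolding qt_norm_def jack_norm_def
    by (intro has_limit_0_prod has_limit_0_mult has_limit_0_power qt_weight_limit)
qed

lemma jack_norm_pos: "jack_norm e > 0"
  unfolding jack_norm_def using alpha_pos
  by (intro prod_pos mult_pos_pos zero_less_power ballI) (simp_all del: of_nat_Suc)

text \<open>The rational functions are ordered by the sign of the leading coefficients, so that \<open>alpha\<close> is
  positive and a sum of squares with positive weights cannot cancel.\<close>

lemma ratfun_sum_squares_pos:
  assumes "finite S" "e \<in> S" "g e \<noteq> 0"
  shows "(\<Sum>e\<in>S. g e * g e * jack_norm e) > 0"
proof -
  have "g e * g e > 0" using assms(3) by (metis mult_neg_neg mult_pos_pos linorder_neqE_linordered_idom)
  then have "0 < g e * g e * jack_norm e" using jack_norm_pos by (rule mult_pos_pos)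
  also have "\<dots> \<le> (\<Sum>e\<in>S. g e * g e * jack_norm e)"
    by (rule member_le_sum[OF assms(2) _ assms(1)]) (use jack_norm_pos in \<open>simp add: less_imp_le\<close>)
  finally show ?thesis .
qed

text \<open>\<open>c\<close> is the inverse of a coefficient of \<open>f\<close> of least order in \<open>z\<close>; it tends to zero if \<open>f\<close> has a pole.\<close>

lemma normalize_order:
  fixes f :: "'a::field_char_0 fls mpol"
  assumes "f \<noteq> 0"
  obtains c e where "c \<noteq> 0" "e \<in> keys f" "c * lookup f e = 1"
    "coeffs_in regular (mconst c * f)" "coeffs_in regular f \<or> has_limit_0 c 0"
proof -
  have ne: "keys f \<noteq> {}" using assms by simp
  obtain e where e: "e \<in> keys f" "\<And>d. d \<in> keys f \<Longrightarrow> fls_subdegree (lookup f e) \<le> fls_subdegree (lookup f d)"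
    using arg_min_if_finite[of "keys f" "\<lambda>e. fls_subdegree (lookup f e)"] ne
    by (metis finite_keys arg_min_least)
  define c where "c = inverse (lookup f e)"
  have fe: "lookup f e \<noteq> 0" using e(1) by (simp add: in_keys_iff)
  have c: "c \<noteq> 0" "c * lookup f e = 1" using fe by (simp_all add: c_def)
  have sc: "fls_subdegree c = - fls_subdegree (lookup f e)"
    using fls_subdegree_mult[OF c(1) fe] by (simp add: c(2))
  have "c * lookup f d \<in> regular" for d
  proof (cases "d \<in> keys f")
    case True
    then have "lookup f d \<noteq> 0" by (simp add: in_keys_iff)
    then show ?thesis using fls_subdegree_mult[OF c(1)] sc e(2)[OF True] by (simp add: regular_iff)
  qed (simp add: in_keys_iff regular_iff)
  then have "coeffs_in regular (mconst c * f)" by (simp add: coeffs_in_def lookup_mconst_mult)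
  moreover have "coeffs_in regular f \<or> has_limit_0 c 0"
  proof (cases "fls_subdegree (lookup f e) < 0")
    case True
    then show ?thesis using sc by (auto simp: has_limit_0_def)
  next
    case False
    have "lookup f d \<in> regular" for d
      using e(2)[of d] False by (cases "d \<in> keys f") (auto simp: regular_iff in_keys_iff)
    then show ?thesis by (simp add: coeffs_in_def)
  qed
  ultimately show ?thesis using that[OF c(1) e(1) c(2)] by blast
qed

lemma qt_form_limit:
  assumes "coeffs_in regular f" "coeffs_in regular g" "finite S" "keys f \<subseteq> S"
  shows "has_limit_0 (qt_form q_param t_param f g)
    (\<Sum>e\<in>S. fls_nth (lookup f e) 0 * fls_nth (lookup g e) 0 * jack_norm e)"
  unfolding qt_form_superset[OF assms(3,4)]
  by (intro has_limit_0_sum has_limit_0_mult qt_norm_limit regular_limit)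
    (use assms in \<open>auto simp: coeffs_in_def\<close>)

lemma normalized_form_limit:
  assumes "coeffs_in regular f" "e \<in> keys f" "lookup f e = 1"
  obtains l where "has_limit_0 (qt_form q_param t_param f f) l" "l > 0"
proof
  show "has_limit_0 (qt_form q_param t_param f f) (\<Sum>e\<in>keys f. fls_nth (lookup f e) 0 * fls_nth (lookup f e) 0 * jack_norm e)"
    by (rule qt_form_limit) (use assms in auto)
  show "(\<Sum>e\<in>keys f. fls_nth (lookup f e) 0 * fls_nth (lookup f e) 0 * jack_norm e) > 0"
    by (rule ratfun_sum_squares_pos[of _ e]) (use assms in auto)
qed

lemma anisotropic_concrete:
  assumes "qt_form q_param t_param f f = 0"
  shows "f = 0"
proof (rule ccontr)
  assume "f \<noteq> 0"
  then obtain c e where c: "c \<noteq> 0" "e \<in> keys f" "c * lookup f e = 1" "coeffs_in regular (mconst c * f)"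
    by (rule normalize_order)
  have "lookup (mconst c * f) e = 1" by (simp add: lookup_mconst_mult c)
  then obtain l where "has_limit_0 (qt_form q_param t_param (mconst c * f) (mconst c * f)) l" "l > 0"
    using normalized_form_limit[OF c(4), of e] by (metis in_keys_iff zero_neq_one)
  then show False
    using assms has_limit_0_unique[OF has_limit_0_0] by (auto simp: qt_form_scale_left qt_form_scale_right)
qed

text \<open>In \<open>n\<close> variables the eigenvalue is, up to a factor, the sum of the powers of \<open>t\<close> with exponents
  \<open>alpha lam_i - i\<close>. These powers are linearly independent, so the eigenvalue determines the set of exponents,
  and the exponent \<open>alpha lam_i - i\<close> determines \<open>i\<close> and \<open>lam_i\<close>.\<close>

lemma eigenvalue_inj_concrete:
  assumes p: "is_partition lam" "is_partition mu"
    and eq: "eigenvalue q_param t_param lam = eigenvalue q_param t_param mu"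
  shows "lam = mu"
proof -
  define n where "n = max (psize lam) (psize mu)"
  interpret qt_params q_param t_param by (rule qt_params_concrete)
  have "node_coeff n \<noteq> 0"
    using t_power[of 0] t_nonzero by (simp add: node_coeff_def)
  moreover have "keys lam \<subseteq> {..<n}" "keys mu \<subseteq> {..<n}"
    by (rule partition_keys_subset; simp add: p n_def)+
  ultimately have "eigenvalue_vars n lam = eigenvalue_vars n mu"
    using eq eigenvalue_vars_eq[of lam n] eigenvalue_vars_eq[of mu n]
    by (metis add_left_cancel mult_left_cancel)
  let ?x = "\<lambda>(nu :: nat \<Rightarrow>\<^sub>0 nat) i. alpha * of_nat (lookup nu i) - of_nat i"
  have ev: "eigenvalue_vars n nu = t_param ^ (n - 1) * (\<Sum>i<n. t_pow (?x nu i))" for nu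
    unfolding eigenvalue_vars_def sum_distrib_left
  proof (rule sum.cong[OF refl])
    fix i assume "i \<in> {..<n}"
    then have "t_param ^ (n - 1) = t_param ^ (n - 1 - i) * t_param ^ i" by (simp flip: power_add)
    moreover have "t_pow (?x nu i) = q_param ^ lookup nu i / t_param ^ i"
      by (simp add: t_pow_diff q_param_eq t_param_eq t_pow_power mult.commute)
    ultimately show "t_param ^ (n - 1 - i) * q_param ^ lookup nu i = t_param ^ (n - 1) * t_pow (?x nu i)"
      using t_nonzero by simp
  qed
  have inj: "inj_on (?x nu) {..<n}" for nu
    by (rule inj_onI) (rule alpha_independent(2))
  have im: "(\<Sum>i<n. t_pow (?x nu i)) = fps_to_fls (\<Sum>c\<in>?x nu ` {..<n}. fps_binomial c)" for nu
  proof -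
    have fs: "fps_to_fls (\<Sum>c\<in>A. fps_binomial c) = (\<Sum>c\<in>A. t_pow c)" for A :: "ratfun set"
      by (induction A rule: infinite_finite_induct) (auto simp: t_pow_def)
    show ?thesis unfolding fs by (simp add: sum.reindex[OF inj])
  qed
  let ?C = "?x lam ` {..<n}" and ?D = "?x mu ` {..<n}"
  have "(\<Sum>i<n. t_pow (?x lam i)) = (\<Sum>i<n. t_pow (?x mu i))"
    using \<open>eigenvalue_vars n lam = eigenvalue_vars n mu\<close> t_nonzero by (simp add: ev)
  then have CD: "(\<Sum>c\<in>?C. fps_binomial c) = (\<Sum>c\<in>?D. fps_binomial c)"
    unfolding im by (rule fps_to_fls_eq_imp_fps_eq)
  \<comment> \<open>a linear relation whose coefficients vanish only if the sets of exponents agree\<close>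
  define w where "w = (\<lambda>c. (if c \<in> ?C then 1 else 0) - (if c \<in> ?D then 1 else 0) :: ratfun)"
  have ind: "(\<Sum>c\<in>?C \<union> ?D. fps_const (if c \<in> A then 1 else 0) * fps_binomial c) = (\<Sum>c\<in>A. fps_binomial c)"
    if "A \<subseteq> ?C \<union> ?D" for A
    by (rule sum.mono_neutral_cong_right) (use that in auto)
  have "(\<Sum>c\<in>?C \<union> ?D. fps_const (w c) * fps_binomial c) =
    (\<Sum>c\<in>?C \<union> ?D. fps_const (if c \<in> ?C then 1 else 0) * fps_binomial c) -
    (\<Sum>c\<in>?C \<union> ?D. fps_const (if c \<in> ?D then 1 else 0) * fps_binomial c)"
    unfolding sum_subtractf[symmetric] w_def
    by (rule sum.cong) (simp_all only: left_diff_distrib fps_const_sub[symmetric])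
  also have "\<dots> = 0" unfolding ind[OF Un_upper1] ind[OF Un_upper2] CD by simp
  finally have w0: "w c = 0" if "c \<in> ?C \<union> ?D" for c
    by (rule t_pow_independent[rotated, OF _ that]) simp
  show ?thesis
  proof (rule poly_mapping_eqI)
    fix i
    show "lookup lam i = lookup mu i"
    proof (cases "i < n")
      case True
      then have "?x lam i \<in> ?C" by blast
      then have "?x lam i \<in> ?D" using w0[of "?x lam i"] by (auto simp: w_def split: if_splits)
      then obtain j where j: "?x lam i = ?x mu j" by blast
      then show ?thesis using alpha_independent[OF j] by simp
    next
      case False
      then have "i \<notin> keys lam" "i \<notin> keys mu"
        using \<open>keys lam \<subseteq> {..<n}\<close> \<open>keys mu \<subseteq> {..<n}\<close> by auto
      then show ?thesis by (simp add: in_keys_iff)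
    qed
  qed
qed

lemma macdonald_setting_concrete: "macdonald_setting q_param t_param"
  by (intro macdonald_setting.intro macdonald_setting_axioms.intro qt_params_concrete
      eigenvalue_inj_concrete anisotropic_concrete)

section \<open>The Jack limit\<close>

interpretation MP: macdonald_setting q_param t_param
  by (rule macdonald_setting_concrete)

text \<open>As \<open>P_lam\<close> is orthogonal to everything below \<open>lam\<close>, its squared norm equals its product with \<open>m_lam\<close>. If
  \<open>P_lam\<close> had a pole of order \<open>k\<close>, the squared norm would have a pole of order \<open>2k\<close>, since the limiting form is
  positive definite, but the product with \<open>m_lam\<close> has a pole of order at most \<open>k\<close>.\<close>

lemma mac_regular:
  assumes lam: "is_partition lam"
  shows "coeffs_in regular (MP.mac lam)"
proof (rule ccontr)
  let ?P = "MP.mac lam" and ?form = "qt_form q_param t_param"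
  assume nr: "\<not> coeffs_in regular ?P"
  obtain c e where c: "c \<noteq> 0" "e \<in> keys ?P" "c * lookup ?P e = 1" "coeffs_in regular (mconst c * ?P)"
    "coeffs_in regular ?P \<or> has_limit_0 c 0"
    by (rule normalize_order[OF MP.mac_nonzero[OF lam]])
  let ?G = "mconst c * ?P"
  have "lookup ?G e = 1" by (simp add: lookup_mconst_mult c)
  then obtain l where l: "has_limit_0 (?form ?G ?G) l" "l > 0"
    using normalized_form_limit[OF c(4), of e] by (metis in_keys_iff zero_neq_one)
  have "?form ?P (?P - Msym lam) = 0"
    by (rule MP.orthogonal_to_below[OF MP.mac_triangular MP.mac_orthogonal lam MP.mac_triangular[OF lam]])
  moreover have "?form ?P ?P = ?form ?P (?P - Msym lam) + ?form ?P (Msym lam)"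
    by (simp flip: qt_form_add_right)
  ultimately have "?form ?G ?G = c * ?form ?G (Msym lam)"
    by (simp add: qt_form_scale_left qt_form_scale_right)
  moreover have "coeffs_in \<rat> (Msym lam :: ratfun fls mpol)" by (rule coeffs_in_Msym[OF lam])
  then have "coeffs_in regular (Msym lam :: ratfun fls mpol)"
    using Rats_regular unfolding coeffs_in_def by blast
  then obtain m where "has_limit_0 (?form ?G (Msym lam)) m"
    using qt_form_limit[OF c(4) _ finite_keys order_refl] by blast
  moreover have "has_limit_0 c 0" using c(5) nr by blast
  ultimately have "has_limit_0 (?form ?G ?G) (0 * m)"
    using has_limit_0_mult by metis
  then show False using has_limit_0_unique[OF l(1)] l(2) by simp
qed

lemma jack_eq:
  assumes lam: "is_partition lam"
  shows "lookup (jack lam n) e = fls_nth (lookup (in_vars n (MP.mac lam)) e) 0"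
proof -
  let ?h = "in_vars n (MP.mac lam)"
  define g where "g = Poly_Mapping.map (\<lambda>c. fls_nth c 0) ?h"
  have g: "lookup g e = fls_nth (lookup ?h e) 0" for e
    by (simp add: g_def Poly_Mapping.map.rep_eq when_def)
  have reg: "has_limit_0 (lookup ?h e) (fls_nth (lookup ?h e) 0)" for e
    using coeffs_in_in_vars[OF subsemiring_regular mac_regular[OF lam], of n] by (intro regular_limit) (simp add: coeffs_in_def)
  have "jack lam n = g"
    unfolding jack_def MP.macdonald_eq_mac[OF lam]
  proof (rule the_equality)
    show "\<forall>e. has_limit_0 (lookup ?h e) (lookup g e)" using reg g by simp
    show "g' = g" if "\<forall>e. has_limit_0 (lookup ?h e) (lookup g' e)" for g'
      by (rule poly_mapping_eqI) (use that reg g has_limit_0_unique in metis)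
  qed
  then show ?thesis by (simp add: g)
qed

lemma jack_at_ones_limit:
  assumes lam: "is_partition lam"
  shows "has_limit_0 (mpol_value (in_vars n (MP.mac lam)) (\<lambda>i. t_param ^ i)) (jack_at_ones lam n)"
proof -
  let ?h = "in_vars n (MP.mac lam)"
  have reg: "has_limit_0 (lookup ?h e) (lookup (jack lam n) e)" for e
    unfolding jack_eq[OF lam]
    using coeffs_in_in_vars[OF subsemiring_regular mac_regular[OF lam], of n] by (intro regular_limit) (simp add: coeffs_in_def)
  have "has_limit_0 (mpol_value ?h (\<lambda>i. t_param ^ i))
    (\<Sum>e\<in>keys ?h. lookup (jack lam n) e * (\<Prod>i\<in>keys e. (1 ^ i) ^ lookup e i))"
    unfolding mpol_value_def
    by (intro has_limit_0_sum has_limit_0_mult reg has_limit_0_prod has_limit_0_power)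
      (simp add: t_param_eq t_pow_limit)
  also have "(\<Sum>e\<in>keys ?h. lookup (jack lam n) e * (\<Prod>i\<in>keys e. (1 ^ i) ^ lookup e i)) =
      (\<Sum>e\<in>keys ?h. lookup (jack lam n) e)" by simp
  also have "\<dots> = (\<Sum>e\<in>keys (jack lam n). lookup (jack lam n) e)"
    by (rule sum.mono_neutral_right) (auto simp: in_keys_iff jack_eq[OF lam])
  also have "\<dots> = jack_at_ones lam n"
    by (simp add: jack_at_ones_def mpol_value_def)
  finally show ?thesis .
qed

definition jack_content_prod :: "nat \<Rightarrow> (nat \<Rightarrow>\<^sub>0 nat) \<Rightarrow> ratfun" where
  "jack_content_prod n lam = (\<Prod>i\<in>keys lam. \<Prod>j<lookup lam i. of_nat n + alpha * of_nat j - of_nat i)"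

lemma jack_factor_pos: "i < n \<Longrightarrow> of_nat n + alpha * of_nat j - of_nat i > (0 :: ratfun)"
proof -
  assume "i < n"
  then have "(of_nat i :: ratfun) < of_nat n" by simp
  moreover have "alpha * of_nat j \<ge> 0" using alpha_pos by simp
  ultimately show ?thesis by (metis add_strict_increasing2 diff_gt_0_iff_gt add.commute)
qed

lemma jack_content_prod_nonzero: "keys lam \<subseteq> {..<n} \<Longrightarrow> jack_content_prod n lam \<noteq> 0"
  using jack_factor_pos unfolding jack_content_prod_def
  by (auto simp: prod_zero_iff) (metis lessThan_iff less_irrefl subsetD)

lemma content_prod_limit:
  "has_limit_0 (MP.content_prod (t_param ^ n) lam / fls_X ^ psize lam) (jack_content_prod n lam)"
proof -
  let ?x = "\<lambda>i j. of_nat n + alpha * of_nat j - of_nat i :: ratfun"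
  have "MP.content_prod (t_param ^ n) lam / fls_X ^ psize lam =
    (\<Prod>i\<in>keys lam. \<Prod>j<lookup lam i. (t_pow (?x i j) - 1) / fls_X)"
  proof -
    have "t_param ^ n * q_param ^ j / t_param ^ i = t_pow (?x i j)" for i j
      by (simp add: t_pow_diff t_pow_add t_param_eq q_param_eq t_pow_power mult.commute)
    moreover have "(fls_X :: ratfun fls) ^ psize lam = (\<Prod>i\<in>keys lam. fls_X ^ lookup lam i)"
      by (simp add: psize_def power_sum)
    moreover have "(\<Prod>j<m. a j / z) = (\<Prod>j<m. a j) / z ^ m" for a and z :: "ratfun fls" and m :: nat
      by (simp add: prod_dividef)
    ultimately show ?thesis unfolding MP.content_prod_def by (simp only: prod_dividef)
  qed
  then show ?thesis unfolding jack_content_prod_def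
    by (simp only:) (intro has_limit_0_prod t_pow_derivative)
qed

text \<open>Every factor \<open>t^n q^j / t^i - 1\<close> of the specialization vanishes at \<open>z = 0\<close> with derivative \<open>n + alpha j - i\<close>, so
  \<open>z\<close> is divided out once for each cell. The remaining constant has a limit because it is the quotient of two
  quantities with limits at \<open>n = |lam|\<close>, where the denominator has a nonzero one.\<close>

theorem jack_evaluation:
  assumes lam: "is_partition lam"
  shows "\<exists>C. \<forall>n. jack_at_ones lam n = C * jack_content_prod n lam"
proof -
  obtain c where c: "\<And>u. u \<noteq> 0 \<Longrightarrow> MP.spec u (MP.mac lam) = c * MP.content_prod u lam"
    using MP.principal_specialization[OF lam] by blast
  let ?x = "\<lambda>n. MP.content_prod (t_param ^ n) lam / fls_X ^ psize lam"
  define C where "C = c * fls_X ^ psize lam"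
  have J: "has_limit_0 (C * ?x n) (jack_at_ones lam n)" for n
  proof -
    have X: "fls_X ^ psize lam \<noteq> (0 :: ratfun fls)" by simp
    have tn: "t_param ^ n \<noteq> 0" using MP.t_nonzero by simp
    have "(a * z) * (b / z) = a * b" if "z \<noteq> 0" for a b z :: "ratfun fls" using that by simp
    then have "C * ?x n = c * MP.content_prod (t_param ^ n) lam"
      unfolding C_def by (metis X)
    then have "C * ?x n = mpol_value (in_vars n (MP.mac lam)) (\<lambda>i. t_param ^ i)"
      unfolding MP.spec_power_t[symmetric] by (simp only: c[OF tn])
    then show ?thesis using jack_at_ones_limit[OF lam] by simp
  qed
  let ?N = "psize lam"
  have N: "jack_content_prod ?N lam \<noteq> 0"
    by (rule jack_content_prod_nonzero[OF partition_keys_subset[OF lam order_refl]])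
  have xN: "?x ?N \<noteq> 0"
  proof
    assume "?x ?N = 0"
    then have "has_limit_0 0 (jack_content_prod ?N lam)" using content_prod_limit[of ?N lam] by (simp only:)
    then have "0 = jack_content_prod ?N lam" by (rule has_limit_0_unique[OF has_limit_0_0])
    then show False using N by simp
  qed
  define C0 where "C0 = jack_at_ones lam ?N / jack_content_prod ?N lam"
  have "has_limit_0 (C * ?x ?N / ?x ?N) C0"
    unfolding C0_def by (rule has_limit_0_divide[OF J content_prod_limit N])
  moreover have "C * ?x ?N / ?x ?N = C" using xN by (rule nonzero_mult_div_cancel_right)
  ultimately have C0: "has_limit_0 C C0" by simp
  have "jack_at_ones lam n = C0 * jack_content_prod n lam" for n
    by (rule has_limit_0_unique[OF J has_limit_0_mult[OF C0 content_prod_limit]])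
  then show ?thesis by blast
qed

lemma jack_at_ones_add_column:
  assumes lam: "is_partition lam" "keys lam \<subseteq> {..<n}"
  shows "jack_at_ones (lam + column n) n = jack_at_ones lam n"
proof -
  let ?x = "\<lambda>i. t_param ^ i :: ratfun fls"
  have "mpol_value (in_vars n (MP.mac (lam + column n))) ?x =
    monomial_value ?x (column n) * mpol_value (in_vars n (MP.mac lam)) ?x"
    unfolding MP.in_vars_mac_add_column[OF lam] mpol_value_eq_msub msub_mult[OF semiring_hom_id]
    by (simp add: msub_single[OF semiring_hom_id])
  moreover have "has_limit_0 (monomial_value ?x (column n)) (\<Prod>i\<in>keys (column n). (1 ^ i) ^ lookup (column n) i)"
    unfolding monomial_value_def
    by (intro has_limit_0_prod has_limit_0_power) (simp add: t_param_eq t_pow_limit)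
  ultimately have "has_limit_0 (mpol_value (in_vars n (MP.mac (lam + column n))) ?x) (jack_at_ones lam n)"
    using has_limit_0_mult[OF _ jack_at_ones_limit[OF lam(1), of n]] by fastforce
  then show ?thesis
    using has_limit_0_unique jack_at_ones_limit[OF is_partition_add[OF lam(1) is_partition_column]] by blast
qed

definition rectangle :: "nat \<Rightarrow> nat \<Rightarrow> (nat \<Rightarrow>\<^sub>0 nat)" where
  "rectangle w n = (\<Sum>i<n. single i w)"

lemma lookup_rectangle: "lookup (rectangle w n) i = (if i < n then w else 0)"
  unfolding rectangle_def by (rule lookup_sum_single)

lemma is_partition_rectangle: "is_partition (rectangle w n)"
  by (auto simp: is_partition_def antimono_def lookup_rectangle)

lemma keys_rectangle: "keys (rectangle w n) \<subseteq> {..<n}"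
  by (auto simp: in_keys_iff lookup_rectangle split: if_splits)

lemma jack_at_ones_add_rectangle:
  assumes lam: "is_partition lam" "keys lam \<subseteq> {..<n}"
  shows "jack_at_ones (lam + rectangle w n) n = jack_at_ones lam n"
proof (induction w)
  case 0
  have "rectangle 0 n = 0" by (rule poly_mapping_eqI) (simp add: lookup_rectangle)
  then show ?case by simp
next
  case (Suc w)
  have "lam + rectangle (Suc w) n = (lam + rectangle w n) + column n"
    by (rule poly_mapping_eqI) (simp add: lookup_add lookup_rectangle lookup_column)
  moreover have "keys (lam + rectangle w n) \<subseteq> {..<n}"
    using keys_add[of lam "rectangle w n"] keys_rectangle[of w n] lam(2) by blast
  ultimately show ?case
    using jack_at_ones_add_column[OF is_partition_add[OF lam(1) is_partition_rectangle]] Suc by simp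
qed

section \<open>Staircases\<close>

lemma lookup_staircase:
  assumes s: "s > 0"
  shows "lookup (staircase w s k) i = w * (k - 1 - i div s)"
proof -
  let ?L = "\<lambda>k. concat (map (\<lambda>j. replicate s (w * j)) (rev [1..<k]))"
  have "nth_default 0 (?L k) i = w * (k - 1 - i div s)"
  proof (induction k arbitrary: i)
    case (Suc k)
    show ?case
    proof (cases "k = 0")
      case False
      then have L: "?L (Suc k) = replicate s (w * k) @ ?L k" by simp
      show ?thesis
      proof (cases "i < s")
        case True
        then show ?thesis unfolding L by (simp add: nth_default_append)
      next
        case False
        then have "i div s = Suc ((i - s) div s)" using s by (simp add: le_div_geq)
        then show ?thesis unfolding L using Suc[of "i - s"] False by (simp add: nth_default_append)
      qed
    qed simp
  qed simp
  then show ?thesis by (simp add: staircase_def)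
qed

lemma is_partition_staircase: "s > 0 \<Longrightarrow> is_partition (staircase w s k)"
  by (auto simp: is_partition_def antimono_def lookup_staircase div_le_mono diff_le_mono2)

lemma keys_staircase:
  assumes "s > 0" shows "keys (staircase w s (Suc k)) \<subseteq> {..<s * k}"
proof
  fix i assume "i \<in> keys (staircase w s (Suc k))"
  then have "i div s < k" by (auto simp: in_keys_iff lookup_staircase[OF assms])
  then have "i < k * s" using assms by (simp add: div_less_iff_less_mult)
  then show "i \<in> {..<s * k}" by (simp add: mult.commute)
qed

lemma staircase_Suc:
  assumes s: "s > 0" and k: "k > 0"
  shows "staircase w s (Suc k) = staircase w s k + rectangle w (s * k)"
proof (rule poly_mapping_eqI)
  fix i
  have "i < s * k \<longleftrightarrow> i div s < k" using s by (simp add: div_less_iff_less_mult mult.commute)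
  then have "k - i div s = (k - 1 - i div s) + (if i < s * k then 1 else 0)" using k by auto
  then have "w * (k - i div s) = w * (k - 1 - i div s) + (if i < s * k then w else 0)"
    by (simp only: distrib_left if_distrib[of "(*) w"] mult_1_right mult_0_right)
  then show "lookup (staircase w s (Suc k)) i = lookup (staircase w s k + rectangle w (s * k)) i"
    by (simp add: lookup_staircase[OF s] lookup_add lookup_rectangle)
qed

text \<open>The product of \<open>n + alpha j - i\<close> over the cells of \<open>delta_(k+1)\<close> outside \<open>delta_k\<close>; row \<open>i\<close> of \<open>delta_k\<close> has
  \<open>w (k - 1 - i div s)\<close> cells.\<close>

definition strip_prod :: "nat \<Rightarrow> nat \<Rightarrow> nat \<Rightarrow> nat \<Rightarrow> ratfun" where
  "strip_prod w s k n = (\<Prod>i<s * k. \<Prod>j<w. of_nat n + alpha * of_nat (w * (k - 1 - i div s) + j) - of_nat i)"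

lemma jack_content_prod_staircase_Suc:
  assumes s: "s > 0" and k: "k > 0"
  shows "jack_content_prod n (staircase w s (Suc k)) = jack_content_prod n (staircase w s k) * strip_prod w s k n"
proof -
  let ?f = "\<lambda>i j. of_nat n + alpha * of_nat j - of_nat i :: ratfun"
  have sup: "jack_content_prod n lam = (\<Prod>i<s * k. \<Prod>j<lookup lam i. ?f i j)" if "keys lam \<subseteq> {..<s * k}" for lam
    unfolding jack_content_prod_def by (rule prod.mono_neutral_left) (use that in \<open>auto simp: in_keys_iff\<close>)
  have "keys (staircase w s k) \<subseteq> {..<s * (k - 1)}" using keys_staircase[OF s, of w "k - 1"] k by simp
  also have "\<dots> \<subseteq> {..<s * k}" by auto
  finally have k0: "keys (staircase w s k) \<subseteq> {..<s * k}" .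
  have row: "(\<Prod>j<a + w. ?f i j) = (\<Prod>j<a. ?f i j) * (\<Prod>j<w. ?f i (a + j))" for a i
    by (induction w) (simp_all add: mult_ac)
  have "jack_content_prod n (staircase w s (Suc k)) = (\<Prod>i<s * k. \<Prod>j<lookup (staircase w s (Suc k)) i. ?f i j)"
    by (rule sup[OF keys_staircase[OF s]])
  also have "\<dots> = (\<Prod>i<s * k. \<Prod>j<lookup (staircase w s k) i + w. ?f i j)"
    by (rule prod.cong) (auto simp: staircase_Suc[OF s k] lookup_add lookup_rectangle)
  finally show ?thesis
    unfolding row prod.distrib sup[OF k0] strip_prod_def lookup_staircase[OF s] .
qed

lemma strip_prod_nonzero:
  assumes "n \<ge> s * k"
  shows "strip_prod w s k n \<noteq> 0"
proof -
  have "of_nat n + alpha * of_nat j - of_nat i \<noteq> (0 :: ratfun)" if "i < s * k" for i j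
    using jack_factor_pos[of i n j] that assms by simp
  then show ?thesis unfolding strip_prod_def by (simp add: prod_zero_iff del: of_nat_add of_nat_mult)
qed

text \<open>Induction on \<open>k\<close>: at \<open>n = s k\<close> the value agrees with that of the previous staircase, so the constant in the
  evaluation is nonzero, and for \<open>n \<ge> s k\<close> all factors are positive.\<close>

lemma jack_at_ones_staircase_nonzero:
  assumes s: "s > 0"
  shows "n \<ge> s * k \<Longrightarrow> jack_at_ones (staircase w s (Suc k)) n \<noteq> 0"
proof (induction k arbitrary: n)
  case 0
  have "staircase w s (Suc 0) = 0" by (rule poly_mapping_eqI) (simp add: lookup_staircase[OF s])
  moreover have "has_limit_0 1 (jack_at_ones 0 n)"
    using jack_at_ones_limit[OF is_partition_0, of n] MP.mac_0
    by (simp add: in_vars_1 mpol_value_eq_msub semiring_hom_1[OF semiring_hom_msub[OF semiring_hom_id]])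
  ultimately show ?case using has_limit_0_unique[OF has_limit_0_1] by fastforce
next
  case (Suc k)
  let ?lam = "staircase w s (Suc (Suc k))" and ?N = "s * Suc k"
  obtain C where C: "\<And>n. jack_at_ones ?lam n = C * jack_content_prod n ?lam"
    using jack_evaluation[OF is_partition_staircase[OF s]] by blast
  have "keys (staircase w s (Suc k)) \<subseteq> {..<?N}"
    using keys_staircase[OF s, of w k] by (auto intro: less_le_trans)
  then have "jack_at_ones ?lam ?N = jack_at_ones (staircase w s (Suc k)) ?N"
    unfolding staircase_Suc[OF s zero_less_Suc[of k]]
    by (rule jack_at_ones_add_rectangle[OF is_partition_staircase[OF s]])
  also have "\<dots> \<noteq> 0" by (rule Suc.IH) simp
  finally have "C \<noteq> 0" using C[of ?N] by auto
  moreover have "keys ?lam \<subseteq> {..<n}" using keys_staircase[OF s, of w "Suc k"] Suc.prems by force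
  ultimately show ?case using C[of n] jack_content_prod_nonzero by simp
qed

text \<open>The evaluation constants of the two staircases are related by comparing their equal values at \<open>n = s k\<close>.\<close>

theorem jack_staircase_ratio:
  assumes s: "s > 0" and k: "k > 0" and n: "n \<ge> s * k"
  shows "jack_at_ones (staircase w s (Suc k)) n / jack_at_ones (staircase w s k) n =
    strip_prod w s k n / strip_prod w s k (s * k)"
proof -
  let ?lam = "staircase w s (Suc k)" and ?mu = "staircase w s k" and ?N = "s * k"
  obtain C where C: "\<And>n. jack_at_ones ?lam n = C * jack_content_prod n ?lam"
    using jack_evaluation[OF is_partition_staircase[OF s]] by blast
  obtain D where D: "\<And>n. jack_at_ones ?mu n = D * jack_content_prod n ?mu"
    using jack_evaluation[OF is_partition_staircase[OF s]] by blast
  obtain k' where k': "k = Suc k'" using k by (cases k) auto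
  have "keys ?mu \<subseteq> {..<?N}" using keys_staircase[OF s, of w k'] k' by (auto intro: less_le_trans)
  then have "jack_at_ones ?lam ?N = jack_at_ones ?mu ?N"
    unfolding staircase_Suc[OF s k] by (rule jack_at_ones_add_rectangle[OF is_partition_staircase[OF s]])
  moreover have nz: "jack_at_ones ?mu m \<noteq> 0" if "m \<ge> ?N" for m
    using jack_at_ones_staircase_nonzero[OF s, of k' m w] that k' by simp
  ultimately have "C * strip_prod w s k ?N = D"
    using C[of ?N] D[of ?N] nz[of ?N] jack_content_prod_staircase_Suc[OF s k, of ?N w] by auto
  then have "jack_at_ones ?lam n * strip_prod w s k ?N = jack_at_ones ?mu n * strip_prod w s k n"
    unfolding C[of n] D[of n] jack_content_prod_staircase_Suc[OF s k] by (auto simp: mult_ac)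
  then show ?thesis
    using nz[OF n] strip_prod_nonzero[of s k ?N w] by (simp add: frac_eq_eq mult.commute)
qed

lemma centered_prod_eq:
  "centered_prod w s k x a =
    (\<Prod>r<k. \<Prod>i<s. \<Prod>j<w. x + a * ((of_nat j - (of_nat w - 1) / 2) + of_nat w * (of_nat r - (of_nat k - 1) / 2))
       + (of_nat i - (of_nat s - 1) / 2) + of_nat s * (of_nat r - (of_nat k - 1) / 2))"
proof -
  have inj: "inj_on (\<lambda>r. of_nat r - (of_nat m - 1) / 2 :: 'a) {..<m}" for m
    by (auto simp: inj_on_def)
  show ?thesis
    unfolding centered_prod_def centered_def
    by (simp add: prod.cartesian_product[symmetric] prod.reindex[OF inj] o_def)
qed

text \<open>The indices \<open>r\<close>, \<open>i\<close> of the centered product count the rows from the bottom, and the centering shifts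
  add up to the constant added to \<open>n\<close>.\<close>

lemma strip_prod_eq_centered_prod:
  assumes s: "s > 0"
  shows "strip_prod w s k n = centered_prod w s k
    (of_nat n + (alpha * (of_nat w * of_nat k - 1) - (of_nat s * of_nat k - 1)) / 2) alpha"
proof -
  let ?g = "\<lambda>i. \<Prod>j<w. of_nat n + alpha * of_nat (w * (k - 1 - i div s) + j) - of_nat i :: ratfun"
  have "strip_prod w s k n = (\<Prod>i<k * s. ?g i)"
    unfolding strip_prod_def mult.commute[of s k] ..
  also have "\<dots> = (\<Prod>i<k * s. ?g (k * s - Suc i))"
    by (rule prod.nat_diff_reindex[symmetric])
  also have "\<dots> = (\<Prod>r<k. \<Prod>i\<in>{r * s..<r * s + s}. ?g (k * s - Suc i))"
    by (rule prod.nat_group[symmetric])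
  also have "\<dots> = (\<Prod>r<k. \<Prod>i<s. ?g (k * s - Suc (r * s + i)))"
  proof (rule prod.cong[OF refl])
    fix r
    show "(\<Prod>i\<in>{r * s..<r * s + s}. ?g (k * s - Suc i)) = (\<Prod>i<s. ?g (k * s - Suc (r * s + i)))"
      by (rule prod.reindex_bij_witness[of _ "\<lambda>i. r * s + i" "\<lambda>i. i - r * s"]) auto
  qed
  also have "\<dots> = centered_prod w s k
    (of_nat n + (alpha * (of_nat w * of_nat k - 1) - (of_nat s * of_nat k - 1)) / 2) alpha"
    unfolding centered_prod_eq
  proof (intro prod.cong refl)
    fix r i j assume "r \<in> {..<k}" "i \<in> {..<s}" "j \<in> {..<w}"
    then have r: "r < k" and i: "i < s" by auto
    obtain d where d: "k = Suc (r + d)" using r less_iff_Suc_add by auto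
    obtain c where c: "s = Suc (i + c)" using i less_iff_Suc_add by auto
    have ix: "k * s - Suc (r * s + i) = d * s + c" by (simp add: d c algebra_simps)
    have "c < s" using c by simp
    then have "(d * s + c) div s = d" by simp
    then have "k - 1 - (k * s - Suc (r * s + i)) div s = r" unfolding ix by (simp add: d)
    moreover have "of_nat (k * s - Suc (r * s + i)) = (of_nat k * of_nat s - 1 - of_nat r * of_nat s - of_nat i :: ratfun)"
      unfolding ix by (simp add: d c algebra_simps)
    ultimately show "of_nat n + alpha * of_nat (w * (k - 1 - (k * s - Suc (r * s + i)) div s) + j) - of_nat (k * s - Suc (r * s + i)) =
      of_nat n + (alpha * (of_nat w * of_nat k - 1) - (of_nat s * of_nat k - 1)) / 2 +
       alpha * ((of_nat j - (of_nat w - 1) / 2) + of_nat w * (of_nat r - (of_nat k - 1) / 2)) +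
       (of_nat i - (of_nat s - 1) / 2) + of_nat s * (of_nat r - (of_nat k - 1) / 2)"
      by (simp add: field_simps)
  qed
  finally show ?thesis .
qed

theorem proposition7p10:
  fixes k w s n :: nat
  assumes "k > 0" and "w > 0" and "s > 0" and "n > 0" and "n \<ge> s * k"
  shows "jack_at_ones (staircase w s (k + 1)) n / jack_at_ones (staircase w s k) n =
    centered_prod w s k
      (of_nat n + (alpha * (of_nat w * of_nat k - 1) - (of_nat s * of_nat k - 1)) / 2) alpha /
    centered_prod w s k
      (of_nat s * of_nat k + (alpha * (of_nat w * of_nat k - 1) - (of_nat s * of_nat k - 1)) / 2) alpha"
proof -
  have "strip_prod w s k (s * k) = centered_prod w s k
      (of_nat s * of_nat k + (alpha * (of_nat w * of_nat k - 1) - (of_nat s * of_nat k - 1)) / 2) alpha"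
    using strip_prod_eq_centered_prod[OF assms(3), of w k "s * k"] by (simp only: of_nat_mult)
  then show ?thesis
    using jack_staircase_ratio[OF assms(3,1,5), of w] strip_prod_eq_centered_prod[OF assms(3), of w k n]
    by (simp only: Suc_eq_plus1)
qed

end
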